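(* Let $k\geqslant 1$, let $\vec{\lambda}\in I_k$, put $\lambda=\overrightarrow{\mathsf{type}}(\vec{\lambda})$ and let $\pi=\pi_\lambda=\{\pi_1<\cdots<\pi_r\}$ with blocks listed in graded last letter order. For a set partition $\gamma=\{\gamma_1<\cdots<\gamma_r\}$ of $[k]$ (blocks listed in graded last letter order) with $\mathsf{type}(\gamma)=\lambda$ and for a $\pi$-tableau $\mathbf{T}$ of shape $\vec{\lambda}$, let $\rho(\ell_\pi^\gamma\otimes\mathbf{T})$ be the sequence of tableaux obtained from $\mathbf{T}$ by replacing each block $\pi_i\in\pi$ with the block $\gamma_i\in\gamma$. Then $\rho$ extends linearly (from the basis of $W^{\vec{\lambda}}_{\mathcal{U}_k}$ formed by the elements $\ell_\pi^\gamma\otimes\mathbf{T}$) to an isomorphism of representations of $\mathcal{U}_k$ $$\rho\colon W^{\vec{\lambda}}_{\mathcal{U}_k}\longrightarrow \mathbb{C}\mathcal{T}_{\vec{\lambda}} .$$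
   Context: **The monoid.** $[k]=\{1,\dots,k\}$, $[\overline{k}]=\{\overline1,\dots,\overline k\}$, $\overline{\overline a}=a$, and $\overline{B}=\{\overline a:a\in B\}$. $\mathcal{U}_k$ is the set of uniform block permutations: set partitions $d$ of $[k]\cup[\overline k]$ with $|B\cap[k]|=|B\cap[\overline k]|$ for every block $B$. $\mathsf{top}(d)$ is the set partition of $[k]$ with blocks $B\cap[k]$, and $\mathsf{bot}(d)$ the one with blocks $\overline{B}\cap[k]$ ($B$ a block of $d$). One also views $d$ as the size-preserving bijection $\mathsf{top}(d)\to\mathsf{bot}(d)$, $B\cap[k]\mapsto\overline B\cap[k]$. The product $dd'$: stack a two-row diagram of $d$ (top row $[k]$, bottom row $[\overline k]$) on top of that of $d'$, identifying bottom vertex $\overline i$ of $d$ with top vertex $i$ of $d'$, take connected components, and delete the middle vertices. This makes $\mathcal{U}_k$ a finite monoid. If $\mathsf{bot}(d)=\mathsf{top}(d')$, then $dd'$ is the bijection $B\mapsto d'(d(B))$. A permutation $\sigma\in\mathfrak{S}_k$ is identified with $\{\{i,\overline{\sigma(i)}\}:i\in[k]\}$. For $\pi\vdash[k]$ (set partition of $[k]$), $e_\pi=\{A\cup\overline A:A\in\pi\}$ is an idempotent. $\mathsf{type}(\pi)$ is the integer partition of the block sizes of $\pi$. **Generators.** $\mathcal{U}_k$ is generated by $s_i$ and $b_i$, $1\leqslant i\leqslant k-1$, where $s_i$ is the transposition of $i,i+1$ and $b_i=e_\pi$ for $\pi$ the set partition whose only non-singleton block is $\{i,i+1\}$. **Graded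 last letter order.** For blocks $A,B$: $A\leqslant B$ if $|A|<|B|$, or if $|A|=|B|$ and $\max A\leqslant\max B$. **Indices.** $I_k=\{(\lambda^{(1)},\dots,\lambda^{(k)}): \lambda^{(i)}\text{ partitions},\ \sum_i i|\lambda^{(i)}|=k\}$; $\overrightarrow{\mathsf{type}}(\vec\lambda)=(1^{a_1}2^{a_2}\cdots k^{a_k})$ with $a_i=|\lambda^{(i)}|$. For $\lambda=(1^{a_1}\cdots k^{a_k})\vdash k$, $\pi_\lambda=\{\{1\},\dots,\{a_1\},\{a_1+1,a_1+2\},\dots,\{a_1+2a_2-1,a_1+2a_2\},\dots\}$ (blocks of consecutive integers, with sizes weakly increasing). **Group and its modules.** $G_\lambda=\{d\in\mathcal{U}_k:\mathsf{top}(d)=\mathsf{bot}(d)=\pi_\lambda\}$, a group with identity $e_{\pi_\lambda}$, which permutes the blocks of each size. A $\pi$-tableau of shape $\vec\lambda$ is a $k$-tuple $\mathbf T=(T^{(1)},\dots,T^{(k)})$ where $T^{(i)}$ is a standard tableau of shape $\lambda^{(i)}$ filled bijectively with the blocks of size $i$ of $\pi$ (increasing along rows and columns in graded last letter order; French notation, longest row at the bottom). $V^{\vec\lambda}_{G_\lambda}$ is the vector space with basis the $\pi_\lambda$-tableaux of shape $\vec\lambda$; it is the tensor product of the Specht modules indexed by $\lambda^{(1)},\dots,\lambda^{(k)}$. The action of $g\in G_\lambda$ permutes entries and then straightens: since the product in $G_\lambda$ is the diagram product ($gh$ is the bijection $h\circ g$), the left action of $g$ replaces each entry $\pi_i$ by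 $g^{-1}(\pi_i)$. A non-standard filling is interpreted as a linear combination of standard ones via the Garnir straightening relations (i.e. a filling $T$ stands for the polytabloid $\sum_{c}\operatorname{sgn}(c)\{cT\}$, $c$ ranging over the column stabilizer of $T$, and is expanded in the basis of polytabloids of standard tableaux), applied in each component. **Induced module.** For $\pi=\pi_\lambda$, $L_\pi=\{d\in\mathcal{U}_k:\mathsf{bot}(d)=\pi\}$; $\mathbb{C}L_\pi$ has left $\mathcal{U}_k$-action $m\odot\ell=m\ell$ if $m\ell\in L_\pi$ and $0$ otherwise, and right $G_\lambda$-action by multiplication. $W^{\vec\lambda}_{\mathcal{U}_k}=\mathbb{C}L_\pi\otimes_{\mathbb{C}G_\lambda}V^{\vec\lambda}_{G_\lambda}$ with $d\cdot(\ell\otimes v)=(d\odot\ell)\otimes v$. For $\gamma$ with $\mathsf{type}(\gamma)=\lambda$, $\ell_\pi^\gamma\in L_\pi$ is the bijection $\gamma\to\pi$ sending $\gamma_i$ to $\pi_i$ for all $i$ (blocks indexed in graded last letter order). **Uniform tableaux.** A uniform tableau of shape $\vec\lambda$ is a sequence $\mathbf S=(S^{(1)},\dots,S^{(k)})$ where $S^{(i)}$ is a tableau of shape $\lambda^{(i)}$ filled with $i$-element subsets of $[k]$, increasing along rows and columns in the last letter order (comparison of maxima), and such that the subsets appearing in $\mathbf S$ form a set partition of $[k]$. $\mathcal{T}_{\vec\lambda}$ is the set of uniform tableaux of shape $\vec\lambda$, and $\mathbb{C}\mathcal{T}_{\vec\lambda}$ the vector space with basis $\mathcal{T}_{\vec\lambda}$.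 It is a left $\mathcal{U}_k$-representation, determined by the generators: $b_i\mathbf S=\mathbf S$ if $i$ and $i+1$ are in the same cell of $\mathbf S$ and $b_i\mathbf S=0$ otherwise; $s_i\mathbf S$ is obtained by interchanging $i$ and $i+1$ in $\mathbf S$ and, if the result is not standard, straightening each component with the Garnir relations (same polytabloid convention). *)

theory Defs
  imports Complex_Main "HOL-Library.Multiset" "HOL-Library.Disjoint_Sets" "HOL-Library.Poly_Mapping"
    "HOL-Combinatorics.Combinatorics" "HOL-Algebra.Algebra" "HOL-Algebra.Algebraic_Closure_Type"
begin

section \<open>Vector spaces and representations\<close>

text \<open>Complex vector spaces are modules, in the sense of HOL-Algebra, over the field of complex
  numbers. A module record extends a ring record; its multiplication and unit are never used.\<close>

abbreviation CC :: "complex ring" where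
  "CC \<equiv> ring_of_type_algebra"

abbreviation scale :: "complex \<Rightarrow> ('b \<Rightarrow>\<^sub>0 complex) \<Rightarrow> ('b \<Rightarrow>\<^sub>0 complex)" where
  "scale c p \<equiv> Poly_Mapping.map ((*) c) p"

abbreviation bvec :: "'b \<Rightarrow> ('b \<Rightarrow>\<^sub>0 complex)" where
  "bvec b \<equiv> Poly_Mapping.single b 1"

definition free_mod :: "'b set \<Rightarrow> (complex, 'b \<Rightarrow>\<^sub>0 complex) module" where
  "free_mod B = \<lparr>carrier = {p. Poly_Mapping.keys p \<subseteq> B},
     mult = (\<lambda>_ _. 0), monoid.one = 0, ring.zero = 0, ring.add = (+), module.smult = scale\<rparr>"

definition lin_ext :: "('a \<Rightarrow> ('b \<Rightarrow>\<^sub>0 complex)) \<Rightarrow> ('a \<Rightarrow>\<^sub>0 complex) \<Rightarrow> ('b \<Rightarrow>\<^sub>0 complex)" where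
  "lin_ext f p = (\<Sum>b\<in>Poly_Mapping.keys p. scale (Poly_Mapping.lookup p b) (f b))"

definition submod_gen :: "(complex, 'v) module \<Rightarrow> 'v set \<Rightarrow> 'v set" where
  "submod_gen V S = \<Inter>{N. submodule N CC V \<and> S \<subseteq> N}"

text \<open>In the quotient by \<open>N\<close>, the scalar multiple of the coset \<open>N + x\<close> is \<open>N + c x\<close>, written as the
  sum of the sets \<open>N\<close> and \<open>c (N + x)\<close> so that \<open>c = 0\<close> is covered.\<close>

definition quot_mod :: "(complex, 'v) module \<Rightarrow> 'v set \<Rightarrow> (complex, 'v set) module" where
  "quot_mod V N = \<lparr>carrier = a_rcosets\<^bsub>V\<^esub> N,
     mult = (\<lambda>_ _. N), monoid.one = N, ring.zero = N, ring.add = set_add V,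
     module.smult = (\<lambda>c Y. N <+>\<^bsub>V\<^esub> ((\<lambda>x. c \<odot>\<^bsub>V\<^esub> x) ` Y))\<rparr>"

definition linear_map :: "(complex, 'v) module \<Rightarrow> (complex, 'w) module \<Rightarrow> ('v \<Rightarrow> 'w) \<Rightarrow> bool" where
  "linear_map V W f \<longleftrightarrow> f \<in> carrier V \<rightarrow> carrier W \<and>
     (\<forall>x\<in>carrier V. \<forall>y\<in>carrier V. f (x \<oplus>\<^bsub>V\<^esub> y) = f x \<oplus>\<^bsub>W\<^esub> f y) \<and>
     (\<forall>c. \<forall>x\<in>carrier V. f (c \<odot>\<^bsub>V\<^esub> x) = c \<odot>\<^bsub>W\<^esub> f x)"

definition is_basis :: "(complex, 'v) module \<Rightarrow> 'i set \<Rightarrow> ('i \<Rightarrow> 'v) \<Rightarrow> bool" where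
  "is_basis V I b \<longleftrightarrow> finite I \<and> b \<in> I \<rightarrow> carrier V \<and>
     (\<forall>v\<in>carrier V. \<exists>!c. c \<in> I \<rightarrow>\<^sub>E UNIV \<and> v = (\<Oplus>\<^bsub>V\<^esub>i\<in>I. c i \<odot>\<^bsub>V\<^esub> b i))"

definition representation ::
  "('g, 'x) monoid_scheme \<Rightarrow> (complex, 'v) module \<Rightarrow> ('g \<Rightarrow> 'v \<Rightarrow> 'v) \<Rightarrow> bool" where
  "representation M V act \<longleftrightarrow> monoid M \<and> module CC V \<and>
     (\<forall>d\<in>carrier M. linear_map V V (act d)) \<and>
     (\<forall>d\<in>carrier M. \<forall>d'\<in>carrier M. \<forall>v\<in>carrier V. act (d \<otimes>\<^bsub>M\<^esub> d') v = act d (act d' v)) \<and>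
     (\<forall>v\<in>carrier V. act \<one>\<^bsub>M\<^esub> v = v)"

definition rep_iso :: "('g, 'x) monoid_scheme \<Rightarrow>
    (complex, 'v) module \<Rightarrow> ('g \<Rightarrow> 'v \<Rightarrow> 'v) \<Rightarrow>
    (complex, 'w) module \<Rightarrow> ('g \<Rightarrow> 'w \<Rightarrow> 'w) \<Rightarrow> ('v \<Rightarrow> 'w) \<Rightarrow> bool" where
  "rep_iso M V actV W actW f \<longleftrightarrow> representation M V actV \<and> representation M W actW \<and>
     linear_map V W f \<and> bij_betw f (carrier V) (carrier W) \<and>
     (\<forall>d\<in>carrier M. \<forall>v\<in>carrier V. f (actV d v) = actW d (f v))"


subsection \<open>Tensor product over a group algebra\<close>

text \<open>\<open>M \<otimes>\<^bsub>\<complex>G\<^esub> V\<close> for a right \<open>G\<close>-module \<open>M\<close> and a left \<open>G\<close>-module \<open>V\<close>: the free vector space on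
  \<open>M \<times> V\<close> modulo bilinearity and \<open>m g \<otimes> v = m \<otimes> g v\<close>. Given bilinearity, balancedness for \<open>G\<close> is
  the same as balancedness for the group algebra.\<close>

definition tensor_rels :: "('g, 'x) monoid_scheme \<Rightarrow>
    (complex, 'm) module \<Rightarrow> ('m \<Rightarrow> 'g \<Rightarrow> 'm) \<Rightarrow> (complex, 'v) module \<Rightarrow> ('g \<Rightarrow> 'v \<Rightarrow> 'v) \<Rightarrow>
    ('m \<times> 'v \<Rightarrow>\<^sub>0 complex) set" where
  "tensor_rels G M ract V lact =
     {bvec (m \<oplus>\<^bsub>M\<^esub> m', v) - bvec (m, v) - bvec (m', v) | m m' v.
        m \<in> carrier M \<and> m' \<in> carrier M \<and> v \<in> carrier V} \<union>
     {bvec (m, v \<oplus>\<^bsub>V\<^esub> v') - bvec (m, v) - bvec (m, v') | m v v'.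
        m \<in> carrier M \<and> v \<in> carrier V \<and> v' \<in> carrier V} \<union>
     {bvec (c \<odot>\<^bsub>M\<^esub> m, v) - scale c (bvec (m, v)) | c m v. m \<in> carrier M \<and> v \<in> carrier V} \<union>
     {bvec (m, c \<odot>\<^bsub>V\<^esub> v) - scale c (bvec (m, v)) | c m v. m \<in> carrier M \<and> v \<in> carrier V} \<union>
     {bvec (ract m g, v) - bvec (m, lact g v) | m g v.
        m \<in> carrier M \<and> g \<in> carrier G \<and> v \<in> carrier V}"

definition tensor_free ::
  "(complex, 'm) module \<Rightarrow> (complex, 'v) module \<Rightarrow> (complex, 'm \<times> 'v \<Rightarrow>\<^sub>0 complex) module" where
  "tensor_free M V = free_mod (carrier M \<times> carrier V)"

definition tensor_ker :: "('g, 'x) monoid_scheme \<Rightarrow>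
    (complex, 'm) module \<Rightarrow> ('m \<Rightarrow> 'g \<Rightarrow> 'm) \<Rightarrow> (complex, 'v) module \<Rightarrow> ('g \<Rightarrow> 'v \<Rightarrow> 'v) \<Rightarrow>
    ('m \<times> 'v \<Rightarrow>\<^sub>0 complex) set" where
  "tensor_ker G M ract V lact = submod_gen (tensor_free M V) (tensor_rels G M ract V lact)"

definition tensor_mod :: "('g, 'x) monoid_scheme \<Rightarrow>
    (complex, 'm) module \<Rightarrow> ('m \<Rightarrow> 'g \<Rightarrow> 'm) \<Rightarrow> (complex, 'v) module \<Rightarrow> ('g \<Rightarrow> 'v \<Rightarrow> 'v) \<Rightarrow>
    (complex, ('m \<times> 'v \<Rightarrow>\<^sub>0 complex) set) module" where
  "tensor_mod G M ract V lact = quot_mod (tensor_free M V) (tensor_ker G M ract V lact)"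

definition pure_tensor :: "('g, 'x) monoid_scheme \<Rightarrow>
    (complex, 'm) module \<Rightarrow> ('m \<Rightarrow> 'g \<Rightarrow> 'm) \<Rightarrow> (complex, 'v) module \<Rightarrow> ('g \<Rightarrow> 'v \<Rightarrow> 'v) \<Rightarrow>
    'm \<Rightarrow> 'v \<Rightarrow> ('m \<times> 'v \<Rightarrow>\<^sub>0 complex) set" where
  "pure_tensor G M ract V lact m v =
     tensor_ker G M ract V lact +>\<^bsub>tensor_free M V\<^esub> bvec (m, v)"

text \<open>The map induced on the quotient by \<open>m \<otimes> v \<mapsto> f m \<otimes> v\<close>: the coset \<open>N + x\<close> goes to the coset
  of the image of \<open>x\<close>, written as the sum of \<open>N\<close> and the image of the whole coset.\<close>

definition tensor_left :: "('g, 'x) monoid_scheme \<Rightarrow>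
    (complex, 'm) module \<Rightarrow> ('m \<Rightarrow> 'g \<Rightarrow> 'm) \<Rightarrow> (complex, 'v) module \<Rightarrow> ('g \<Rightarrow> 'v \<Rightarrow> 'v) \<Rightarrow>
    ('m \<Rightarrow> 'm) \<Rightarrow> ('m \<times> 'v \<Rightarrow>\<^sub>0 complex) set \<Rightarrow> ('m \<times> 'v \<Rightarrow>\<^sub>0 complex) set" where
  "tensor_left G M ract V lact f Y =
     tensor_ker G M ract V lact <+>\<^bsub>tensor_free M V\<^esub> (lin_ext (\<lambda>(m, v). bvec (f m, v)) ` Y)"


section \<open>Uniform block permutations\<close>

text \<open>The vertex \<open>i\<close> of the top row is \<open>Inl i\<close> and the vertex \<open>\<bar>i\<close> of the bottom row is \<open>Inr i\<close>.\<close>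

type_synonym diagram = "(nat + nat) set set"

definition ubp_set :: "nat \<Rightarrow> diagram set" where
  "ubp_set k = {d. partition_on (Inl ` {1..k} \<union> Inr ` {1..k}) d \<and>
     (\<forall>B\<in>d. card (Inl -` B) = card (Inr -` B))}"

definition top_part :: "diagram \<Rightarrow> nat set set" where
  "top_part d = (\<lambda>B. Inl -` B) ` d"

definition bot_part :: "diagram \<Rightarrow> nat set set" where
  "bot_part d = (\<lambda>B. Inr -` B) ` d"

text \<open>A diagram as a map from the blocks of its top to the blocks of its bottom.\<close>

definition block_map :: "diagram \<Rightarrow> nat set \<Rightarrow> nat set" where
  "block_map d A = (THE C. Inl ` A \<union> Inr ` C \<in> d)"

text \<open>In the stacked diagram the top, middle and bottom vertices are \<open>Inl i\<close>, \<open>Inr (Inl i)\<close> and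
  \<open>Inr (Inr i)\<close>; two vertices lying in a common block of either factor are adjacent.\<close>

definition stack :: "diagram \<Rightarrow> diagram \<Rightarrow> (nat + nat + nat) set set" where
  "stack d d' = (\<lambda>B. map_sum id Inl ` B) ` d \<union> (\<lambda>B. Inr ` B) ` d'"

definition ubp_mult :: "diagram \<Rightarrow> diagram \<Rightarrow> diagram" where
  "ubp_mult d d' =
     (\<lambda>C. map_sum id Inr -` C) ` (\<Union>(stack d d') // (\<Union>B\<in>stack d d'. B \<times> B)\<^sup>*) - {{}}"

definition perm_diag :: "nat \<Rightarrow> (nat \<Rightarrow> nat) \<Rightarrow> diagram" where
  "perm_diag k \<sigma> = (\<lambda>i. {Inl i, Inr (\<sigma> i)}) ` {1..k}"

definition e_diag :: "nat set set \<Rightarrow> diagram" where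
  "e_diag \<pi> = (\<lambda>A. Inl ` A \<union> Inr ` A) ` \<pi>"

definition ubp :: "nat \<Rightarrow> diagram monoid" where
  "ubp k = \<lparr>carrier = ubp_set k, mult = ubp_mult, one = perm_diag k id\<rparr>"

definition s_gen :: "nat \<Rightarrow> nat \<Rightarrow> diagram" where
  "s_gen k i = perm_diag k (Transposition.transpose i (i + 1))"

definition b_gen :: "nat \<Rightarrow> nat \<Rightarrow> diagram" where
  "b_gen k i = e_diag (insert {i, i + 1} ((\<lambda>j. {j}) ` ({1..k} - {i, i + 1})))"


section \<open>Orders on blocks\<close>

definition gll_le :: "nat set \<Rightarrow> nat set \<Rightarrow> bool" where
  "gll_le A B \<longleftrightarrow> card A < card B \<or> (card A = card B \<and> Max A \<le> Max B)"

definition gll_less :: "nat set \<Rightarrow> nat set \<Rightarrow> bool" where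
  "gll_less A B \<longleftrightarrow> gll_le A B \<and> A \<noteq> B"

definition last_less :: "nat set \<Rightarrow> nat set \<Rightarrow> bool" where
  "last_less A B \<longleftrightarrow> Max A < Max B"

definition blocks :: "nat set set \<Rightarrow> nat set list" where
  "blocks \<pi> = (THE xs. set xs = \<pi> \<and> sorted_wrt gll_less xs)"


section \<open>Shapes and straightening\<close>

definition int_partition :: "nat list \<Rightarrow> bool" where
  "int_partition \<mu> \<longleftrightarrow> sorted_wrt (\<ge>) \<mu> \<and> 0 \<notin> set \<mu>"

text \<open>French notation: row \<open>0\<close> is the longest row, drawn at the bottom, and rows are numbered upwards.\<close>

definition cells :: "nat list \<Rightarrow> (nat \<times> nat) set" where
  "cells \<mu> = {(r, c). r < length \<mu> \<and> c < \<mu> ! r}"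

definition increasing :: "('e \<Rightarrow> 'e \<Rightarrow> bool) \<Rightarrow> nat list \<Rightarrow> (nat \<times> nat \<Rightarrow> 'e) \<Rightarrow> bool" where
  "increasing lt \<mu> T \<longleftrightarrow>
     (\<forall>r c c'. c < c' \<and> (r, c') \<in> cells \<mu> \<longrightarrow> lt (T (r, c)) (T (r, c'))) \<and>
     (\<forall>r r' c. r < r' \<and> (r', c) \<in> cells \<mu> \<longrightarrow> lt (T (r, c)) (T (r', c)))"

definition std_tableaux ::
  "('e \<Rightarrow> 'e \<Rightarrow> bool) \<Rightarrow> nat list \<Rightarrow> 'e set \<Rightarrow> (nat \<times> nat \<Rightarrow> 'e) set" where
  "std_tableaux lt \<mu> Y =
     {T \<in> cells \<mu> \<rightarrow>\<^sub>E Y. bij_betw T (cells \<mu>) Y \<and> increasing lt \<mu> T}"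

text \<open>A tabloid is given by the sets of entries of its rows.\<close>

definition tabloid :: "nat list \<Rightarrow> (nat \<times> nat \<Rightarrow> 'e) \<Rightarrow> nat \<Rightarrow> 'e set" where
  "tabloid \<mu> F = (\<lambda>r. {F (r, c) | c. (r, c) \<in> cells \<mu>})"

definition col_stab :: "nat list \<Rightarrow> (nat \<times> nat \<Rightarrow> 'e) \<Rightarrow> ('e \<Rightarrow> 'e) set" where
  "col_stab \<mu> F = {p. p permutes (F ` cells \<mu>) \<and>
     (\<forall>(r, c)\<in>cells \<mu>. \<exists>r'. (r', c) \<in> cells \<mu> \<and> p (F (r, c)) = F (r', c))}"

definition polytabloid :: "nat list \<Rightarrow> (nat \<times> nat \<Rightarrow> 'e) \<Rightarrow> ((nat \<Rightarrow> 'e set) \<Rightarrow>\<^sub>0 complex)" where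
  "polytabloid \<mu> F =
     (\<Sum>p\<in>col_stab \<mu> F. Poly_Mapping.single (tabloid \<mu> (p \<circ> F)) (of_int (sign p)))"

text \<open>The expansion of an injective filling \<open>F\<close> in terms of standard tableaux with the same entries.
  In particular a standard filling is its own expansion.\<close>

definition straighten ::
  "('e \<Rightarrow> 'e \<Rightarrow> bool) \<Rightarrow> nat list \<Rightarrow> (nat \<times> nat \<Rightarrow> 'e) \<Rightarrow> ((nat \<times> nat \<Rightarrow> 'e) \<Rightarrow>\<^sub>0 complex)" where
  "straighten lt \<mu> F = (THE q.
     Poly_Mapping.keys q \<subseteq> std_tableaux lt \<mu> (F ` cells \<mu>) \<and>
     polytabloid \<mu> F = lin_ext (polytabloid \<mu>) q)"


section \<open>Tuples of shapes and of tableaux\<close>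

text \<open>A \<open>k\<close>-tuple is a function on \<open>{1..k}\<close>, \<open>undefined\<close> elsewhere.\<close>

type_synonym shapes = "nat \<Rightarrow> nat list"
type_synonym tableaux = "nat \<Rightarrow> nat \<times> nat \<Rightarrow> nat set"

definition index_set :: "nat \<Rightarrow> shapes set" where
  "index_set k = {lam \<in> {1..k} \<rightarrow>\<^sub>E {\<mu>. int_partition \<mu>}. (\<Sum>i = 1..k. i * sum_list (lam i)) = k}"

text \<open>Types, being integer partitions, are represented by the multisets of their parts.\<close>

definition vec_type :: "nat \<Rightarrow> shapes \<Rightarrow> nat multiset" where
  "vec_type k lam = (\<Sum>i = 1..k. replicate_mset (sum_list (lam i)) i)"

definition set_type :: "nat set set \<Rightarrow> nat multiset" where
  "set_type \<pi> = image_mset card (mset_set \<pi>)"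

definition pi_of :: "nat multiset \<Rightarrow> nat set set" where
  "pi_of ty = (let ps = sorted_list_of_multiset ty in
     {{sum_list (take j ps) + 1 .. sum_list (take (j + 1) ps)} | j. j < length ps})"

text \<open>Straightening is done in each component and extended multilinearly.\<close>

definition straighten_tuple ::
  "(nat set \<Rightarrow> nat set \<Rightarrow> bool) \<Rightarrow> nat \<Rightarrow> shapes \<Rightarrow> tableaux \<Rightarrow> (tableaux \<Rightarrow>\<^sub>0 complex)" where
  "straighten_tuple lt k lam F =
     (\<Sum>S \<in> (\<Pi>\<^sub>E i\<in>{1..k}. std_tableaux lt (lam i) (F i ` cells (lam i))).
        Poly_Mapping.single S (\<Prod>i = 1..k. Poly_Mapping.lookup (straighten lt (lam i) (F i)) (S i)))"


section \<open>The module of the maximal subgroup\<close>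

definition G_group :: "nat \<Rightarrow> nat set set \<Rightarrow> diagram monoid" where
  "G_group k \<pi> = \<lparr>carrier = {d \<in> ubp_set k. top_part d = \<pi> \<and> bot_part d = \<pi>},
     mult = ubp_mult, one = e_diag \<pi>\<rparr>"

definition pi_tableaux :: "nat \<Rightarrow> shapes \<Rightarrow> nat set set \<Rightarrow> tableaux set" where
  "pi_tableaux k lam \<pi> = (\<Pi>\<^sub>E i\<in>{1..k}. std_tableaux gll_less (lam i) {B \<in> \<pi>. card B = i})"

definition V_mod :: "nat \<Rightarrow> shapes \<Rightarrow> (complex, tableaux \<Rightarrow>\<^sub>0 complex) module" where
  "V_mod k lam = free_mod (pi_tableaux k lam (pi_of (vec_type k lam)))"

definition V_act :: "nat \<Rightarrow> shapes \<Rightarrow> diagram \<Rightarrow> (tableaux \<Rightarrow>\<^sub>0 complex) \<Rightarrow> (tableaux \<Rightarrow>\<^sub>0 complex)" where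
  "V_act k lam g = lin_ext (\<lambda>T. straighten_tuple gll_less k lam
     (\<lambda>i x. inv_into (top_part g) (block_map g) (T i x)))"


section \<open>The induced module\<close>

definition L_set :: "nat \<Rightarrow> nat set set \<Rightarrow> diagram set" where
  "L_set k \<pi> = {d \<in> ubp_set k. bot_part d = \<pi>}"

definition L_lact :: "nat \<Rightarrow> nat set set \<Rightarrow> diagram \<Rightarrow> (diagram \<Rightarrow>\<^sub>0 complex) \<Rightarrow> (diagram \<Rightarrow>\<^sub>0 complex)" where
  "L_lact k \<pi> d = lin_ext (\<lambda>l. if ubp_mult d l \<in> L_set k \<pi> then bvec (ubp_mult d l) else 0)"

definition L_ract :: "(diagram \<Rightarrow>\<^sub>0 complex) \<Rightarrow> diagram \<Rightarrow> (diagram \<Rightarrow>\<^sub>0 complex)" where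
  "L_ract m g = lin_ext (\<lambda>l. bvec (ubp_mult l g)) m"

type_synonym W_elem = "((diagram \<Rightarrow>\<^sub>0 complex) \<times> (tableaux \<Rightarrow>\<^sub>0 complex) \<Rightarrow>\<^sub>0 complex) set"

definition W_mod :: "nat \<Rightarrow> shapes \<Rightarrow> (complex, W_elem) module" where
  "W_mod k lam = (let \<pi> = pi_of (vec_type k lam) in
     tensor_mod (G_group k \<pi>) (free_mod (L_set k \<pi>)) L_ract (V_mod k lam) (V_act k lam))"

definition W_act :: "nat \<Rightarrow> shapes \<Rightarrow> diagram \<Rightarrow> W_elem \<Rightarrow> W_elem" where
  "W_act k lam d = (let \<pi> = pi_of (vec_type k lam) in
     tensor_left (G_group k \<pi>) (free_mod (L_set k \<pi>)) L_ract (V_mod k lam) (V_act k lam)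
       (L_lact k \<pi> d))"

definition ell :: "nat set set \<Rightarrow> nat set set \<Rightarrow> diagram" where
  "ell \<gamma> \<pi> = {Inl ` (blocks \<gamma> ! j) \<union> Inr ` (blocks \<pi> ! j) | j. j < length (blocks \<pi>)}"

definition W_elt :: "nat \<Rightarrow> shapes \<Rightarrow> nat set set \<Rightarrow> tableaux \<Rightarrow> W_elem" where
  "W_elt k lam \<gamma> T = (let \<pi> = pi_of (vec_type k lam) in
     pure_tensor (G_group k \<pi>) (free_mod (L_set k \<pi>)) L_ract (V_mod k lam) (V_act k lam)
       (bvec (ell \<gamma> \<pi>)) (bvec T))"

definition set_partitions_of_type :: "nat \<Rightarrow> nat multiset \<Rightarrow> nat set set set" where
  "set_partitions_of_type k ty = {\<gamma>. partition_on {1..k} \<gamma> \<and> set_type \<gamma> = ty}"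


section \<open>Uniform tableaux\<close>

definition uniform_tableaux :: "nat \<Rightarrow> shapes \<Rightarrow> tableaux set" where
  "uniform_tableaux k lam =
     {S \<in> (\<Pi>\<^sub>E i\<in>{1..k}. cells (lam i) \<rightarrow>\<^sub>E {A. A \<subseteq> {1..k} \<and> card A = i}).
        (\<forall>i\<in>{1..k}. increasing last_less (lam i) (S i)) \<and>
        partition_on {1..k} (\<Union>i\<in>{1..k}. S i ` cells (lam i))}"

definition CT_mod :: "nat \<Rightarrow> shapes \<Rightarrow> (complex, tableaux \<Rightarrow>\<^sub>0 complex) module" where
  "CT_mod k lam = free_mod (uniform_tableaux k lam)"

definition same_cell :: "nat \<Rightarrow> shapes \<Rightarrow> tableaux \<Rightarrow> nat \<Rightarrow> nat \<Rightarrow> bool" where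
  "same_cell k lam S a b \<longleftrightarrow> (\<exists>i\<in>{1..k}. \<exists>x\<in>cells (lam i). a \<in> S i x \<and> b \<in> S i x)"

text \<open>The unique representation with the prescribed values on the generators. It is required to be
  \<open>undefined\<close> outside the carriers.\<close>

definition CT_act :: "nat \<Rightarrow> shapes \<Rightarrow> diagram \<Rightarrow> (tableaux \<Rightarrow>\<^sub>0 complex) \<Rightarrow> (tableaux \<Rightarrow>\<^sub>0 complex)" where
  "CT_act k lam = (THE act.
     act \<in> carrier (ubp k) \<rightarrow>\<^sub>E (carrier (CT_mod k lam) \<rightarrow>\<^sub>E carrier (CT_mod k lam)) \<and>
     representation (ubp k) (CT_mod k lam) act \<and>
     (\<forall>S\<in>uniform_tableaux k lam. \<forall>i\<in>{1..<k}.
        act (b_gen k i) (bvec S) = (if same_cell k lam S i (i + 1) then bvec S else 0) \<and>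
        act (s_gen k i) (bvec S) = straighten_tuple last_less k lam
          (\<lambda>j x. Transposition.transpose i (i + 1) ` S j x)))"


section \<open>The map on tableaux\<close>

definition relabel :: "nat \<Rightarrow> shapes \<Rightarrow> nat set set \<Rightarrow> nat set set \<Rightarrow> tableaux \<Rightarrow> tableaux" where
  "relabel k lam \<pi> \<gamma> T =
     (\<lambda>i\<in>{1..k}. \<lambda>x\<in>cells (lam i). the (map_of (zip (blocks \<pi>) (blocks \<gamma>)) (T i x)))"

end

theory Submission
  imports Defs
begin

text \<open>A diagram \<open>d\<close> is encoded by the relation consisting of the pairs \<open>(A, C)\<close> for which the top
  vertices \<open>A\<close> together with the bottom vertices \<open>C\<close> form a union of blocks of \<open>d\<close>. It determines \<open>d\<close>,
  it is an injective partial function, and the product of diagrams becomes composition of relations.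
  Hence \<open>d\<close> acts on uniform tableaux by a closed formula: replace every entry \<open>C\<close> by the \<open>A\<close> related
  to it and straighten, or give \<open>0\<close> if some entry is not a union of bottom blocks. This is
  multiplicative because straightening commutes with injective relabellings of the entries, and it
  has the prescribed values on the generators, so it is the action on uniform tableaux.

  The same formula defines a linear map from the free space underlying the tensor product to the
  space of uniform tableaux, sending \<open>l \<otimes> T\<close> to the straightening of \<open>T\<close> with its entries pulled back
  along \<open>l\<close>. It kills the tensor relations, and it sends \<open>ell \<gamma> \<pi> \<otimes> T\<close> to the relabelled tableau, which
  is already standard because the relabelling is monotone. Since every \<open>l\<close> factors as \<open>ell \<gamma> \<pi>\<close> times
  a group element, every tensor reduces modulo the relations to a combination of these elements, so
  the kernel is exactly the submodule generated by the relations. The cosets are therefore the fibres of this map.\<close>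


text \<open>\<open>straighten\<close> and \<open>CT_act\<close> are definite descriptions, so
  nothing can be computed from them before existence and uniqueness are settled. For
  \<open>straighten\<close>, existence is the Garnir algorithm and uniqueness is the independence of
  standard polytabloids. For \<open>CT_act\<close>, the closed formula gives existence, and
  uniqueness rests on the fact that \<open>s_gen\<close> and \<open>b_gen\<close> generate the whole
  monoid. Straightening commutes with relabelling because a polytabloid does not mention any order:
  an injective map of the entries sends polytabloids to polytabloids, and the order only selects the
  basis in which they are expanded. Inside a component all blocks have one size, so the graded and
  the plain last letter order select the same basis. Diagrams act through preimages because, with
  the product read as left-to-right composition of relations, preimages compose in the order that a
  left action asks for. Uniformity enters through cardinalities: a union of blocks without top
  vertices has no bottom vertices either, which makes the relation an injective partial
  function.\<close>

abbreviation coef :: "('b \<Rightarrow>\<^sub>0 complex) \<Rightarrow> 'b \<Rightarrow> complex" where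
  "coef \<equiv> Poly_Mapping.lookup"

abbreviation supp :: "('b \<Rightarrow>\<^sub>0 complex) \<Rightarrow> 'b set" where
  "supp \<equiv> Poly_Mapping.keys"

section \<open>Linear extension\<close>

lemma coef_scale [simp]: "coef (scale c p) b = c * coef p b"
  by (simp add: Poly_Mapping.map.rep_eq when_def)

lemma scale_add: "scale c (p + q) = scale c p + scale c q"
  by (rule poly_mapping_eqI) (simp add: lookup_add algebra_simps)

lemma scale_add_left: "scale (c + d) p = scale c p + scale d p"
  by (rule poly_mapping_eqI) (simp add: lookup_add algebra_simps)

lemma scale_zero [simp]: "scale c 0 = (0 :: 'b \<Rightarrow>\<^sub>0 complex)"
  by (rule poly_mapping_eqI) simp

lemma scale_zero_left [simp]: "scale 0 p = 0"
  by (rule poly_mapping_eqI) simp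

lemma scale_one [simp]: "scale 1 p = p"
  by (rule poly_mapping_eqI) simp

lemma scale_scale: "scale c (scale d p) = scale (c * d) p"
  by (rule poly_mapping_eqI) simp

lemma scale_sum: "scale c (sum f A) = (\<Sum>a\<in>A. scale c (f a))"
  by (rule poly_mapping_eqI) (simp add: lookup_sum sum_distrib_left)

lemma supp_scale: "supp (scale c p) \<subseteq> supp p"
  by (auto simp: in_keys_iff)

lemma coef_bvec: "coef (bvec a) b = (if a = b then 1 else 0)"
  by (auto simp: lookup_single when_def)

lemma lin_ext_superset:
  assumes "finite A" "supp p \<subseteq> A"
  shows "lin_ext f p = (\<Sum>b\<in>A. scale (coef p b) (f b))"
  unfolding lin_ext_def
  by (rule sum.mono_neutral_left) (use assms in \<open>auto simp: in_keys_iff\<close>)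

lemma coef_lin_ext:
  assumes "finite A" "supp p \<subseteq> A"
  shows "coef (lin_ext f p) x = (\<Sum>b\<in>A. coef p b * coef (f b) x)"
  by (simp add: lin_ext_superset[OF assms] lookup_sum)

lemma lin_ext_zero [simp]: "lin_ext f 0 = 0"
  by (simp add: lin_ext_def)

lemma lin_ext_bvec [simp]: "lin_ext f (bvec b) = f b"
  by (simp add: lin_ext_def)

lemma lin_ext_single [simp]: "lin_ext f (Poly_Mapping.single b c) = scale c (f b)"
  by (cases "c = 0") (simp_all add: lin_ext_def)

lemma lin_ext_add: "lin_ext f (p + q) = lin_ext f p + lin_ext f q"
proof -
  let ?A = "supp p \<union> supp q"
  have "supp (p + q) \<subseteq> ?A" by (rule keys_add)
  then show ?thesis
    by (simp add: lin_ext_superset[of ?A] lookup_add scale_add_left sum.distrib)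
qed

lemma lin_ext_scale: "lin_ext f (scale c p) = scale c (lin_ext f p)"
  by (simp add: lin_ext_superset[of "supp p" "scale c p"] supp_scale scale_scale scale_sum
      lin_ext_def[of f p])

lemma lin_ext_sum: "lin_ext f (sum g A) = (\<Sum>a\<in>A. lin_ext f (g a))"
  by (induction A rule: infinite_finite_induct) (simp_all add: lin_ext_add)

lemma lin_ext_uminus: "lin_ext f (- p) = - lin_ext f p"
  using lin_ext_add[of f p "- p"] by (simp add: eq_neg_iff_add_eq_0 add.commute)

lemma lin_ext_diff: "lin_ext f (p - q) = lin_ext f p - lin_ext f q"
  using lin_ext_add[of f p "- q"] by (simp add: lin_ext_uminus)

lemma lin_ext_cong: "(\<And>b. b \<in> supp p \<Longrightarrow> f b = g b) \<Longrightarrow> lin_ext f p = lin_ext g p"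
  by (simp add: lin_ext_def)

lemma lin_ext_lin_ext: "lin_ext f (lin_ext g p) = lin_ext (\<lambda>b. lin_ext f (g b)) p"
  by (simp add: lin_ext_def[of g p] lin_ext_sum lin_ext_scale lin_ext_def[of _ p])

lemma sum_single_supp: "(\<Sum>b\<in>supp p. scale (coef p b) (bvec b)) = p"
  by (rule poly_mapping_eqI)
    (auto simp: lookup_sum lookup_single when_def in_keys_iff)

lemma lin_ext_bvec_id [simp]: "lin_ext bvec p = p"
  unfolding lin_ext_def by (rule sum_single_supp)

lemma lin_ext_add_fun: "lin_ext (\<lambda>b. f b + g b) p = lin_ext f p + lin_ext g p"
  by (simp add: lin_ext_def scale_add sum.distrib)

lemma lin_ext_scale_fun: "lin_ext (\<lambda>b. scale c (f b)) p = scale c (lin_ext f p)"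
  by (simp add: lin_ext_def scale_sum scale_scale mult.commute)

lemma supp_sum_subset: "(\<And>a. a \<in> A \<Longrightarrow> supp (f a) \<subseteq> B) \<Longrightarrow> supp (sum f A) \<subseteq> B"
  using keys_sum[of f A] by blast

lemma supp_lin_ext: "(\<And>b. b \<in> supp p \<Longrightarrow> supp (f b) \<subseteq> B) \<Longrightarrow> supp (lin_ext f p) \<subseteq> B"
  unfolding lin_ext_def by (rule supp_sum_subset) (meson subset_trans supp_scale)


unbundle no m_inv_syntax

section \<open>Polytabloids\<close>

text \<open>The column stabilizer, acting on cells instead of entries. It no longer depends on the
  filling, so the polytabloids of different fillings become sums over one index set.\<close>

definition col_perms :: "nat list \<Rightarrow> (nat \<times> nat \<Rightarrow> nat \<times> nat) set" where
  "col_perms \<mu> = {q. q permutes cells \<mu> \<and> (\<forall>x\<in>cells \<mu>. snd (q x) = snd x)}"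

lemma finite_cells [simp]: "finite (cells \<mu>)"
proof -
  have "cells \<mu> = (SIGMA r:{..<length \<mu>}. {..<\<mu> ! r})" by (auto simp: cells_def)
  then show ?thesis by simp
qed

lemma tabloid_image: "tabloid \<mu> F r = F ` {x \<in> cells \<mu>. fst x = r}"
  by (force simp: tabloid_def)

lemma tabloid_cong: "(\<And>x. x \<in> cells \<mu> \<Longrightarrow> F x = G x) \<Longrightarrow> tabloid \<mu> F = tabloid \<mu> G"
  by (rule ext) (auto simp: tabloid_image)

lemma tabloid_comp: "tabloid \<mu> (f \<circ> F) = (\<lambda>r. f ` tabloid \<mu> F r)"
  by (rule ext) (auto simp: tabloid_image)

lemma tabloid_row_perm:
  assumes "q permutes cells \<mu>" "\<And>x. x \<in> cells \<mu> \<Longrightarrow> fst (q x) = fst x"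
  shows "tabloid \<mu> (F \<circ> q) = tabloid \<mu> F"
proof
  fix r
  have "q ` {x \<in> cells \<mu>. fst x = r} = {x \<in> cells \<mu>. fst x = r}"
  proof (intro equalityI subsetI)
    fix y assume y: "y \<in> {x \<in> cells \<mu>. fst x = r}"
    have "inv q y \<in> cells \<mu>" using y permutes_in_image[OF permutes_inv[OF assms(1)]] by simp
    moreover have "q (inv q y) = y" using assms(1) by (simp add: permutes_inverses)
    ultimately show "y \<in> q ` {x \<in> cells \<mu>. fst x = r}"
      using y assms(2)[of "inv q y"] by (intro image_eqI[of _ _ "inv q y"]) auto
  qed (use assms permutes_in_image[OF assms(1)] in auto)
  then show "tabloid \<mu> (F \<circ> q) r = tabloid \<mu> F r"
    unfolding tabloid_image image_comp[symmetric] by simp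
qed

lemma col_perms_permutes: "q \<in> col_perms \<mu> \<Longrightarrow> q permutes cells \<mu>"
  by (simp add: col_perms_def)

lemma col_perms_cells: "q \<in> col_perms \<mu> \<Longrightarrow> x \<in> cells \<mu> \<Longrightarrow> q x \<in> cells \<mu>"
  by (simp add: col_perms_def permutes_in_image)

lemma col_perms_snd: "q \<in> col_perms \<mu> \<Longrightarrow> x \<in> cells \<mu> \<Longrightarrow> snd (q x) = snd x"
  by (simp add: col_perms_def)

lemma finite_col_perms [simp]: "finite (col_perms \<mu>)"
  by (rule finite_subset[OF _ finite_permutations[of "cells \<mu>"]]) (auto simp: col_perms_def)

lemma id_col_perms: "id \<in> col_perms \<mu>"
  by (simp add: col_perms_def permutes_id)

lemma col_perms_comp: "p \<in> col_perms \<mu> \<Longrightarrow> q \<in> col_perms \<mu> \<Longrightarrow> p \<circ> q \<in> col_perms \<mu>"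
  by (auto simp: col_perms_def permutes_compose permutes_in_image)

lemma col_perms_inv:
  assumes "p \<in> col_perms \<mu>"
  shows "inv p \<in> col_perms \<mu>"
proof -
  have p: "p permutes cells \<mu>" by (rule col_perms_permutes[OF assms])
  have "snd (inv p x) = snd x" if "x \<in> cells \<mu>" for x
    using col_perms_snd[OF assms, of "inv p x"] that permutes_in_image[OF permutes_inv[OF p]]
    by (simp add: permutes_inverses[OF p])
  then show ?thesis by (simp add: col_perms_def permutes_inv[OF p])
qed

lemma sign_cells_comp:
  "p permutes cells \<mu> \<Longrightarrow> q permutes cells \<mu> \<Longrightarrow> sign (p \<circ> q) = sign p * sign q"
  by (meson finite_cells permutes_imp_permutation sign_compose)

text \<open>Conjugation by \<open>F\<close> identifies permutations of the entries with permutations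
  of the cells. It matches \<open>col_stab\<close> with \<open>col_perms\<close> and preserves
  signs.\<close>

lemma polytabloid_cells:
  assumes inj: "inj_on F (cells \<mu>)"
  shows "polytabloid \<mu> F =
    (\<Sum>q\<in>col_perms \<mu>. Poly_Mapping.single (tabloid \<mu> (F \<circ> q)) (of_int (sign q)))"
  unfolding polytabloid_def
proof (rule sum.reindex_bij_witness[of _ "map_permutation (cells \<mu>) F"
      "map_permutation (F ` cells \<mu>) (inv_into (cells \<mu>) F)"])
  let ?C = "cells \<mu>" and ?G = "inv_into (cells \<mu>) F"
  have FG: "bij_betw F ?C (F ` ?C)" "bij_betw ?G (F ` ?C) ?C"
    using inj by (auto simp: bij_betw_imageI bij_betw_inv_into)
  have inj': "inj_on ?G (F ` ?C)" by (rule inj_on_inv_into) simp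
  { fix p assume p: "p \<in> col_stab \<mu> F"
    then have perm: "p permutes F ` ?C" by (simp add: col_stab_def)
    show "map_permutation ?C F (map_permutation (F ` ?C) ?G p) = p"
      by (rule map_permutation_compose_inv[OF FG(2) perm]) (simp add: f_inv_into_f)
    have q: "map_permutation (F ` ?C) ?G p permutes ?C"
      by (rule map_permutation_permutes[OF FG(2) perm])
    have app: "F (map_permutation (F ` ?C) ?G p x) = p (F x)" if "x \<in> ?C" for x
    proof -
      have "map_permutation (F ` ?C) ?G p (?G (F x)) = ?G (p (F x))"
        by (rule map_permutation_apply) (use inj' that in auto)
      moreover have "p (F x) \<in> F ` ?C" using perm that by (simp add: permutes_in_image)
      ultimately show ?thesis using that inj by (simp add: f_inv_into_f)
    qed
    have "snd (map_permutation (F ` ?C) ?G p x) = snd x" if x: "x \<in> ?C" for x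
    proof -
      obtain r' where r': "(r', snd x) \<in> ?C" "p (F x) = F (r', snd x)"
        using p x by (fastforce simp: col_stab_def)
      then have "map_permutation (F ` ?C) ?G p x = (r', snd x)"
        using app[OF x] inj q x by (metis inj_onD permutes_in_image)
      then show ?thesis by simp
    qed
    with q show "map_permutation (F ` ?C) ?G p \<in> col_perms \<mu>" by (simp add: col_perms_def)
    have "tabloid \<mu> (F \<circ> map_permutation (F ` ?C) ?G p) = tabloid \<mu> (p \<circ> F)"
      by (rule tabloid_cong) (simp add: app)
    moreover have "sign (map_permutation (F ` ?C) ?G p) = sign p"
      by (rule sign_map_permutation[OF inj' perm]) simp
    ultimately show "Poly_Mapping.single (tabloid \<mu> (F \<circ> map_permutation (F ` ?C) ?G p))
        (of_int (sign (map_permutation (F ` ?C) ?G p)) :: complex) =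
      Poly_Mapping.single (tabloid \<mu> (p \<circ> F)) (of_int (sign p))" by simp }
  { fix q assume q: "q \<in> col_perms \<mu>"
    then have perm: "q permutes ?C" by (rule col_perms_permutes)
    show "map_permutation (F ` ?C) ?G (map_permutation ?C F q) = q"
      by (rule map_permutation_compose_inv[OF FG(1) perm]) (simp add: inj)
    have "map_permutation ?C F q permutes F ` ?C"
      by (rule map_permutation_permutes[OF FG(1) perm])
    moreover have "\<exists>r'. (r', c) \<in> ?C \<and> map_permutation ?C F q (F (r, c)) = F (r', c)"
      if "(r, c) \<in> ?C" for r c
    proof (intro exI conjI)
      have "q (r, c) = (fst (q (r, c)), c)" using col_perms_snd[OF q that] by (simp add: prod_eq_iff)
      then show "(fst (q (r, c)), c) \<in> ?C"
        and "map_permutation ?C F q (F (r, c)) = F (fst (q (r, c)), c)"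
        using col_perms_cells[OF q that] map_permutation_apply[OF inj that, of q] by simp_all
    qed
    ultimately show "map_permutation ?C F q \<in> col_stab \<mu> F" by (auto simp: col_stab_def) }
qed

lemma polytabloid_cong:
  fixes F G :: "nat \<times> nat \<Rightarrow> 'e"
  assumes "\<And>x. x \<in> cells \<mu> \<Longrightarrow> F x = G x"
  shows "polytabloid \<mu> F = polytabloid \<mu> G"
proof -
  have im: "F ` cells \<mu> = G ` cells \<mu>" using assms by auto
  have *: "F (r, c) = G (r, c)" if "(r, c) \<in> cells \<mu>" for r c using assms[OF that] .
  have "col_stab \<mu> F = col_stab \<mu> G"
    unfolding col_stab_def im
    by (intro Collect_cong conj_cong refl ball_cong prod.case_cong) (auto simp: *)
  moreover have "tabloid \<mu> (p \<circ> F) = tabloid \<mu> (p \<circ> G)" for p :: "'e \<Rightarrow> 'e"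
    by (rule tabloid_cong) (simp add: assms)
  ultimately show ?thesis by (simp only: polytabloid_def)
qed

text \<open>\<open>f\<close> acts on the rows of every tabloid, while neither the index set
  \<open>col_perms\<close> nor the signs involve the filling.\<close>

lemma polytabloid_comp:
  assumes "inj_on F (cells \<mu>)" "inj_on f (F ` cells \<mu>)"
  shows "polytabloid \<mu> (f \<circ> F) = lin_ext (\<lambda>t. bvec (\<lambda>r. f ` t r)) (polytabloid \<mu> F)"
proof -
  have "inj_on (f \<circ> F) (cells \<mu>)" using assms by (rule comp_inj_on)
  then show ?thesis
    by (simp add: polytabloid_cells assms lin_ext_sum tabloid_comp o_assoc[symmetric])
qed

text \<open>Left translation by \<open>p\<close> permutes the index set \<open>col_perms\<close> and
  multiplies every sign by \<open>sign p\<close>.\<close>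

lemma polytabloid_col_perm:
  assumes inj: "inj_on F (cells \<mu>)" and p: "p \<in> col_perms \<mu>"
  shows "polytabloid \<mu> (F \<circ> p) = scale (of_int (sign p)) (polytabloid \<mu> F)"
proof -
  have pp: "p permutes cells \<mu>" by (rule col_perms_permutes[OF p])
  have "inj_on (F \<circ> p) (cells \<mu>)"
    using inj pp by (simp add: comp_inj_on permutes_image permutes_inj_on)
  then have "polytabloid \<mu> (F \<circ> p) =
      (\<Sum>q\<in>col_perms \<mu>. Poly_Mapping.single (tabloid \<mu> (F \<circ> (p \<circ> q))) (of_int (sign q)))"
    by (simp add: polytabloid_cells o_assoc)
  also have "\<dots> = (\<Sum>q\<in>col_perms \<mu>.
      Poly_Mapping.single (tabloid \<mu> (F \<circ> q)) (of_int (sign p * sign q)))"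
  proof (rule sum.reindex_bij_witness[of _ "\<lambda>q. inv p \<circ> q" "\<lambda>q. p \<circ> q"])
    fix q assume q: "q \<in> col_perms \<mu>"
    then have qq: "q permutes cells \<mu>" by (rule col_perms_permutes)
    show "inv p \<circ> (p \<circ> q) = q" "p \<circ> (inv p \<circ> q) = q"
      by (simp_all add: o_assoc permutes_inv_o[OF pp])
    show "p \<circ> q \<in> col_perms \<mu>" "inv p \<circ> q \<in> col_perms \<mu>"
      using p q by (simp_all add: col_perms_comp col_perms_inv)
    show "Poly_Mapping.single (tabloid \<mu> (F \<circ> (p \<circ> q))) (of_int (sign p * sign (p \<circ> q)) :: complex) =
        Poly_Mapping.single (tabloid \<mu> (F \<circ> (p \<circ> q))) (of_int (sign q))"
      by (simp add: sign_cells_comp[OF pp qq] mult.assoc[symmetric] sign_idempotent)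
  qed
  also have "\<dots> = scale (of_int (sign p)) (polytabloid \<mu> F)"
    by (simp add: polytabloid_cells[OF inj] scale_sum)
  finally show ?thesis .
qed

text \<open>Composing with the transposition of two cells of \<open>U\<close> whose \<open>q\<close>-preimages share a row reverses the
  sign and keeps the tabloid. Unlike in the usual Garnir element, the sum is over all permutations of
  \<open>U\<close>, which spares the choice of coset representatives.\<close>

lemma garnir:
  assumes inj: "inj_on F (cells \<mu>)" and U: "U \<subseteq> cells \<mu>"
    and rep: "\<And>q. q \<in> col_perms \<mu> \<Longrightarrow>
      \<exists>x\<in>cells \<mu>. \<exists>y\<in>cells \<mu>. x \<noteq> y \<and> fst x = fst y \<and> q x \<in> U \<and> q y \<in> U"
  shows "(\<Sum>s | s permutes U. scale (of_int (sign s)) (polytabloid \<mu> (F \<circ> s))) = 0"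
proof -
  have perm: "s permutes cells \<mu>" if "s permutes U" for s
    using that U by (rule permutes_subset)
  have inj': "inj_on (F \<circ> s) (cells \<mu>)" if "s permutes U" for s
    using inj perm[OF that] by (simp add: comp_inj_on permutes_image permutes_inj_on)
  have fin: "finite {s. s permutes U}"
    by (rule finite_permutations) (rule finite_subset[OF U finite_cells])
  let ?f = "\<lambda>q s. Poly_Mapping.single (tabloid \<mu> (F \<circ> s \<circ> q)) (of_int (sign s) :: complex)"
  have zero: "(\<Sum>s | s permutes U. ?f q s) = 0" if q: "q \<in> col_perms \<mu>" for q
  proof -
    obtain x y where xy: "x \<in> cells \<mu>" "y \<in> cells \<mu>" "x \<noteq> y" "fst x = fst y" "q x \<in> U" "q y \<in> U"
      using rep[OF q] by blast
    define t where "t = Transposition.transpose (q x) (q y)"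
    have qq: "q permutes cells \<mu>" by (rule col_perms_permutes[OF q])
    have t: "t permutes U" using xy by (simp add: t_def permutes_swap_id)
    have tt: "t \<circ> t = id" by (simp add: t_def)
    have "q x \<noteq> q y" using xy qq by (metis permutes_inverses(2))
    then have sgn: "sign t = - 1" by (simp add: t_def sign_swap_id)
    have conj: "t \<circ> q = q \<circ> Transposition.transpose x y"
      unfolding t_def using qq by (auto simp: fun_eq_iff Transposition.transpose_def dest: permutes_inj[THEN injD])
    have flip: "?f q (s \<circ> t) = - ?f q s" if s: "s permutes U" for s
    proof -
      have "tabloid \<mu> (F \<circ> (s \<circ> t) \<circ> q) = tabloid \<mu> ((F \<circ> s \<circ> q) \<circ> Transposition.transpose x y)"
        by (simp add: o_assoc[symmetric] conj)
      also have "\<dots> = tabloid \<mu> (F \<circ> s \<circ> q)"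
        by (rule tabloid_row_perm)
          (use xy in \<open>auto simp: permutes_swap_id Transposition.transpose_def\<close>)
      finally show ?thesis
        using sign_cells_comp[OF perm[OF s] perm[OF t]] by (simp add: sgn single_uminus)
    qed
    have "(\<Sum>s | s permutes U. ?f q s) = (\<Sum>s | s permutes U. ?f q (s \<circ> t))"
      by (rule sum.reindex_bij_witness[of _ "\<lambda>s. s \<circ> t" "\<lambda>s. s \<circ> t"])
        (simp_all add: o_assoc[symmetric] tt permutes_compose[OF t])
    also have "\<dots> = - (\<Sum>s | s permutes U. ?f q s)"
      by (simp add: flip sum_negf)
    finally have eq: "(\<Sum>s | s permutes U. ?f q s) = - (\<Sum>s | s permutes U. ?f q s)" .
    \<comment> \<open>An element equal to its own negative vanishes, because each of its complex
      coefficients does.\<close>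
    show ?thesis
    proof (rule poly_mapping_eqI)
      fix k show "coef (\<Sum>s | s permutes U. ?f q s) k = coef 0 k"
        using arg_cong[OF eq, of "\<lambda>p. coef p k"] by (simp del: sum_negf)
    qed
  qed
  have "(\<Sum>s | s permutes U. scale (of_int (sign s)) (polytabloid \<mu> (F \<circ> s))) =
      (\<Sum>s | s permutes U. \<Sum>q\<in>col_perms \<mu>. scale (of_int (sign q)) (?f q s))"
    by (intro sum.cong) (auto simp: polytabloid_cells[OF inj'] scale_sum mult.commute)
  also have "\<dots> = (\<Sum>q\<in>col_perms \<mu>. scale (of_int (sign q)) (\<Sum>s | s permutes U. ?f q s))"
    by (subst sum.swap) (simp only: scale_sum)
  also have "\<dots> = 0" by (rule sum.neutral) (simp add: zero)
  finally show ?thesis .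
qed


section \<open>Independence of standard polytabloids\<close>

text \<open>By rearrangement, permuting the entries within the columns of a column-increasing filling strictly
  lowers its row weight; so the tabloid of a standard tableau has the largest weight in its
  polytabloid, which is what makes standard polytabloids independent.\<close>

definition row_weight :: "nat list \<Rightarrow> (nat \<times> nat \<Rightarrow> nat) \<Rightarrow> nat" where
  "row_weight \<mu> G = (\<Sum>x\<in>cells \<mu>. fst x * G x)"

definition col_increasing :: "nat list \<Rightarrow> (nat \<times> nat \<Rightarrow> nat) \<Rightarrow> bool" where
  "col_increasing \<mu> G \<longleftrightarrow> (\<forall>r r' c. r < r' \<and> (r', c) \<in> cells \<mu> \<longrightarrow> G (r, c) < G (r', c))"

text \<open>Entries are compared through a rank in the natural numbers (later the maximum of a block).\<close>

definition ranked :: "('e \<Rightarrow> 'e \<Rightarrow> bool) \<Rightarrow> 'e set \<Rightarrow> ('e \<Rightarrow> nat) \<Rightarrow> bool" where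
  "ranked lt Y w \<longleftrightarrow> inj_on w Y \<and> (\<forall>x\<in>Y. \<forall>y\<in>Y. lt x y \<longleftrightarrow> w x < w y)"

lemma cells_down:
  assumes "int_partition \<mu>" "(r, c) \<in> cells \<mu>" "r' \<le> r" "c' \<le> c"
  shows "(r', c') \<in> cells \<mu>"
proof -
  have "r < length \<mu>" "c < \<mu> ! r" using assms(2) by (auto simp: cells_def)
  moreover have "\<mu> ! r \<le> \<mu> ! r'"
  proof (cases "r' = r")
    case False
    then show ?thesis
      using assms(1,3) \<open>r < length \<mu>\<close> by (simp add: int_partition_def sorted_wrt_iff_nth_less)
  qed simp
  ultimately show ?thesis using assms(3,4) by (auto simp: cells_def)
qed

text \<open>An inversion in a column can be removed by a transposition. This raises the weight by
  the product of the two gaps, between the rows and between the values, and so contradicts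
  maximality.\<close>

lemma row_weight_maximizer:
  assumes "int_partition \<mu>" "inj_on G (cells \<mu>)" "q \<in> col_perms \<mu>"
    and max: "\<And>p. p \<in> col_perms \<mu> \<Longrightarrow> row_weight \<mu> (G \<circ> p) \<le> row_weight \<mu> (G \<circ> q)"
  shows "col_increasing \<mu> (G \<circ> q)"
  unfolding col_increasing_def
proof (intro allI impI, elim conjE, rule ccontr)
  fix r r' c assume rr: "r < r'" and cell': "(r', c) \<in> cells \<mu>"
    and not: "\<not> (G \<circ> q) (r, c) < (G \<circ> q) (r', c)"
  let ?x = "(r, c)" and ?y = "(r', c)" and ?H = "G \<circ> q"
  have cell: "?x \<in> cells \<mu>" using cells_down[OF assms(1) cell'] rr by simp
  have "q ?x \<noteq> q ?y"
    using rr col_perms_permutes[OF assms(3)] by (metis fst_conv less_irrefl permutes_inverses(2))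
  then have "G (q ?x) \<noteq> G (q ?y)"
    using assms(2) col_perms_cells[OF assms(3)] cell cell' by (metis inj_onD)
  with not have gt: "?H ?y < ?H ?x" by simp
  define t where "t = Transposition.transpose ?x ?y"
  have "t \<in> col_perms \<mu>"
    using cell cell' by (auto simp: col_perms_def t_def permutes_swap_id Transposition.transpose_def)
  then have le: "row_weight \<mu> (?H \<circ> t) \<le> row_weight \<mu> ?H"
    using max[OF col_perms_comp[OF assms(3)], of t] by (simp add: o_assoc)
  have split: "row_weight \<mu> K = r * K ?x + (r' * K ?y + (\<Sum>z\<in>cells \<mu> - {?x} - {?y}. fst z * K z))" for K
    unfolding row_weight_def using cell cell' rr
    by (simp add: sum.remove[of _ ?x] sum.remove[of _ ?y])
  have "(\<Sum>z\<in>cells \<mu> - {?x} - {?y}. fst z * (?H \<circ> t) z) = (\<Sum>z\<in>cells \<mu> - {?x} - {?y}. fst z * ?H z)"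
    by (intro sum.cong) (auto simp: t_def transpose_apply_other)
  then have "r * ?H ?y + r' * ?H ?x \<le> r * ?H ?x + r' * ?H ?y"
    using le unfolding split[of "?H \<circ> t"] split[of ?H] by (simp add: t_def)
  \<comment> \<open>Both gaps are written as successors, so that the rearrangement inequality
    becomes an identity in natural numbers free of truncated subtraction.\<close>
  moreover obtain d where "r' = r + Suc d" using rr less_imp_Suc_add by force
  moreover obtain e where "?H ?x = ?H ?y + Suc e" using gt less_imp_Suc_add by force
  ultimately show False by (simp add: algebra_simps)
qed

text \<open>The entries of a column can be sorted in only one way. With the previous result this
  makes the maximizer of the row weight unique.\<close>

lemma col_increasing_perm_id:
  assumes "int_partition \<mu>" "q \<in> col_perms \<mu>" "col_increasing \<mu> G" "col_increasing \<mu> (G \<circ> q)"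
  shows "q = id"
proof -
  have qq: "q permutes cells \<mu>" by (rule col_perms_permutes[OF assms(2)])
  \<comment> \<open>\<open>q\<close> never lowers a row index, and the sum of all row indices is preserved.\<close>
  have le: "r \<le> fst (q (r, c))" if "(r, c) \<in> cells \<mu>" for r c
    using that
  proof (induction r)
    case (Suc r)
    have cell: "(r, c) \<in> cells \<mu>" by (rule cells_down[OF assms(1) Suc.prems]) auto
    let ?a = "q (r, c)" and ?b = "q (Suc r, c)"
    have ab: "?a = (fst ?a, c)" "?b = (fst ?b, c)"
      using col_perms_snd[OF assms(2)] cell Suc.prems by (metis snd_conv prod.collapse)+
    have lt: "G ?a < G ?b"
      using assms(4) Suc.prems by (auto simp: col_increasing_def)
    have "fst ?a < fst ?b"
    proof (rule ccontr)
      assume "\<not> fst ?a < fst ?b"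
      then have "fst ?b < fst ?a \<or> fst ?a = fst ?b" by auto
      then have "G ?b \<le> G ?a"
        using assms(3) col_perms_cells[OF assms(2) cell] ab unfolding col_increasing_def
        by (metis less_imp_le order_refl)
      with lt show False by simp
    qed
    with Suc.IH[OF cell] show ?case by simp
  qed simp
  have "(\<Sum>x\<in>cells \<mu>. fst x) = (\<Sum>x\<in>cells \<mu>. fst (q x))"
    using sum.permute[OF qq, of fst] by (simp add: o_def)
  then have eq: "fst x = fst (q x)" if "x \<in> cells \<mu>" for x
    by (rule sum_mono_inv) (use le that in auto)
  have "q x = x" for x
  proof (cases "x \<in> cells \<mu>")
    case True
    then show ?thesis using eq[OF True] col_perms_snd[OF assms(2) True] by (simp add: prod_eq_iff)
  next
    case False
    then show ?thesis using qq by (simp add: permutes_not_in)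
  qed
  then show ?thesis by auto
qed

lemma ex_row_weight_maximizer:
  "\<exists>q\<in>col_perms \<mu>. \<forall>p\<in>col_perms \<mu>. row_weight \<mu> (G \<circ> p) \<le> row_weight \<mu> (G \<circ> q)"
proof -
  let ?W = "(\<lambda>p. row_weight \<mu> (G \<circ> p)) ` col_perms \<mu>"
  have "Max ?W \<in> ?W" using id_col_perms by (intro Max_in) auto
  then obtain q where "q \<in> col_perms \<mu>" "Max ?W = row_weight \<mu> (G \<circ> q)" by auto
  moreover have "row_weight \<mu> (G \<circ> p) \<le> Max ?W" if "p \<in> col_perms \<mu>" for p
    using that by (intro Max_ge) auto
  ultimately show ?thesis by metis
qed

lemma ex_col_increasing:
  assumes "int_partition \<mu>" "inj_on G (cells \<mu>)"
  shows "\<exists>q\<in>col_perms \<mu>. col_increasing \<mu> (G \<circ> q)"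
  using ex_row_weight_maximizer[of \<mu> G] row_weight_maximizer[OF assms] by blast

text \<open>A maximizer exists and is column-increasing, hence it is the identity. If
  \<open>q\<close> reached the weight of \<open>G\<close>, it would be a maximizer too, hence also
  the identity.\<close>

lemma row_weight_less:
  assumes "int_partition \<mu>" "inj_on G (cells \<mu>)" "col_increasing \<mu> G" "q \<in> col_perms \<mu>" "q \<noteq> id"
  shows "row_weight \<mu> (G \<circ> q) < row_weight \<mu> G"
proof (rule ccontr)
  assume "\<not> row_weight \<mu> (G \<circ> q) < row_weight \<mu> G"
  then have ge: "row_weight \<mu> G \<le> row_weight \<mu> (G \<circ> q)" by simp
  obtain q0 where q0: "q0 \<in> col_perms \<mu>"
    "\<And>p. p \<in> col_perms \<mu> \<Longrightarrow> row_weight \<mu> (G \<circ> p) \<le> row_weight \<mu> (G \<circ> q0)"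
    using ex_row_weight_maximizer by blast
  have "q0 = id"
    using col_increasing_perm_id[OF assms(1) q0(1) assms(3)]
      row_weight_maximizer[OF assms(1,2) q0] by simp
  then have "col_increasing \<mu> (G \<circ> q)"
    by (intro row_weight_maximizer[OF assms(1,2,4)]) (use q0(2) ge le_trans in fastforce)
  then show False using col_increasing_perm_id[OF assms(1,4,3)] assms(5) by simp
qed

text \<open>Grouping the sum by rows shows that the weight depends only on the tabloid, so it can be
  used to tell tabloids apart.\<close>

lemma row_weight_tabloid:
  assumes "inj_on F (cells \<mu>)"
  shows "row_weight \<mu> (w \<circ> F) = (\<Sum>r<length \<mu>. r * sum w (tabloid \<mu> F r))"
proof -
  have "row_weight \<mu> (w \<circ> F) =
      (\<Sum>r<length \<mu>. \<Sum>x\<in>{x \<in> cells \<mu>. fst x = r}. fst x * (w \<circ> F) x)"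
    unfolding row_weight_def by (rule sum.group[symmetric, OF finite_cells]) (auto simp: cells_def)
  also have "\<dots> = (\<Sum>r<length \<mu>. r * sum w (tabloid \<mu> F r))"
  proof (intro sum.cong refl)
    fix r
    have "inj_on F {x \<in> cells \<mu>. fst x = r}" using assms by (rule inj_on_subset) auto
    then show "(\<Sum>x\<in>{x \<in> cells \<mu>. fst x = r}. fst x * (w \<circ> F) x) = r * sum w (tabloid \<mu> F r)"
      by (simp add: tabloid_image sum.reindex sum_distrib_left)
  qed
  finally show ?thesis .
qed

lemma std_tableauxD:
  assumes "S \<in> std_tableaux lt \<mu> Y"
  shows "inj_on S (cells \<mu>)" "S ` cells \<mu> = Y" "increasing lt \<mu> S" "S \<in> extensional (cells \<mu>)"
  using assms by (auto simp: std_tableaux_def bij_betw_def PiE_def)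

lemma finite_std_tableaux:
  assumes "finite Y"
  shows "finite (std_tableaux lt \<mu> Y)"
  by (rule finite_subset[OF _ finite_PiE[of "cells \<mu>" "\<lambda>_. Y"]])
    (use assms in \<open>auto simp: std_tableaux_def\<close>)

lemma std_col_increasing:
  assumes "int_partition \<mu>" "ranked lt Y w" "S \<in> std_tableaux lt \<mu> Y"
  shows "col_increasing \<mu> (w \<circ> S)"
  unfolding col_increasing_def
proof (intro allI impI, elim conjE)
  fix r r' c assume rc: "r < r'" "(r', c) \<in> cells \<mu>"
  have "lt (S (r, c)) (S (r', c))"
    using std_tableauxD(3)[OF assms(3)] rc by (auto simp: increasing_def)
  moreover have "(r, c) \<in> cells \<mu>" using cells_down[OF assms(1) rc(2)] rc(1) by simp
  ultimately show "(w \<circ> S) (r, c) < (w \<circ> S) (r', c)"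
    using assms(2) rc(2) std_tableauxD(2)[OF assms(3)] by (auto simp: ranked_def)
qed

text \<open>The ranks along a row of a standard tableau increase strictly, so the row is recovered
  by sorting its set of entries.\<close>

lemma std_tabloid_inj:
  assumes rk: "ranked lt Y w"
    and S: "S \<in> std_tableaux lt \<mu> Y" and S': "S' \<in> std_tableaux lt \<mu> Y"
    and eq: "tabloid \<mu> S = tabloid \<mu> S'"
  shows "S = S'"
proof (rule extensionalityI[OF std_tableauxD(4)[OF S] std_tableauxD(4)[OF S']])
  fix x assume x: "x \<in> cells \<mu>"
  obtain r c where rc: "x = (r, c)" by (cases x)
  define row where "row K = map (\<lambda>c. w (K (r, c))) [0..<\<mu> ! r]" for K :: "nat \<times> nat \<Rightarrow> _"
  have r: "r < length \<mu>" and c: "c < \<mu> ! r" using x rc by (auto simp: cells_def)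
  have strict: "sorted_wrt (<) (row K)" if K: "K \<in> std_tableaux lt \<mu> Y" for K
  proof -
    have "w (K (r, i)) < w (K (r, j))" if ij: "i < j" "j < \<mu> ! r" for i j
    proof -
      have cl: "(r, i) \<in> cells \<mu>" "(r, j) \<in> cells \<mu>" using r ij by (auto simp: cells_def)
      then have "lt (K (r, i)) (K (r, j))"
        using std_tableauxD(3)[OF K] ij by (auto simp: increasing_def)
      then show ?thesis using rk cl std_tableauxD(2)[OF K] by (auto simp: ranked_def)
    qed
    then show ?thesis by (auto simp: row_def sorted_wrt_iff_nth_less)
  qed
  have set: "set (row K) = w ` tabloid \<mu> K r" for K
    using r by (force simp: row_def tabloid_def cells_def)
  have "row S = row S'"
    using strict[OF S] strict[OF S'] set[of S] set[of S'] eq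
    by (metis sorted_list_of_set.idem_if_sorted_distinct strict_sorted_iff)
  then have "row S ! c = row S' ! c" by simp
  then have "w (S x) = w (S' x)" using c by (simp add: row_def rc)
  then show "S x = S' x"
    using rk x std_tableauxD(2)[OF S] std_tableauxD(2)[OF S'] by (auto simp: ranked_def inj_on_def)
qed

text \<open>Take \<open>S\<close> of largest row weight in the support of \<open>q\<close>, and look
  at the coefficient of its tabloid. A term \<open>S' \<circ> p\<close> with
  \<open>p \<noteq> id\<close> has smaller weight than \<open>S'\<close>, hence than
  \<open>S\<close>; with \<open>p = id\<close> its tabloid determines \<open>S'\<close>. So only
  \<open>S\<close> itself contributes, with coefficient one, and \<open>coef q S\<close> must
  vanish.\<close>

lemma std_polytabloids_independent:
  assumes part: "int_partition \<mu>" and rk: "ranked lt Y w"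
    and supp: "supp q \<subseteq> std_tableaux lt \<mu> Y" and zero: "lin_ext (polytabloid \<mu>) q = 0"
  shows "q = 0"
proof (rule ccontr)
  assume "q \<noteq> 0"
  then have ne: "supp q \<noteq> {}" by simp
  let ?u = "\<lambda>S. row_weight \<mu> (w \<circ> S)"
  have "Max (?u ` supp q) \<in> ?u ` supp q" using ne by (intro Max_in) auto
  then obtain S where S: "S \<in> supp q" "Max (?u ` supp q) = ?u S" by auto
  have max: "?u S' \<le> ?u S" if "S' \<in> supp q" for S'
    using S(2) that by (metis Max_ge finite_imageI finite_keys imageI)
  have injw: "inj_on (w \<circ> T) (cells \<mu>)" if "T \<in> std_tableaux lt \<mu> Y" for T
    using std_tableauxD(1,2)[OF that] rk by (auto simp: ranked_def intro!: comp_inj_on)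
  have tab: "tabloid \<mu> (S' \<circ> p) = tabloid \<mu> S \<longleftrightarrow> p = id \<and> S' = S"
    if S': "S' \<in> supp q" and p: "p \<in> col_perms \<mu>" for S' p
  proof
    assume eq: "tabloid \<mu> (S' \<circ> p) = tabloid \<mu> S"
    have std: "S \<in> std_tableaux lt \<mu> Y" "S' \<in> std_tableaux lt \<mu> Y" using S S' supp by auto
    have "inj_on (S' \<circ> p) (cells \<mu>)"
      using std_tableauxD(1)[OF std(2)] col_perms_permutes[OF p]
      by (simp add: comp_inj_on permutes_image permutes_inj_on)
    then have "?u (S' \<circ> p) = ?u S"
      using std_tableauxD(1)[OF std(1)] eq by (simp add: row_weight_tabloid)
    then have "p = id"
      using row_weight_less[OF part injw[OF std(2)] std_col_increasing[OF part rk std(2)] p]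
        max[OF S'] by (auto simp: o_assoc[symmetric])
    then show "p = id \<and> S' = S"
      using std_tabloid_inj[OF rk std(2,1)] eq by simp
  qed simp
  have "coef (polytabloid \<mu> S') (tabloid \<mu> S) = (if S' = S then 1 else 0)" if S': "S' \<in> supp q" for S'
  proof -
    have "coef (polytabloid \<mu> S') (tabloid \<mu> S) =
        (\<Sum>p\<in>col_perms \<mu>. if p = id \<and> S' = S then of_int (sign p) else 0)"
      using supp S' by (subst polytabloid_cells)
        (auto simp: lookup_sum lookup_single when_def tab dest: std_tableauxD intro!: sum.cong)
    also have "\<dots> = (\<Sum>p\<in>col_perms \<mu>. if p = id then (if S' = S then 1 else 0) else 0)"
      by (intro sum.cong) auto
    finally show ?thesis by (simp add: id_col_perms)
  qed
  then have "coef (lin_ext (polytabloid \<mu>) q) (tabloid \<mu> S) =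
      (\<Sum>S'\<in>supp q. if S' = S then coef q S' else 0)"
    unfolding coef_lin_ext[OF finite_keys subset_refl] by (intro sum.cong) auto
  also have "\<dots> = coef q S" using S(1) by simp
  finally show False using zero S(1) by (simp add: in_keys_iff)
qed


section \<open>Straightening\<close>

definition std_span :: "('e \<Rightarrow> 'e \<Rightarrow> bool) \<Rightarrow> nat list \<Rightarrow> 'e set \<Rightarrow> ((nat \<Rightarrow> 'e set) \<Rightarrow>\<^sub>0 complex) set" where
  "std_span lt \<mu> Y = {lin_ext (polytabloid \<mu>) q | q. supp q \<subseteq> std_tableaux lt \<mu> Y}"

text \<open>The termination measure of the Garnir straightening: the terms of a Garnir relation that differ
  from the given filling by more than a column permutation have larger column weight.\<close>

definition col_weight :: "nat list \<Rightarrow> (nat \<times> nat \<Rightarrow> nat) \<Rightarrow> nat" where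
  "col_weight \<mu> G = (\<Sum>x\<in>cells \<mu>. snd x * G x)"

lemma std_span_scale: "p \<in> std_span lt \<mu> Y \<Longrightarrow> scale c p \<in> std_span lt \<mu> Y"
  unfolding std_span_def by clarsimp (metis (no_types) lin_ext_scale subset_trans supp_scale)

lemma std_span_add:
  assumes "p \<in> std_span lt \<mu> Y" "p' \<in> std_span lt \<mu> Y"
  shows "p + p' \<in> std_span lt \<mu> Y"
proof -
  obtain q q' where q: "supp q \<subseteq> std_tableaux lt \<mu> Y" "p = lin_ext (polytabloid \<mu>) q"
    "supp q' \<subseteq> std_tableaux lt \<mu> Y" "p' = lin_ext (polytabloid \<mu>) q'"
    using assms by (auto simp: std_span_def)
  then have "supp (q + q') \<subseteq> std_tableaux lt \<mu> Y" using keys_add[of q q'] by blast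
  then show ?thesis using q unfolding std_span_def by (metis (mono_tags, lifting) CollectI lin_ext_add)
qed

lemma std_span_zero: "0 \<in> std_span lt \<mu> Y"
  unfolding std_span_def by (auto intro!: exI[of _ 0])

lemma std_span_sum: "(\<And>a. a \<in> A \<Longrightarrow> f a \<in> std_span lt \<mu> Y) \<Longrightarrow> sum f A \<in> std_span lt \<mu> Y"
  by (induction A rule: infinite_finite_induct) (auto intro: std_span_zero std_span_add)

text \<open>By injectivity as many elements enter \<open>B\<close> as leave it. Each entering value
  exceeds \<open>g\<close>, and each leaving value is at most \<open>g\<close>.\<close>

lemma sum_exchange_less:
  fixes G :: "'a \<Rightarrow> nat"
  assumes "finite B" "inj_on s B" "s ` B \<subseteq> A \<union> B" "\<not> s ` B \<subseteq> B"
    and big: "\<And>x. x \<in> A \<Longrightarrow> g < G x" and small: "\<And>y. y \<in> B \<Longrightarrow> G y \<le> g"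
  shows "sum G B < (\<Sum>x\<in>B. G (s x))"
proof -
  let ?D = "s ` B"
  have fin: "finite ?D" using assms(1) by simp
  have card: "card (B - ?D) = card (?D - B)"
    using card_image[OF assms(2)] assms(1) fin
    by (metis card_Diff_subset_Int finite_Int inf_commute)
  have pos: "card (?D - B) > 0" using assms(4) fin by (auto simp: card_gt_0_iff)
  have "sum G B = sum G (B \<inter> ?D) + sum G (B - ?D)"
    using assms(1) by (metis sum.Int_Diff)
  also have "sum G (B - ?D) \<le> card (?D - B) * g"
    unfolding card[symmetric] by (rule sum_bounded_above[where 'a=nat, simplified]) (use small in auto)
  also have "card (?D - B) * g < card (?D - B) * Suc g" using pos by simp
  also have "card (?D - B) * Suc g \<le> sum G (?D - B)"
    by (rule sum_bounded_below[where 'a=nat, simplified]) (use big assms(3) in \<open>auto simp: Suc_le_eq\<close>)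
  also have "sum G (B \<inter> ?D) + sum G (?D - B) = sum G ?D"
    using fin by (metis inf_commute sum.Int_Diff)
  also have "sum G ?D = (\<Sum>x\<in>B. G (s x))" by (simp add: sum.reindex[OF assms(2)])
  finally show ?thesis by simp
qed

text \<open>Two columns and a row in which they violate the row condition; \<open>A\<close> and \<open>B\<close> are the parts of the
  columns used in the Garnir relation.\<close>

locale garnir_cells =
  fixes \<mu> :: "nat list" and G :: "nat \<times> nat \<Rightarrow> nat" and r c c' :: nat
  assumes part: "int_partition \<mu>" and col: "col_increasing \<mu> G"
    and cc: "c < c'" and cell: "(r, c') \<in> cells \<mu>" and bad: "G (r, c') < G (r, c)"
begin

definition "A = {x \<in> cells \<mu>. snd x = c \<and> r \<le> fst x}"
definition "B = {x \<in> cells \<mu>. snd x = c' \<and> fst x \<le> r}"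

lemma fin: "finite A" "finite B"
  by (simp_all add: A_def B_def)

lemma disj: "A \<inter> B = {}"
  using cc by (auto simp: A_def B_def)

lemma AB_cells: "A \<union> B \<subseteq> cells \<mu>"
  by (auto simp: A_def B_def)

text \<open>The violation in row \<open>r\<close> spreads up column \<open>c\<close> and down column
  \<open>c'\<close>, because columns increase: the entry at \<open>(r, c')\<close> separates the
  values on \<open>A\<close> from those on \<open>B\<close>.\<close>

lemma big: "x \<in> A \<Longrightarrow> G (r, c') < G x"
  using col bad unfolding A_def col_increasing_def
  by (cases x) (auto simp: le_less intro: less_trans)

lemma small: "x \<in> B \<Longrightarrow> G x \<le> G (r, c')"
  using col cell unfolding B_def col_increasing_def by (cases x) (auto simp: le_less)

text \<open>Pigeonhole: \<open>A \<union> B\<close> has one cell more than column \<open>c\<close>.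
  The preimages of its cells under \<open>q\<close> stay in the columns \<open>c\<close> and
  \<open>c'\<close>, and since \<open>c < c'\<close> all their rows are rows of column
  \<open>c\<close>; so two of them share a row.\<close>

lemma row_repeat:
  assumes q: "q \<in> col_perms \<mu>"
  shows "\<exists>x\<in>cells \<mu>. \<exists>y\<in>cells \<mu>. x \<noteq> y \<and> fst x = fst y \<and> q x \<in> A \<union> B \<and> q y \<in> A \<union> B"
proof -
  define H where "H = {i. (i, c) \<in> cells \<mu>}"
  define U where "U = {x \<in> cells \<mu>. q x \<in> A \<union> B}"
  have qq: "q permutes cells \<mu>" by (rule col_perms_permutes[OF q])
  have finH: "finite H"
    by (rule finite_subset[of _ "fst ` cells \<mu>"]) (force simp: H_def)+
  have "q ` U = A \<union> B"
  proof (intro equalityI subsetI)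
    fix y assume y: "y \<in> A \<union> B"
    then have "y \<in> q ` cells \<mu>" using permutes_image[OF qq] AB_cells by (simp only: subsetD)
    then obtain x where "x \<in> cells \<mu>" "y = q x" by (rule imageE)
    then show "y \<in> q ` U" using y unfolding U_def by (intro image_eqI[of _ _ x]) simp_all
  qed (simp_all only: U_def image_iff mem_Collect_eq, elim bexE, simp)
  then have c1: "card U = card (A \<union> B)"
    using card_image[OF permutes_inj_on[OF qq, of U]] by simp
  have c2: "card (A \<union> B) = card A + card B" by (rule card_Un_disjoint[OF fin disj])
  have "A = (\<lambda>i. (i, c)) ` (H \<inter> {r..})" by (force simp: A_def H_def)
  then have c3: "card A = card (H \<inter> {r..})" by (simp add: card_image inj_on_def)
  have "B = (\<lambda>i. (i, c')) ` {..r}"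
    using cells_down[OF part cell _ order_refl] by (auto simp: B_def image_iff)
  \<comment> \<open>Row \<open>r\<close> is counted in \<open>A\<close> as well as in
    \<open>B\<close>. This is the surplus cell of the pigeonhole argument.\<close>
  then have c4: "card B = Suc (card {..<r})" by (simp add: card_image inj_on_def)
  have sub_H: "i \<in> H" if "i < r" for i
    using cells_down[OF part cell, of i c] cc that by (simp add: H_def)
  have c5: "card ((H \<inter> {r..}) \<union> {..<r}) = card (H \<inter> {r..}) + card {..<r}"
  proof (rule card_Un_disjoint)
    show "finite (H \<inter> {r..})" by (rule finite_Int[OF disjI1, OF finH])
    show "H \<inter> {r..} \<inter> {..<r} = {}" by (rule equals0I) (elim IntE, simp only: atLeast_iff lessThan_iff)
  qed simp
  have "(H \<inter> {r..}) \<union> {..<r} = H"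
    using sub_H by (auto simp: not_le)
  then have cardU: "card U = card H + 1"
    using c1 c2 c3 c4 c5 by simp
  have sub: "fst ` U \<subseteq> H"
  proof
    fix i assume "i \<in> fst ` U"
    then obtain x where x: "x \<in> U" "i = fst x" by auto
    then have "x \<in> cells \<mu>" "snd x \<in> {c, c'}"
      using col_perms_snd[OF q, of x] by (auto simp: U_def A_def B_def)
    then show "i \<in> H"
      using cells_down[OF part, of "fst x" "snd x" "fst x" c] cc x by (auto simp: H_def)
  qed
  have "\<not> inj_on fst U"
  proof
    assume "inj_on fst U"
    then have "card U \<le> card H" using card_mono[OF finH sub] by (simp add: card_image)
    then show False using cardU by simp
  qed
  then show ?thesis unfolding inj_on_def U_def by blast
qed

text \<open>A permutation of \<open>A \<union> B\<close> that maps the finite set \<open>B\<close>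
  into itself also preserves \<open>A\<close>, hence both columns. The corresponding terms of the
  Garnir sum are all equal to the original polytabloid, the two signs cancelling.\<close>

lemma preserving_col_perm:
  assumes s: "s permutes (A \<union> B)" and pres: "s ` B \<subseteq> B"
  shows "s \<in> col_perms \<mu>"
proof -
  have inj: "inj s" by (rule permutes_inj[OF s])
  have im: "s ` B = B"
    using pres fin inj by (metis endo_inj_surj inj_on_subset subset_UNIV)
  have "snd (s x) = snd x" if "x \<in> cells \<mu>" for x
  proof (cases "x \<in> A \<union> B")
    case True
    then have sx: "s x \<in> A \<union> B" using permutes_in_image[OF s] by blast
    show ?thesis
    proof (cases "x \<in> B")
      case True
      then show ?thesis using pres by (auto simp: B_def)
    next
      case False
      then have "s x \<notin> B" using im inj by (metis imageE injD)
      then show ?thesis using sx \<open>x \<in> A \<union> B\<close> False by (auto simp: A_def)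
    qed
  next
    case False
    then show ?thesis using s by (simp add: permutes_not_in)
  qed
  then show ?thesis
    using permutes_subset[OF s AB_cells] by (simp add: col_perms_def)
qed

text \<open>The total of the entries on \<open>A \<union> B\<close> does not change, so only the
  additional factor of column \<open>c'\<close> over column \<open>c\<close> counts. The values on
  \<open>B\<close> grow in total, since small ones are exchanged for larger ones from
  \<open>A\<close>.\<close>

lemma col_weight_less:
  assumes s: "s permutes (A \<union> B)" and pres: "\<not> s ` B \<subseteq> B"
  shows "col_weight \<mu> G < col_weight \<mu> (G \<circ> s)"
proof -
  obtain d where d: "c' = c + Suc d" using cc less_imp_Suc_add by force
  have split: "col_weight \<mu> K = (\<Sum>x\<in>cells \<mu> - (A \<union> B). snd x * K x) +
      (c * sum K (A \<union> B) + Suc d * sum K B)" for K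
  proof -
    have "(\<Sum>x\<in>A \<union> B. snd x * K x) = (\<Sum>x\<in>A. c * K x) + (\<Sum>x\<in>B. c' * K x)"
      using fin disj by (subst sum.union_disjoint) (auto simp: A_def B_def intro!: sum.cong)
    also have "\<dots> = c * sum K (A \<union> B) + Suc d * sum K B"
      using fin disj by (simp add: sum.union_disjoint sum_distrib_left d sum.distrib algebra_simps)
    finally show ?thesis
      unfolding col_weight_def using sum.subset_diff[OF AB_cells finite_cells, of "\<lambda>x. snd x * K x"]
      by simp
  qed
  have "(\<Sum>x\<in>cells \<mu> - (A \<union> B). snd x * (G \<circ> s) x) = (\<Sum>x\<in>cells \<mu> - (A \<union> B). snd x * G x)"
    using s by (intro sum.cong) (auto simp: permutes_not_in)
  moreover have "sum (G \<circ> s) (A \<union> B) = sum G (A \<union> B)"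
    using sum.permute[OF s, of G] by simp
  moreover have "sum G B < sum (G \<circ> s) B"
    unfolding o_def
  proof (rule sum_exchange_less[OF fin(2) _ _ pres big small])
    show "inj_on s B" using s by (rule permutes_inj_on)
    show "s ` B \<subseteq> A \<union> B" using permutes_in_image[OF s] by blast
  qed auto
  then have "Suc d * sum G B < Suc d * sum (G \<circ> s) B" by (simp only: Suc_mult_less_cancel1)
  ultimately show ?thesis unfolding split by simp
qed

end

text \<open>Sorting the columns changes the polytabloid only by a sign and keeps the column weight.
  If then no row condition fails, the filling is standard. Otherwise the Garnir relation at a
  failing pair expresses a nonzero multiple of the polytabloid through fillings of larger column
  weight, to which the induction hypothesis applies.\<close>

lemma polytabloid_in_std_span:
  fixes F :: "nat \<times> nat \<Rightarrow> 'e"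
  assumes part: "int_partition \<mu>" and rk: "ranked lt Y w"
    and "inj_on F (cells \<mu>)" "F ` cells \<mu> = Y"
  shows "polytabloid \<mu> F \<in> std_span lt \<mu> Y"
proof -
  \<comment> \<open>Every rank is at most the maximum over \<open>Y\<close>, so \<open>M\<close>
    bounds all column weights and the difference from \<open>M\<close> is a valid termination
    measure.\<close>
  define M where "M = (\<Sum>x\<in>cells \<mu>. snd x * Max (w ` Y))"
  have bound: "col_weight \<mu> (w \<circ> K) \<le> M" if "K ` cells \<mu> = Y" for K
    unfolding col_weight_def M_def
    by (intro sum_mono mult_left_mono) (auto simp: that[symmetric])
  show ?thesis
    using assms(3,4)
  proof (induction "M - col_weight \<mu> (w \<circ> F)" arbitrary: F rule: less_induct)
    case less
    have injw: "inj_on (w \<circ> F) (cells \<mu>)"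
      using less.prems rk by (auto simp: ranked_def intro!: comp_inj_on)
    obtain q where q: "q \<in> col_perms \<mu>" "col_increasing \<mu> ((w \<circ> F) \<circ> q)"
      using ex_col_increasing[OF part injw] by blast
    define F' where "F' = F \<circ> q"
    have qq: "q permutes cells \<mu>" by (rule col_perms_permutes[OF q(1)])
    have F': "inj_on F' (cells \<mu>)" "F' ` cells \<mu> = Y"
      using less.prems qq unfolding F'_def image_comp[symmetric]
      by (simp_all add: comp_inj_on permutes_image permutes_inj_on)
    have colF': "col_increasing \<mu> (w \<circ> F')" using q(2) by (simp add: F'_def o_assoc)
    have injw': "inj_on (w \<circ> F') (cells \<mu>)"
      using F' rk by (auto simp: ranked_def intro!: comp_inj_on)
    have weight: "col_weight \<mu> (w \<circ> F') = col_weight \<mu> (w \<circ> F)"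
    proof -
      have "col_weight \<mu> (w \<circ> F) = (\<Sum>x\<in>cells \<mu>. snd (q x) * (w \<circ> F) (q x))"
        unfolding col_weight_def using sum.permute[OF qq, of "\<lambda>x. snd x * (w \<circ> F) x"] by (simp add: o_def)
      also have "\<dots> = col_weight \<mu> (w \<circ> F')"
        unfolding col_weight_def by (intro sum.cong) (auto simp: F'_def col_perms_snd[OF q(1)])
      finally show ?thesis by simp
    qed
    have "polytabloid \<mu> F' \<in> std_span lt \<mu> Y"
    proof (cases "\<exists>r c c'. c < c' \<and> (r, c') \<in> cells \<mu> \<and> \<not> lt (F' (r, c)) (F' (r, c'))")
      case False
      \<comment> \<open>Standard tableaux are required to be \<open>undefined\<close> off their
        cells, whereas \<open>F'\<close> is arbitrary there.\<close>
      let ?S = "restrict F' (cells \<mu>)"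
      have lt_iff: "lt (F' x) (F' y) \<longleftrightarrow> w (F' x) < w (F' y)" if "x \<in> cells \<mu>" "y \<in> cells \<mu>" for x y
        using rk that F'(2) unfolding ranked_def by blast
      have "increasing lt \<mu> ?S"
        unfolding increasing_def
      proof (intro conjI allI impI; elim conjE)
        fix r c c' assume "c < c'" "(r, c') \<in> cells \<mu>"
        then show "lt (?S (r, c)) (?S (r, c'))"
          using False cells_down[OF part, of r c' r c] by auto
      next
        fix r r' c assume rc: "r < r'" "(r', c) \<in> cells \<mu>"
        then have "(r, c) \<in> cells \<mu>" using cells_down[OF part, of r' c r c] by auto
        then show "lt (?S (r, c)) (?S (r', c))"
          using rc lt_iff[of "(r, c)" "(r', c)"] colF' by (auto simp: col_increasing_def)
      qed
      then have S: "?S \<in> std_tableaux lt \<mu> Y"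
        using F' by (auto simp: std_tableaux_def bij_betw_def inj_on_restrict_eq)
      have "polytabloid \<mu> F' = lin_ext (polytabloid \<mu>) (bvec ?S)"
        by (simp, rule polytabloid_cong) simp
      then show ?thesis
        unfolding std_span_def using S by (intro CollectI exI[of _ "bvec ?S"]) simp
    next
      case True
      then obtain r c c' where rc: "c < c'" "(r, c') \<in> cells \<mu>" "\<not> lt (F' (r, c)) (F' (r, c'))" by blast
      have cell: "(r, c) \<in> cells \<mu>" using cells_down[OF part rc(2), of r c] rc(1) by simp
      have "(w \<circ> F') (r, c) \<noteq> (w \<circ> F') (r, c')"
        using inj_onD[OF injw' _ cell rc(2)] rc(1) by blast
      moreover have "\<not> w (F' (r, c)) < w (F' (r, c'))"
        using rc(2,3) cell rk F'(2) unfolding ranked_def by blast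
      ultimately have "(w \<circ> F') (r, c') < (w \<circ> F') (r, c)" by auto
      then interpret garnir_cells \<mu> "w \<circ> F'" r c c'
        using part colF' rc by unfold_locales auto
      let ?K = "{s. s permutes (A \<union> B)}" and ?P = "{s. s permutes (A \<union> B) \<and> s ` B \<subseteq> B}"
      let ?f = "\<lambda>s. scale (of_int (sign s)) (polytabloid \<mu> (F' \<circ> s))"
      have finK: "finite ?K" using fin by (intro finite_permutations) simp
      have sub: "?P \<subseteq> ?K" by auto
      have "sum ?f ?K = 0" by (rule garnir[OF F'(1) AB_cells row_repeat])
      then have split: "sum ?f (?K - ?P) + sum ?f ?P = 0"
        using sum.subset_diff[OF sub finK, of ?f] by simp
      have "?f s = polytabloid \<mu> F'" if "s \<in> ?P" for s
        using that preserving_col_perm[of s]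
        by (simp add: polytabloid_col_perm[OF F'(1)] scale_scale of_int_mult[symmetric] sign_idempotent
            del: of_int_mult)
      then have P: "sum ?f ?P = scale (of_nat (card ?P)) (polytabloid \<mu> F')"
        by (intro poly_mapping_eqI) (simp add: lookup_sum)
      have "id \<in> ?P" by (simp add: permutes_id)
      moreover have "finite ?P" by (rule finite_subset[OF sub finK])
      ultimately have pos: "card ?P > 0" unfolding card_gt_0_iff by blast
      have span: "sum ?f (?K - ?P) \<in> std_span lt \<mu> Y"
      proof (intro std_span_sum std_span_scale)
        fix s assume s: "s \<in> ?K - ?P"
        then have perm: "s permutes cells \<mu>" using permutes_subset[OF _ AB_cells] by auto
        have Fs: "inj_on (F' \<circ> s) (cells \<mu>)" "(F' \<circ> s) ` cells \<mu> = Y"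
          using F' perm unfolding image_comp[symmetric]
          by (simp_all add: comp_inj_on permutes_image permutes_inj_on)
        have "col_weight \<mu> (w \<circ> F') < col_weight \<mu> (w \<circ> (F' \<circ> s))"
          using col_weight_less[of s] s by (simp add: o_assoc)
        then have "M - col_weight \<mu> (w \<circ> (F' \<circ> s)) < M - col_weight \<mu> (w \<circ> F)"
          using bound[OF Fs(2)] weight by simp
        then show "polytabloid \<mu> (F' \<circ> s) \<in> std_span lt \<mu> Y"
          by (rule less.hyps) (use Fs in auto)
      qed
      \<comment> \<open>The sum over all permutations of \<open>A \<union> B\<close> repeats the
        sorted polytabloid \<open>card ?P\<close> times. This number is positive because of
        \<open>id\<close>, so it can be divided out.\<close>
      define a :: complex where "a = - 1 / of_nat (card ?P)"
      have a: "a * (- 1 * of_nat (card ?P)) = 1" using pos by (simp add: a_def)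
      from span have "scale a (sum ?f (?K - ?P)) \<in> std_span lt \<mu> Y"
        by (rule std_span_scale)
      also have "sum ?f (?K - ?P) = scale (- 1) (scale (of_nat (card ?P)) (polytabloid \<mu> F'))"
        using split P by (intro poly_mapping_eqI)
          (simp add: add_eq_0_iff2 lookup_uminus)
      finally show ?thesis unfolding scale_scale a by (simp only: scale_one)
    qed
    moreover have "polytabloid \<mu> F = scale (of_int (sign q)) (polytabloid \<mu> F')"
      by (simp add: F'_def polytabloid_col_perm[OF less.prems(1) q(1)] scale_scale
          of_int_mult[symmetric] sign_idempotent del: of_int_mult)
    ultimately show ?case by (simp add: std_span_scale)
  qed
qed

text \<open>Two expansions differ by a relation between standard polytabloids, and these are
  independent. An identity for \<open>straighten\<close> can therefore be proved by exhibiting a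
  single expansion.\<close>

lemma straighten_unique:
  assumes part: "int_partition \<mu>" and rk: "ranked lt Y w" and Y: "F ` cells \<mu> = Y"
    and q: "supp q \<subseteq> std_tableaux lt \<mu> Y" "polytabloid \<mu> F = lin_ext (polytabloid \<mu>) q"
  shows "straighten lt \<mu> F = q"
  unfolding straighten_def
proof (rule the_equality)
  fix p assume p: "supp p \<subseteq> std_tableaux lt \<mu> (F ` cells \<mu>) \<and>
    polytabloid \<mu> F = lin_ext (polytabloid \<mu>) p"
  have "supp (p - q) \<subseteq> supp p \<union> supp q" by (rule keys_diff)
  then have "p - q = 0"
    using p q Y by (intro std_polytabloids_independent[OF part rk]) (auto simp: lin_ext_diff)
  then show "p = q" by simp
qed (use q Y in simp)

lemma straighten_spec:
  assumes "int_partition \<mu>" "ranked lt Y w" "inj_on F (cells \<mu>)" "F ` cells \<mu> = Y"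
  shows "supp (straighten lt \<mu> F) \<subseteq> std_tableaux lt \<mu> Y"
    and "lin_ext (polytabloid \<mu>) (straighten lt \<mu> F) = polytabloid \<mu> F"
proof -
  obtain q where q: "supp q \<subseteq> std_tableaux lt \<mu> Y" "polytabloid \<mu> F = lin_ext (polytabloid \<mu>) q"
    using polytabloid_in_std_span[OF assms] by (auto simp: std_span_def)
  have "straighten lt \<mu> F = q" by (rule straighten_unique[OF assms(1,2,4) q])
  then show "supp (straighten lt \<mu> F) \<subseteq> std_tableaux lt \<mu> Y"
    and "lin_ext (polytabloid \<mu>) (straighten lt \<mu> F) = polytabloid \<mu> F" using q by simp_all
qed

lemma straighten_std:
  assumes "int_partition \<mu>" "ranked lt Y w" "S \<in> std_tableaux lt \<mu> Y"
  shows "straighten lt \<mu> S = bvec S"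
  by (rule straighten_unique[OF assms(1,2)]) (use std_tableauxD[OF assms(3)] assms(3) in auto)

lemma straighten_cong:
  assumes "\<And>x. x \<in> cells \<mu> \<Longrightarrow> F x = G x"
  shows "straighten lt \<mu> F = straighten lt \<mu> G"
proof -
  have "F ` cells \<mu> = G ` cells \<mu>" using assms by auto
  then show ?thesis
    unfolding straighten_def using polytabloid_cong[of \<mu> F G, OF assms] by simp
qed

text \<open>An injective \<open>f\<close> sends polytabloids to polytabloids, whatever it does to
  the order. Applying it to the expansion of \<open>F\<close> gives an expansion of
  \<open>f \<circ> F\<close> in fillings \<open>f \<circ> S\<close>, each of which is then
  straightened for the order \<open>lt'\<close>.\<close>

lemma straighten_comp:
  fixes F :: "nat \<times> nat \<Rightarrow> 'e" and f :: "'e \<Rightarrow> 'f"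
  assumes part: "int_partition \<mu>" and Y: "inj_on F (cells \<mu>)" "F ` cells \<mu> = Y"
    and rk: "ranked lt Y w" "ranked lt' (f ` Y) w'" and inj: "inj_on f Y"
  shows "straighten lt' \<mu> (f \<circ> F) = lin_ext (\<lambda>S. straighten lt' \<mu> (f \<circ> S)) (straighten lt \<mu> F)"
proof (rule straighten_unique[OF part rk(2)])
  let ?q = "straighten lt \<mu> F" and ?f = "\<lambda>t. bvec (\<lambda>r. f ` t r) :: (nat \<Rightarrow> 'f set) \<Rightarrow>\<^sub>0 complex"
  note q = straighten_spec[OF part rk(1) Y]
  have S: "inj_on (f \<circ> S) (cells \<mu>)" "(f \<circ> S) ` cells \<mu> = f ` Y" if "S \<in> supp ?q" for S
    using that q(1) inj std_tableauxD(1,2)[of S lt \<mu> Y] unfolding image_comp[symmetric]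
    by (auto simp: comp_inj_on)
  show "(f \<circ> F) ` cells \<mu> = f ` Y" using Y unfolding image_comp[symmetric] by simp
  show "supp (lin_ext (\<lambda>S. straighten lt' \<mu> (f \<circ> S)) ?q) \<subseteq> std_tableaux lt' \<mu> (f ` Y)"
    by (rule supp_lin_ext) (rule straighten_spec(1)[OF part rk(2) S])
  have "polytabloid \<mu> (f \<circ> F) = lin_ext ?f (polytabloid \<mu> F)"
    using Y inj by (intro polytabloid_comp) auto
  also have "\<dots> = lin_ext (\<lambda>S. lin_ext ?f (polytabloid \<mu> S)) ?q"
    using q(2) by (metis lin_ext_lin_ext)
  also have "\<dots> = lin_ext (\<lambda>S. polytabloid \<mu> (f \<circ> S)) ?q"
  proof (rule lin_ext_cong)
    fix S assume "S \<in> supp ?q"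
    then have "S \<in> std_tableaux lt \<mu> Y" using q(1) by auto
    then show "lin_ext ?f (polytabloid \<mu> S) = polytabloid \<mu> (f \<circ> S)"
      using inj std_tableauxD(1,2)[of S lt \<mu> Y] by (intro polytabloid_comp[symmetric]) auto
  qed
  also have "\<dots> = lin_ext (\<lambda>S. lin_ext (polytabloid \<mu>) (straighten lt' \<mu> (f \<circ> S))) ?q"
    by (intro lin_ext_cong) (simp add: straighten_spec(2)[OF part rk(2) S])
  finally show "polytabloid \<mu> (f \<circ> F) =
      lin_ext (polytabloid \<mu>) (lin_ext (\<lambda>S. straighten lt' \<mu> (f \<circ> S)) ?q)"
    by (simp add: lin_ext_lin_ext)
qed


section \<open>Straightening of tuples\<close>

text \<open>The entry sets \<open>Y i\<close> are parameters, so that a filling and all the standard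
  tuples in its expansion satisfy the same predicate.\<close>

definition tuple_filling :: "('e \<Rightarrow> 'e \<Rightarrow> bool) \<Rightarrow> ('e \<Rightarrow> nat) \<Rightarrow> nat \<Rightarrow> shapes \<Rightarrow>
    (nat \<Rightarrow> 'e set) \<Rightarrow> (nat \<Rightarrow> nat \<times> nat \<Rightarrow> 'e) \<Rightarrow> bool" where
  "tuple_filling lt w k lam Y F \<longleftrightarrow> (\<forall>i\<in>{1..k}. int_partition (lam i) \<and>
     inj_on (F i) (cells (lam i)) \<and> F i ` cells (lam i) = Y i \<and> ranked lt (Y i) w)"

abbreviation std_tuples :: "('e \<Rightarrow> 'e \<Rightarrow> bool) \<Rightarrow> nat \<Rightarrow> shapes \<Rightarrow> (nat \<Rightarrow> 'e set) \<Rightarrow>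
    (nat \<Rightarrow> nat \<times> nat \<Rightarrow> 'e) set" where
  "std_tuples lt k lam Y \<equiv> \<Pi>\<^sub>E i\<in>{1..k}. std_tableaux lt (lam i) (Y i)"

lemma finite_std_tuples:
  assumes "\<And>i. i \<in> {1..k} \<Longrightarrow> finite (Y i)"
  shows "finite (std_tuples lt k lam Y)"
  using assms by (intro finite_PiE finite_std_tableaux) auto

lemma tuple_filling_finite: "tuple_filling lt w k lam Y F \<Longrightarrow> i \<in> {1..k} \<Longrightarrow> finite (Y i)"
  unfolding tuple_filling_def by (metis finite_cells finite_imageI)

lemma tuple_filling_std:
  assumes "tuple_filling lt w k lam Y F" "S \<in> std_tuples lt k lam Y"
  shows "tuple_filling lt w k lam Y S"
  unfolding tuple_filling_def
proof (intro ballI conjI)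
  fix i assume i: "i \<in> {1..k}"
  then have "S i \<in> std_tableaux lt (lam i) (Y i)" using assms(2) by auto
  then show "inj_on (S i) (cells (lam i))" "S i ` cells (lam i) = Y i"
    using std_tableauxD by blast+
  show "int_partition (lam i)" "ranked lt (Y i) w"
    using assms(1) i by (auto simp: tuple_filling_def)
qed

lemma tuple_filling_map:
  assumes "tuple_filling lt w k lam Y F"
    and "\<And>i. i \<in> {1..k} \<Longrightarrow> inj_on f (Y i)" "\<And>i. i \<in> {1..k} \<Longrightarrow> ranked lt' (f ` Y i) w'"
  shows "tuple_filling lt' w' k lam (\<lambda>i. f ` Y i) (\<lambda>i x. f (F i x))"
  unfolding tuple_filling_def
proof (intro ballI conjI)
  fix i assume i: "i \<in> {1..k}"
  have F: "inj_on (F i) (cells (lam i))" "F i ` cells (lam i) = Y i"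
    using assms(1) i by (auto simp: tuple_filling_def)
  then show "inj_on (\<lambda>x. f (F i x)) (cells (lam i))"
    using comp_inj_on[OF F(1), of f] assms(2)[OF i] by (simp add: o_def)
  show "(\<lambda>x. f (F i x)) ` cells (lam i) = f ` Y i"
    unfolding F(2)[symmetric] by (simp add: image_image)
  show "int_partition (lam i)" "ranked lt' (f ` Y i) w'"
    using assms(1) assms(3)[OF i] i by (auto simp: tuple_filling_def)
qed

text \<open>Off the standard tuples some factor of the product already vanishes, which leaves only
  extensionality to be tested. In this form coefficients factor over the components.\<close>

lemma coef_straighten_tuple:
  assumes F: "tuple_filling lt w k lam Y F"
  shows "coef (straighten_tuple lt k lam F) R =
    (if R \<in> extensional {1..k} then \<Prod>i = 1..k. coef (straighten lt (lam i) (F i)) (R i) else 0)"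
proof -
  have PiE: "(\<Pi>\<^sub>E i\<in>{1..k}. std_tableaux lt (lam i) (F i ` cells (lam i))) = std_tuples lt k lam Y"
    using F by (intro PiE_cong) (auto simp: tuple_filling_def)
  have fin: "finite (std_tuples lt k lam Y)"
    using tuple_filling_finite[OF F] by (rule finite_std_tuples)
  have *: "coef (straighten_tuple lt k lam F) R =
      (if R \<in> std_tuples lt k lam Y then \<Prod>i = 1..k. coef (straighten lt (lam i) (F i)) (R i) else 0)"
    unfolding straighten_tuple_def PiE
    using fin by (simp add: lookup_sum lookup_single when_def del: One_nat_def)
  show ?thesis
  proof (cases "R \<in> extensional {1..k} \<and> R \<notin> std_tuples lt k lam Y")
    case True
    then obtain i where i: "i \<in> {1..k}" "R i \<notin> std_tableaux lt (lam i) (Y i)"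
      by (auto simp: PiE_def Pi_def)
    have "supp (straighten lt (lam i) (F i)) \<subseteq> std_tableaux lt (lam i) (Y i)"
      using F i(1) straighten_spec(1)[of "lam i" lt "Y i" w "F i"] by (auto simp: tuple_filling_def)
    then have "coef (straighten lt (lam i) (F i)) (R i) = 0"
      using i(2) by (auto simp: in_keys_iff)
    then have "(\<Prod>i = 1..k. coef (straighten lt (lam i) (F i)) (R i)) = 0"
      using i(1) by (intro prod_zero) auto
    then show ?thesis using * True by simp
  next
    case False
    then show ?thesis using * by (auto simp: PiE_def)
  qed
qed

lemma supp_straighten_tuple:
  assumes F: "tuple_filling lt w k lam Y F"
  shows "supp (straighten_tuple lt k lam F) \<subseteq> std_tuples lt k lam Y"
proof -
  have "(\<Pi>\<^sub>E i\<in>{1..k}. std_tableaux lt (lam i) (F i ` cells (lam i))) = std_tuples lt k lam Y"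
    using F by (intro PiE_cong) (auto simp: tuple_filling_def)
  then show ?thesis
    unfolding straighten_tuple_def by (intro supp_sum_subset) (auto split: if_splits)
qed

lemma straighten_tuple_cong:
  assumes "\<And>i x. i \<in> {1..k} \<Longrightarrow> x \<in> cells (lam i) \<Longrightarrow> F i x = G i x"
  shows "straighten_tuple lt k lam F = straighten_tuple lt k lam G"
proof -
  have "F i ` cells (lam i) = G i ` cells (lam i)" if "i \<in> {1..k}" for i
    using assms that by auto
  then have "(\<Pi>\<^sub>E i\<in>{1..k}. std_tableaux lt (lam i) (F i ` cells (lam i))) =
      (\<Pi>\<^sub>E i\<in>{1..k}. std_tableaux lt (lam i) (G i ` cells (lam i)))"
    by (intro PiE_cong) auto
  moreover have "straighten lt (lam i) (F i) = straighten lt (lam i) (G i)" if "i \<in> {1..k}" for i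
    by (rule straighten_cong) (rule assms[OF that])
  ultimately show ?thesis unfolding straighten_tuple_def by simp
qed

lemma straighten_tuple_std:
  assumes F: "tuple_filling lt w k lam Y S" and S: "S \<in> std_tuples lt k lam Y"
  shows "straighten_tuple lt k lam S = bvec S"
proof (rule poly_mapping_eqI)
  fix R
  have "straighten lt (lam i) (S i) = bvec (S i)" if "i \<in> {1..k}" for i
    using F PiE_mem[OF S that] that straighten_std[of "lam i" lt "Y i" w "S i"]
    by (auto simp: tuple_filling_def)
  then have "(\<Prod>i = 1..k. coef (straighten lt (lam i) (S i)) (R i)) =
      (\<Prod>i = 1..k. if S i = R i then 1 else 0)"
    by (intro prod.cong) (auto simp: coef_bvec)
  also have "\<dots> = (if \<forall>i\<in>{1..k}. S i = R i then 1 else 0)"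
    by (auto intro: prod_zero)
  finally have prod: "(\<Prod>i = 1..k. coef (straighten lt (lam i) (S i)) (R i)) =
      (if \<forall>i\<in>{1..k}. S i = R i then 1 else 0)" .
  have *: "coef (straighten_tuple lt k lam S) R =
      (if R \<in> extensional {1..k} \<and> (\<forall>i\<in>{1..k}. S i = R i) then 1 else 0)"
    unfolding coef_straighten_tuple[OF F] prod by auto
  have "S \<in> extensional {1..k}" using S by (simp add: PiE_def)
  then have "R \<in> extensional {1..k} \<and> (\<forall>i\<in>{1..k}. S i = R i) \<longleftrightarrow> S = R"
    using extensionalityI[of S "{1..k}" R] by blast
  then show "coef (straighten_tuple lt k lam S) R = coef (bvec S) R"
    using * by (simp add: coef_bvec)
qed

text \<open>Coefficients are products over the components, so the sum over tuples of standard
  tableaux factors into one sum for each component, and every factor is an instance of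
  \<open>straighten_comp\<close>.\<close>

lemma straighten_tuple_comp:
  fixes F :: "nat \<Rightarrow> nat \<times> nat \<Rightarrow> nat set" and f :: "nat set \<Rightarrow> nat set"
  assumes F: "tuple_filling lt w k lam Y F"
    and inj: "\<And>i. i \<in> {1..k} \<Longrightarrow> inj_on f (Y i)"
    and rk: "\<And>i. i \<in> {1..k} \<Longrightarrow> ranked lt' (f ` Y i) w'"
  shows "straighten_tuple lt' k lam (\<lambda>i x. f (F i x)) =
    lin_ext (\<lambda>S. straighten_tuple lt' k lam (\<lambda>i x. f (S i x))) (straighten_tuple lt k lam F)"
proof (rule poly_mapping_eqI)
  fix R
  let ?D = "std_tuples lt k lam Y" and ?a = "\<lambda>i. coef (straighten lt (lam i) (F i))"
  let ?b = "\<lambda>i T. coef (straighten lt' (lam i) (\<lambda>x. f (T x))) (R i)"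
  have fin: "\<And>i. i \<in> {1..k} \<Longrightarrow> finite (Y i)" by (rule tuple_filling_finite[OF F])
  note FF = tuple_filling_map[OF _ inj rk]
  have S: "tuple_filling lt w k lam Y S" if "S \<in> ?D" for S
    by (rule tuple_filling_std[OF F that])
  have "coef (lin_ext (\<lambda>S. straighten_tuple lt' k lam (\<lambda>i x. f (S i x))) (straighten_tuple lt k lam F)) R
     = (\<Sum>S\<in>?D. coef (straighten_tuple lt k lam F) S * coef (straighten_tuple lt' k lam (\<lambda>i x. f (S i x))) R)"
    by (rule coef_lin_ext[OF finite_std_tuples[OF fin] supp_straighten_tuple[OF F]])
  also have "\<dots> = (\<Sum>S\<in>?D. if R \<in> extensional {1..k} then (\<Prod>i = 1..k. ?a i (S i) * ?b i (S i)) else 0)"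
  proof (intro sum.cong refl)
    fix S assume "S \<in> ?D"
    then have "S \<in> extensional {1..k}" by (simp add: PiE_def)
    then show "coef (straighten_tuple lt k lam F) S * coef (straighten_tuple lt' k lam (\<lambda>i x. f (S i x))) R =
        (if R \<in> extensional {1..k} then (\<Prod>i = 1..k. ?a i (S i) * ?b i (S i)) else 0)"
      using coef_straighten_tuple[OF FF[OF S[OF \<open>S \<in> ?D\<close>]]]
      by (simp add: coef_straighten_tuple[OF F] prod.distrib)
  qed
  also have "\<dots> = (if R \<in> extensional {1..k}
      then (\<Prod>i = 1..k. \<Sum>T\<in>std_tableaux lt (lam i) (Y i). ?a i T * ?b i T) else 0)"
    using prod_sum_PiE[of "{1..k}" "\<lambda>i. std_tableaux lt (lam i) (Y i)" "\<lambda>i T. ?a i T * ?b i T"]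
      finite_std_tableaux[OF fin] by simp
  also have "\<dots> = (if R \<in> extensional {1..k}
      then (\<Prod>i = 1..k. coef (straighten lt' (lam i) (\<lambda>x. f (F i x))) (R i)) else 0)"
  proof (intro if_cong refl prod.cong)
    fix i assume i: "i \<in> {1..k}"
    then have Fi: "int_partition (lam i)" "inj_on (F i) (cells (lam i))" "F i ` cells (lam i) = Y i"
      "ranked lt (Y i) w" using F by (auto simp: tuple_filling_def)
    have "coef (straighten lt' (lam i) (\<lambda>x. f (F i x))) (R i) =
        coef (lin_ext (\<lambda>T. straighten lt' (lam i) (\<lambda>x. f (T x))) (straighten lt (lam i) (F i))) (R i)"
      using straighten_comp[OF Fi(1,2,3,4) rk[OF i] inj[OF i]] by (simp add: o_def)
    also have "\<dots> = (\<Sum>T\<in>std_tableaux lt (lam i) (Y i). ?a i T * ?b i T)"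
      by (rule coef_lin_ext[OF finite_std_tableaux[OF fin[OF i]]])
        (rule straighten_spec(1)[OF Fi(1,4,2,3)])
    finally show "(\<Sum>T\<in>std_tableaux lt (lam i) (Y i). ?a i T * ?b i T) =
        coef (straighten lt' (lam i) (\<lambda>x. f (F i x))) (R i)" by simp
  qed
  also have "\<dots> = coef (straighten_tuple lt' k lam (\<lambda>i x. f (F i x))) R"
    by (rule coef_straighten_tuple[OF FF[OF F], symmetric])
  finally show "coef (straighten_tuple lt' k lam (\<lambda>i x. f (F i x))) R =
      coef (lin_ext (\<lambda>S. straighten_tuple lt' k lam (\<lambda>i x. f (S i x))) (straighten_tuple lt k lam F)) R"
    by simp
qed


section \<open>Saturated sets of a uniform block permutation\<close>

text \<open>For a partition these are exactly the unions of blocks. In this form closure under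
  Boolean operations is immediate, and the notion also applies to \<open>stack\<close>, whose
  members overlap in the middle row.\<close>

definition sat :: "'a set set \<Rightarrow> 'a set \<Rightarrow> bool" where
  "sat P U \<longleftrightarrow> U \<subseteq> \<Union>P \<and> (\<forall>B\<in>P. B \<subseteq> U \<or> B \<inter> U = {})"

definition sat_rel :: "diagram \<Rightarrow> (nat set \<times> nat set) set" where
  "sat_rel d = {(A, C). sat d (Inl ` A \<union> Inr ` C)}"

lemma sat_Int: "sat P U \<Longrightarrow> sat P W \<Longrightarrow> sat P (U \<inter> W)"
  unfolding sat_def by blast

lemma sat_Un: "sat P U \<Longrightarrow> sat P W \<Longrightarrow> sat P (U \<union> W)"
  unfolding sat_def by blast

lemma sat_Diff: "sat P U \<Longrightarrow> sat P W \<Longrightarrow> sat P (U - W)"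
  unfolding sat_def by blast

lemma sat_block: "partition_on A P \<Longrightarrow> B \<in> P \<Longrightarrow> sat P B"
  unfolding sat_def partition_on_def disjoint_def by blast

lemma sat_UNIV: "partition_on A P \<Longrightarrow> sat P A"
  unfolding sat_def partition_on_def by blast

lemma sat_Union: "\<forall>U\<in>Q. sat P U \<Longrightarrow> sat P (\<Union>Q)"
  unfolding sat_def by blast

lemma sat_cases: "sat P U \<Longrightarrow> B \<in> P \<Longrightarrow> B \<subseteq> U \<or> B \<inter> U = {}"
  by (simp add: sat_def)

lemma sat_subset: "sat P U \<Longrightarrow> U \<subseteq> \<Union>P"
  by (simp add: sat_def)

lemma sat_block_subset: "sat P U \<Longrightarrow> B \<in> P \<Longrightarrow> x \<in> B \<Longrightarrow> x \<in> U \<Longrightarrow> B \<subseteq> U"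
  using sat_cases[of P U B] by auto

lemma sat_eq_Union: "sat P U \<Longrightarrow> U = \<Union>{B \<in> P. B \<subseteq> U}"
proof (intro equalityI subsetI)
  fix x assume sat: "sat P U" and x: "x \<in> U"
  then obtain B where B: "B \<in> P" "x \<in> B" unfolding sat_def by blast
  then have "B \<subseteq> U" using sat_block_subset[OF sat] x by auto
  then show "x \<in> \<Union>{B \<in> P. B \<subseteq> U}" using B by blast
qed blast

text \<open>Blocks are the minimal nonempty saturated sets: a block of \<open>P\<close> and a block
  of \<open>Q\<close> with a common point are each saturated for the other partition, hence contain
  each other.\<close>

lemma partition_eq_if_sat:
  assumes P: "partition_on A P" and Q: "partition_on A Q" and eq: "\<And>U. sat P U \<longleftrightarrow> sat Q U"
  shows "P = Q"
proof -
  have "B \<in> Q" if P: "partition_on A P" and Q: "partition_on A Q"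
    and eq: "\<And>U. sat P U \<longleftrightarrow> sat Q U" and B: "B \<in> P" for P Q :: "'a set set" and B
  proof -
    have "B \<noteq> {}" using P B by (auto simp: partition_on_def)
    then obtain x where x: "x \<in> B" by auto
    then have "x \<in> \<Union>Q" using P Q B by (auto simp: partition_on_def)
    then obtain B' where B': "B' \<in> Q" "x \<in> B'" by auto
    have "sat Q B" "sat P B'" using sat_block[OF P B] sat_block[OF Q B'(1)] eq by auto
    then have "B' \<subseteq> B" "B \<subseteq> B'" using B B' x sat_block_subset by metis+
    then show ?thesis using B' by simp
  qed
  from this[OF P Q eq] this[OF Q P] eq show ?thesis by blast
qed

lemma sum_set_split: "Inl ` (Inl -` U) \<union> Inr ` (Inr -` U) = U"
proof (intro equalityI subsetI)
  fix x assume "x \<in> U" then show "x \<in> Inl ` (Inl -` U) \<union> Inr ` (Inr -` U)" by (cases x) auto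
qed auto

lemma vimage_sum_set [simp]:
  "Inl -` (Inl ` A \<union> Inr ` C) = A" "Inr -` (Inl ` A \<union> Inr ` C) = C"
  by auto

lemma sum_set_Int: "(Inl ` A \<union> Inr ` C) \<inter> (Inl ` A' \<union> Inr ` C') = Inl ` (A \<inter> A') \<union> Inr ` (C \<inter> C')"
  and sum_set_Un: "(Inl ` A \<union> Inr ` C) \<union> (Inl ` A' \<union> Inr ` C') = Inl ` (A \<union> A') \<union> Inr ` (C \<union> C')"
  and sum_set_Diff: "(Inl ` A \<union> Inr ` C) - (Inl ` A' \<union> Inr ` C') = Inl ` (A - A') \<union> Inr ` (C - C')"
  by auto

lemma sat_rel_Int: "(A, C) \<in> sat_rel d \<Longrightarrow> (A', C') \<in> sat_rel d \<Longrightarrow> (A \<inter> A', C \<inter> C') \<in> sat_rel d"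
  unfolding sat_rel_def using sat_Int by (fastforce simp: sum_set_Int[symmetric])

lemma sat_rel_Un: "(A, C) \<in> sat_rel d \<Longrightarrow> (A', C') \<in> sat_rel d \<Longrightarrow> (A \<union> A', C \<union> C') \<in> sat_rel d"
  unfolding sat_rel_def using sat_Un by (fastforce simp: sum_set_Un[symmetric])

lemma sat_rel_Diff: "(A, C) \<in> sat_rel d \<Longrightarrow> (A', C') \<in> sat_rel d \<Longrightarrow> (A - A', C - C') \<in> sat_rel d"
  unfolding sat_rel_def using sat_Diff by (fastforce simp: sum_set_Diff[symmetric])

lemma sat_iff_sat_rel: "sat d U \<longleftrightarrow> (Inl -` U, Inr -` U) \<in> sat_rel d"
  unfolding sat_rel_def mem_Collect_eq case_prod_conv sum_set_split ..

section \<open>Diagrams as relations between sets of top and bottom vertices\<close>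

abbreviation verts :: "nat \<Rightarrow> (nat + nat) set" where
  "verts k \<equiv> Inl ` {1..k} \<union> Inr ` {1..k}"

lemma ubp_partition: "d \<in> ubp_set k \<Longrightarrow> partition_on (verts k) d"
  by (simp add: ubp_set_def)

lemma ubp_eqI:
  assumes "d \<in> ubp_set k" "d' \<in> ubp_set k" "sat_rel d = sat_rel d'"
  shows "d = d'"
  by (rule partition_eq_if_sat[OF ubp_partition[OF assms(1)] ubp_partition[OF assms(2)]])
    (simp add: sat_iff_sat_rel assms(3))

lemma sat_rel_subset:
  assumes "d \<in> ubp_set k" "(A, C) \<in> sat_rel d"
  shows "A \<subseteq> {1..k}" "C \<subseteq> {1..k}"
  using assms ubp_partition[OF assms(1)] unfolding sat_rel_def sat_def partition_on_def by auto

lemma ubp_block_card: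
  assumes "d \<in> ubp_set k" "B \<in> d"
  shows "card (Inl -` B) = card (Inr -` B)"
  using assms by (simp add: ubp_set_def)

lemma ubp_finite:
  assumes "d \<in> ubp_set k"
  shows "finite d" "B \<in> d \<Longrightarrow> finite B"
proof -
  show "finite d" by (rule finite_elements[OF _ ubp_partition[OF assms]]) simp
  show "finite B" if "B \<in> d"
    using ubp_partition[OF assms] that by (intro finite_subset[of B "verts k"]) (auto simp: partition_on_def)
qed

lemma card_vimage_Union:
  assumes "inj f" "finite D" "\<And>B. B \<in> D \<Longrightarrow> finite B" "disjoint D"
  shows "card (f -` \<Union>D) = (\<Sum>B\<in>D. card (f -` B))"
  unfolding vimage_Union
proof (rule card_UN_disjoint[OF assms(2)])
  show "\<forall>B\<in>D. finite (f -` B)" using finite_vimageI[OF assms(3,1)] by blast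
  show "\<forall>B\<in>D. \<forall>B'\<in>D. B \<noteq> B' \<longrightarrow> f -` B \<inter> f -` B' = {}"
    using disjointD[OF assms(4)] vimage_Int[of f] by (metis vimage_empty)
qed

text \<open>A saturated set is a disjoint union of blocks, and each block is balanced by
  uniformity.\<close>

lemma sat_rel_card:
  assumes d: "d \<in> ubp_set k" and AC: "(A, C) \<in> sat_rel d"
  shows "card A = card C"
proof -
  let ?U = "Inl ` A \<union> Inr ` C" and ?D = "{B \<in> d. B \<subseteq> Inl ` A \<union> Inr ` C}"
  have sat: "sat d ?U" using AC by (simp add: sat_rel_def)
  have U: "?U = \<Union>?D" by (rule sat_eq_Union[OF sat])
  have disj: "disjoint ?D"
  proof (rule disjointI)
    have "disjoint d" using ubp_partition[OF d] by (simp add: partition_on_def)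
    then show "B \<inter> B' = {}" if "B \<in> ?D" "B' \<in> ?D" "B \<noteq> B'" for B B'
      using that by (intro disjointD[of d]) simp_all
  qed
  have fin: "finite ?D" "\<And>B. B \<in> ?D \<Longrightarrow> finite B" using ubp_finite[OF d] by simp_all
  have "A = Inl -` \<Union>?D" "C = Inr -` \<Union>?D"
    unfolding U[symmetric] by (simp_all only: vimage_sum_set)
  then have "card A = card (Inl -` \<Union>?D)" "card C = card (Inr -` \<Union>?D)" by simp_all
  moreover have "card (Inl -` \<Union>?D) = (\<Sum>B\<in>?D. card (Inl -` B))"
    by (rule card_vimage_Union[OF inj_Inl fin disj])
  moreover have "card (Inr -` \<Union>?D) = (\<Sum>B\<in>?D. card (Inr -` B))"
    by (rule card_vimage_Union[OF inj_Inr fin disj])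
  moreover have "(\<Sum>B\<in>?D. card (Inl -` B)) = (\<Sum>B\<in>?D. card (Inr -` B))"
    using ubp_block_card[OF d] by (intro sum.cong) auto
  ultimately show ?thesis by simp
qed

text \<open>If \<open>C\<close> and \<open>C'\<close> are both related to \<open>A\<close>, then
  \<open>{}\<close> is related to \<open>C - C'\<close>, which is empty because related sets have
  equal size. The same argument works with the rows exchanged.\<close>

lemma sat_rel_functional:
  assumes d: "d \<in> ubp_set k"
  shows "(A, C) \<in> sat_rel d \<Longrightarrow> (A, C') \<in> sat_rel d \<Longrightarrow> C = C'"
    and "(A, C) \<in> sat_rel d \<Longrightarrow> (A', C) \<in> sat_rel d \<Longrightarrow> A = A'"
proof -
  have fin: "finite S" if "S \<subseteq> {1..k}" for S using that finite_subset by blast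
  have *: "C \<subseteq> C'" if "(A, C) \<in> sat_rel d" "(A, C') \<in> sat_rel d" for A C C'
  proof -
    have "({}, C - C') \<in> sat_rel d" using sat_rel_Diff[OF that] by simp
    then have "card (C - C') = 0" using sat_rel_card[OF d] by fastforce
    then show ?thesis using fin sat_rel_subset(2)[OF d that(1)] by auto
  qed
  have **: "A \<subseteq> A'" if "(A, C) \<in> sat_rel d" "(A', C) \<in> sat_rel d" for A A' C
  proof -
    have "(A - A', {}) \<in> sat_rel d" using sat_rel_Diff[OF that] by simp
    then have "card (A - A') = 0" using sat_rel_card[OF d] by fastforce
    then show ?thesis using fin sat_rel_subset(1)[OF d that(1)] by auto
  qed
  show "(A, C) \<in> sat_rel d \<Longrightarrow> (A, C') \<in> sat_rel d \<Longrightarrow> C = C'" using * by blast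
  show "(A, C) \<in> sat_rel d \<Longrightarrow> (A', C) \<in> sat_rel d \<Longrightarrow> A = A'" using ** by blast
qed

lemma ubp_block_nonempty:
  assumes d: "d \<in> ubp_set k" and B: "B \<in> d"
  shows "Inl -` B \<noteq> {}" "Inr -` B \<noteq> {}"
proof -
  have "B \<noteq> {}" using ubp_partition[OF d] B by (auto simp: partition_on_def)
  moreover have "finite (Inl -` B)" "finite (Inr -` B)"
    by (rule finite_vimageI[OF ubp_finite(2)[OF d B]], simp)+
  ultimately show "Inl -` B \<noteq> {}" "Inr -` B \<noteq> {}"
    using ubp_block_card[OF d B] sum_set_split[of B] by force+
qed

lemma ubp_block_sat_rel: "d \<in> ubp_set k \<Longrightarrow> B \<in> d \<Longrightarrow> (Inl -` B, Inr -` B) \<in> sat_rel d"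
  by (rule iffD1[OF sat_iff_sat_rel sat_block[OF ubp_partition]])

section \<open>Top and bottom partitions as domain and range of the relation\<close>

lemma top_part_partition:
  assumes d: "d \<in> ubp_set k"
  shows "partition_on {1..k} (top_part d)"
  unfolding partition_on_def
proof (intro conjI)
  have U: "\<Union>d = verts k" and dis: "disjoint d" using ubp_partition[OF d] by (auto simp: partition_on_def)
  have "\<Union>(top_part d) = Inl -` \<Union>d" by (auto simp: top_part_def)
  then show "\<Union>(top_part d) = {1..k}" by (simp only: U vimage_sum_set)
  show "disjoint (top_part d)"
    unfolding disjoint_def top_part_def
  proof (intro ballI impI)
    fix S T assume "S \<in> (-`) Inl ` d" "T \<in> (-`) Inl ` d" and ne: "S \<noteq> T"
    then obtain B B' where B: "S = Inl -` B" "B \<in> d" "T = Inl -` B'" "B' \<in> d" by blast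
    then have "B \<inter> B' = {}" using dis ne by (metis disjointD)
    then show "S \<inter> T = {}" unfolding B by auto
  qed
  show "{} \<notin> top_part d" using ubp_block_nonempty[OF d] by (force simp: top_part_def)
qed

lemma bot_part_partition:
  assumes d: "d \<in> ubp_set k"
  shows "partition_on {1..k} (bot_part d)"
  unfolding partition_on_def
proof (intro conjI)
  have U: "\<Union>d = verts k" and dis: "disjoint d" using ubp_partition[OF d] by (auto simp: partition_on_def)
  have "\<Union>(bot_part d) = Inr -` \<Union>d" by (auto simp: bot_part_def)
  then show "\<Union>(bot_part d) = {1..k}" by (simp only: U vimage_sum_set)
  show "disjoint (bot_part d)"
    unfolding disjoint_def bot_part_def
  proof (intro ballI impI)
    fix S T assume "S \<in> (-`) Inr ` d" "T \<in> (-`) Inr ` d" and ne: "S \<noteq> T"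
    then obtain B B' where B: "S = Inr -` B" "B \<in> d" "T = Inr -` B'" "B' \<in> d" by blast
    then have "B \<inter> B' = {}" using dis ne by (metis disjointD)
    then show "S \<inter> T = {}" unfolding B by auto
  qed
  show "{} \<notin> bot_part d" using ubp_block_nonempty[OF d] by (force simp: bot_part_def)
qed

text \<open>The union of the blocks whose top part lies in \<open>A\<close> meets the top row
  exactly in \<open>A\<close>; its bottom part is the set related to \<open>A\<close>.\<close>

lemma sat_top_part:
  assumes d: "d \<in> ubp_set k"
  shows "sat (top_part d) A \<longleftrightarrow> A \<in> Domain (sat_rel d)"
proof
  assume A: "sat (top_part d) A"
  let ?D = "{B \<in> d. Inl -` B \<subseteq> A}"
  have sat: "sat d (\<Union>?D)" using sat_block[OF ubp_partition[OF d]] by (intro sat_Union) auto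
  have "x \<in> Inl -` \<Union>?D" if "x \<in> A" for x
  proof -
    have "x \<in> \<Union>(top_part d)" using sat_subset[OF A] that by auto
    then obtain B where "B \<in> d" "x \<in> Inl -` B" unfolding top_part_def by blast
    moreover from this have "Inl -` B \<subseteq> A"
      by (intro sat_block_subset[OF A _ _ that]) (simp_all add: top_part_def)
    ultimately show ?thesis by blast
  qed
  then have "Inl -` \<Union>?D = A" by blast
  moreover have "(Inl -` \<Union>?D, Inr -` \<Union>?D) \<in> sat_rel d" by (rule iffD1[OF sat_iff_sat_rel sat])
  ultimately show "A \<in> Domain (sat_rel d)" by (metis DomainI)
next
  assume "A \<in> Domain (sat_rel d)"
  then obtain C where C: "sat d (Inl ` A \<union> Inr ` C)" by (auto simp: sat_rel_def)
  have 1: "A \<subseteq> \<Union>(top_part d)"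
    using sat_subset[OF C] unfolding top_part_def by blast
  have 2: "Inl -` B \<subseteq> A \<or> Inl -` B \<inter> A = {}" if "B \<in> d" for B
  proof -
    have "B \<subseteq> Inl ` A \<union> Inr ` C \<or> B \<inter> (Inl ` A \<union> Inr ` C) = {}"
      by (rule sat_cases[OF C that])
    then show ?thesis by auto
  qed
  show "sat (top_part d) A" unfolding sat_def using 1 2 by (auto simp: top_part_def)
qed

lemma sat_bot_part:
  assumes d: "d \<in> ubp_set k"
  shows "sat (bot_part d) C \<longleftrightarrow> C \<in> Range (sat_rel d)"
proof
  assume C: "sat (bot_part d) C"
  let ?D = "{B \<in> d. Inr -` B \<subseteq> C}"
  have sat: "sat d (\<Union>?D)" using sat_block[OF ubp_partition[OF d]] by (intro sat_Union) auto
  have "x \<in> Inr -` \<Union>?D" if "x \<in> C" for x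
  proof -
    have "x \<in> \<Union>(bot_part d)" using sat_subset[OF C] that by auto
    then obtain B where "B \<in> d" "x \<in> Inr -` B" unfolding bot_part_def by blast
    moreover from this have "Inr -` B \<subseteq> C"
      by (intro sat_block_subset[OF C _ _ that]) (simp_all add: bot_part_def)
    ultimately show ?thesis by blast
  qed
  then have "Inr -` \<Union>?D = C" by blast
  moreover have "(Inl -` \<Union>?D, Inr -` \<Union>?D) \<in> sat_rel d" by (rule iffD1[OF sat_iff_sat_rel sat])
  ultimately show "C \<in> Range (sat_rel d)" by (metis RangeI)
next
  assume "C \<in> Range (sat_rel d)"
  then obtain A where A: "sat d (Inl ` A \<union> Inr ` C)" by (auto simp: sat_rel_def)
  have 1: "C \<subseteq> \<Union>(bot_part d)"
    using sat_subset[OF A] unfolding bot_part_def by blast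
  have 2: "Inr -` B \<subseteq> C \<or> Inr -` B \<inter> C = {}" if "B \<in> d" for B
  proof -
    have "B \<subseteq> Inl ` A \<union> Inr ` C \<or> B \<inter> (Inl ` A \<union> Inr ` C) = {}"
      by (rule sat_cases[OF A that])
    then show ?thesis by auto
  qed
  show "sat (bot_part d) C" unfolding sat_def using 1 2 by (auto simp: bot_part_def)
qed

section \<open>The diagram product as composition of relations\<close>

locale diagram_product =
  fixes k :: nat and d d' :: diagram
  assumes d: "d \<in> ubp_set k" and d': "d' \<in> ubp_set k"
begin

definition "E = (\<Union>B\<in>stack d d'. B \<times> B)"

abbreviation "upmap \<equiv> map_sum id Inl :: nat + nat \<Rightarrow> nat + nat + nat"
abbreviation "outmap \<equiv> map_sum id Inr :: nat + nat \<Rightarrow> nat + nat + nat"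

lemma equiv: "equiv UNIV (E\<^sup>*)"
proof (rule equivI)
  have "sym E" by (auto simp: E_def sym_def)
  then show "sym (E\<^sup>*)" by (rule sym_rtrancl)
qed (auto simp: refl_rtrancl trans_rtrancl)

lemma mult_def': "ubp_mult d d' = (\<lambda>K. outmap -` K) ` (\<Union>(stack d d') // E\<^sup>*) - {{}}"
  by (simp add: ubp_mult_def E_def)

lemma component: "K \<in> \<Union>(stack d d') // E\<^sup>* \<Longrightarrow> x \<in> K \<Longrightarrow> K = E\<^sup>* `` {x}"
  using equiv by (auto simp: quotient_def dest: equiv_class_eq)

lemma closed_rtrancl:
  assumes "sat (stack d d') W" "x \<in> W" "(x, y) \<in> E\<^sup>*"
  shows "y \<in> W"
  using assms(3,2) by (induction) (use assms(1) in \<open>auto simp: E_def sat_def\<close>)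

lemma component_subset: "K \<in> \<Union>(stack d d') // E\<^sup>* \<Longrightarrow> K \<subseteq> \<Union>(stack d d')"
proof -
  have "y \<in> \<Union>(stack d d')" if "x \<in> \<Union>(stack d d')" "(x, y) \<in> E\<^sup>*" for x y
    using that(2,1) by induction (auto simp: E_def)
  then show "K \<in> \<Union>(stack d d') // E\<^sup>* \<Longrightarrow> K \<subseteq> \<Union>(stack d d')" by (auto simp: quotient_def)
qed

lemma Un_blocks: "\<Union>d = verts k" "\<Union>d' = verts k"
  using ubp_partition[OF d] ubp_partition[OF d'] by (auto simp: partition_on_def)

lemma Un_stack: "\<Union>(stack d d') = Inl ` {1..k} \<union> Inr ` verts k"
proof -
  have "\<Union>(stack d d') = upmap ` \<Union>d \<union> Inr ` \<Union>d'" by (auto simp: stack_def)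
  also have "\<dots> = Inl ` {1..k} \<union> Inr ` verts k" unfolding Un_blocks image_Un image_image by auto
  finally show ?thesis .
qed

lemma outer_in_stack: "outmap u \<in> \<Union>(stack d d') \<longleftrightarrow> u \<in> verts k"
  unfolding Un_stack by (cases u) auto

text \<open>Each member of the stack comes from one factor only, so saturation can be tested on the
  traces in the two factors. The middle vertices belong to both traces.\<close>

lemma sat_stack: "sat (stack d d') W \<longleftrightarrow> sat d (upmap -` W) \<and> sat d' (Inr -` W)"
proof
  assume W: "sat (stack d d') W"
  have blocks: "upmap ` B \<subseteq> W \<or> upmap ` B \<inter> W = {}" if "B \<in> d" for B
    using W that by (auto simp: sat_def stack_def)
  have blocks': "Inr ` B \<subseteq> W \<or> Inr ` B \<inter> W = {}" if "B \<in> d'" for B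
    using W that by (auto simp: sat_def stack_def)
  have W_sub: "W \<subseteq> Inl ` {1..k} \<union> Inr ` verts k" using W Un_stack by (auto simp: sat_def)
  have "u \<in> verts k" if "u \<in> upmap -` W" for u
    using subsetD[OF W_sub, of "upmap u"] that by (cases u) auto
  moreover have "u \<in> verts k" if "u \<in> Inr -` W" for u
    using subsetD[OF W_sub, of "Inr u"] that by auto
  ultimately show "sat d (upmap -` W) \<and> sat d' (Inr -` W)"
    unfolding sat_def Un_blocks
  proof (intro conjI ballI subsetI)
    show "B \<subseteq> upmap -` W \<or> B \<inter> upmap -` W = {}" if "B \<in> d" for B using blocks[OF that] by auto
    show "B \<subseteq> Inr -` W \<or> B \<inter> Inr -` W = {}" if "B \<in> d'" for B using blocks'[OF that] by auto
  qed
next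
  assume W: "sat d (upmap -` W) \<and> sat d' (Inr -` W)"
  have "w \<in> \<Union>(stack d d')" if "w \<in> W" for w
  proof (cases w)
    case (Inl i)
    then have "upmap (Inl i) \<in> W" using that by simp
    then have "Inl i \<in> \<Union>d" by (intro subsetD[OF sat_subset[OF conjunct1[OF W]]] vimageI2)
    then show ?thesis using Inl by (force simp: stack_def)
  next
    case (Inr y)
    then have "y \<in> \<Union>d'" using W that by (auto simp: sat_def)
    then show ?thesis using Inr by (force simp: stack_def)
  qed
  moreover have "upmap ` B \<subseteq> W \<or> upmap ` B \<inter> W = {}" if "B \<in> d" for B
    using sat_cases[OF conjunct1[OF W] that] by auto
  moreover have "Inr ` B \<subseteq> W \<or> Inr ` B \<inter> W = {}" if "B \<in> d'" for B
    using sat_cases[OF conjunct2[OF W] that] by auto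
  ultimately show "sat (stack d d') W"
    unfolding sat_def stack_def by (intro conjI subsetI) (simp_all only: ball_Un ball_simps(9), auto)
qed

lemma mult_partition: "partition_on (verts k) (ubp_mult d d')"
  unfolding partition_on_def
proof (intro conjI)
  have "u \<in> \<Union>(ubp_mult d d')" if "u \<in> verts k" for u
  proof -
    have "outmap -` (E\<^sup>* `` {outmap u}) \<in> ubp_mult d d'"
      unfolding mult_def' using that outer_in_stack by (auto intro!: imageI quotientI)
    then show ?thesis by (rule UnionI) simp
  qed
  moreover have "u \<in> verts k" if u: "u \<in> \<Union>(ubp_mult d d')" for u
  proof -
    obtain K where "K \<in> \<Union>(stack d d') // E\<^sup>*" "u \<in> outmap -` K"
      using u unfolding mult_def' by blast
    then show ?thesis unfolding outer_in_stack[symmetric] using component_subset[of K] by blast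
  qed
  ultimately show "\<Union>(ubp_mult d d') = verts k" by blast
  show "disjoint (ubp_mult d d')"
    unfolding disjoint_def
  proof (intro ballI impI)
    fix S T assume "S \<in> ubp_mult d d'" "T \<in> ubp_mult d d'" and ne: "S \<noteq> T"
    then obtain K L where KL: "S = outmap -` K" "K \<in> \<Union>(stack d d') // E\<^sup>*"
      "T = outmap -` L" "L \<in> \<Union>(stack d d') // E\<^sup>*" unfolding mult_def' by blast
    show "S \<inter> T = {}"
    proof (rule ccontr)
      assume "S \<inter> T \<noteq> {}"
      then obtain u where "outmap u \<in> K" "outmap u \<in> L" using KL by auto
      then have "K = L" using component[OF KL(2)] component[OF KL(4)] by blast
      then show False using KL ne by simp
    qed
  qed
  show "{} \<notin> ubp_mult d d'" by (simp add: mult_def')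
qed

text \<open>For one inclusion, the union \<open>W\<close> of the components that meet a saturated
  outer set is saturated in the stack, and its middle row is the intermediate set of the
  composition. Conversely, two related pairs with a common middle set glue to a saturated set of the
  stack, which is a union of components.\<close>

lemma sat_rel_mult: "sat_rel (ubp_mult d d') = sat_rel d O sat_rel d'"
proof (intro equalityI subsetI)
  fix z assume z: "z \<in> sat_rel (ubp_mult d d')"
  obtain A C where AC: "z = (A, C)" by (cases z)
  let ?U = "Inl ` A \<union> Inr ` C"
  have U: "sat (ubp_mult d d') ?U" using z AC by (simp add: sat_rel_def)
  have Uk: "?U \<subseteq> verts k" using U mult_partition by (auto simp: sat_def partition_on_def)
  define W where "W = E\<^sup>* `` (outmap ` ?U)"
  have comp: "E\<^sup>* `` {outmap u} \<in> \<Union>(stack d d') // E\<^sup>*" if "u \<in> ?U" for u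
    using that Uk outer_in_stack by (intro quotientI) blast
  have W1: "W \<subseteq> \<Union>(stack d d')" using component_subset[OF comp] unfolding W_def by blast
  have W2: "B \<subseteq> W \<or> B \<inter> W = {}" if B: "B \<in> stack d d'" for B
  proof (cases "B \<inter> W = {}")
    case False
    then obtain x u where x: "x \<in> B" "u \<in> ?U" "(outmap u, x) \<in> E\<^sup>*" by (auto simp: W_def)
    have "y \<in> W" if "y \<in> B" for y
    proof -
      have "(x, y) \<in> E" using that x B by (auto simp: E_def)
      with x(3) have "(outmap u, y) \<in> E\<^sup>*" by (rule rtrancl.rtrancl_into_rtrancl)
      then show ?thesis unfolding W_def by (rule ImageI) (rule imageI[OF x(2)])
    qed
    then show ?thesis by blast
  qed simp
  have W: "sat (stack d d') W" unfolding sat_def using W1 W2 by blast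
  \<comment> \<open>The outer traces of components are the blocks of the product, and
    \<open>?U\<close> is saturated for these blocks. Passing to whole components therefore adds no
    outer vertex.\<close>
  have UW: "outmap -` W = ?U"
  proof (intro equalityI subsetI)
    fix u assume "u \<in> outmap -` W"
    then obtain v where v: "v \<in> ?U" "outmap u \<in> E\<^sup>* `` {outmap v}" by (auto simp: W_def)
    let ?X = "outmap -` (E\<^sup>* `` {outmap v})"
    have vX: "v \<in> ?X" by auto
    then have "?X \<in> ubp_mult d d'" unfolding mult_def' using comp[OF v(1)] by blast
    then have "?X \<subseteq> ?U" using v(1) vX by (intro sat_block_subset[OF U])
    then show "u \<in> ?U" using v(2) by blast
  qed (auto simp: W_def)
  define M where "M = {m. Inr (Inl m) \<in> W}"
  have "upmap -` W = Inl ` A \<union> Inr ` M"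
  proof (rule Set.set_eqI)
    fix u show "u \<in> upmap -` W \<longleftrightarrow> u \<in> Inl ` A \<union> Inr ` M"
    proof (cases u)
      case (Inl a)
      have "upmap u \<in> W \<longleftrightarrow> Inl a \<in> outmap -` W" using Inl by simp
      then show ?thesis unfolding UW using Inl by auto
    qed (auto simp: M_def)
  qed
  moreover have "Inr -` W = Inl ` M \<union> Inr ` C"
  proof (rule Set.set_eqI)
    fix u :: "nat + nat" show "u \<in> Inr -` W \<longleftrightarrow> u \<in> Inl ` M \<union> Inr ` C"
    proof (cases u)
      case (Inr a)
      have "Inr u \<in> W \<longleftrightarrow> Inr a \<in> outmap -` W" using Inr by simp
      then show ?thesis unfolding UW using Inr by auto
    qed (auto simp: M_def)
  qed
  ultimately have "(A, M) \<in> sat_rel d" "(M, C) \<in> sat_rel d'"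
    using W unfolding sat_stack sat_rel_def by simp_all
  then show "z \<in> sat_rel d O sat_rel d'" unfolding AC by blast
next
  fix z assume "z \<in> sat_rel d O sat_rel d'"
  then obtain A M C where z: "z = (A, C)" "(A, M) \<in> sat_rel d" "(M, C) \<in> sat_rel d'" by auto
  define W :: "(nat + nat + nat) set" where "W = Inl ` A \<union> Inr ` (Inl ` M \<union> Inr ` C)"
  have "upmap -` W = Inl ` A \<union> Inr ` M"
  proof (rule Set.set_eqI)
    fix u show "u \<in> upmap -` W \<longleftrightarrow> u \<in> Inl ` A \<union> Inr ` M" by (cases u) (auto simp: W_def)
  qed
  moreover have "Inr -` W = Inl ` M \<union> Inr ` C" unfolding W_def by (rule vimage_sum_set)
  ultimately have W: "sat (stack d d') W"
    using z unfolding sat_stack sat_rel_def by simp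
  have UW: "outmap -` W = Inl ` A \<union> Inr ` C"
  proof (rule Set.set_eqI)
    fix u show "u \<in> outmap -` W \<longleftrightarrow> u \<in> Inl ` A \<union> Inr ` C" by (cases u) (auto simp: W_def)
  qed
  have "K \<subseteq> W \<or> K \<inter> W = {}" if K: "K \<in> \<Union>(stack d d') // E\<^sup>*" for K
  proof (cases "K \<inter> W = {}")
    case False
    then obtain x where x: "x \<in> K" "x \<in> W" by auto
    then show ?thesis using component[OF K x(1)] closed_rtrancl[OF W x(2)] by auto
  qed simp
  then have "B \<subseteq> outmap -` W \<or> B \<inter> outmap -` W = {}" if "B \<in> ubp_mult d d'" for B
    using that unfolding mult_def' by blast
  moreover have "outmap -` W \<subseteq> \<Union>(ubp_mult d d')"
  proof
    fix u assume "u \<in> outmap -` W"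
    then have "u \<in> verts k"
      by (intro iffD1[OF outer_in_stack] subsetD[OF sat_subset[OF W]]) (rule vimageD)
    moreover have "\<Union>(ubp_mult d d') = verts k"
      using mult_partition unfolding partition_on_def by (rule conjunct1)
    ultimately show "u \<in> \<Union>(ubp_mult d d')" by (simp only:)
  qed
  ultimately have "sat (ubp_mult d d') (outmap -` W)" unfolding sat_def by blast
  then show "z \<in> sat_rel (ubp_mult d d')" unfolding UW z sat_rel_def by simp
qed

text \<open>A block of the product is a related pair, so its two halves both have the size of an
  intermediate set in the middle row.\<close>

lemma mult_closed: "ubp_mult d d' \<in> ubp_set k"
proof -
  have "card (Inl -` B) = card (Inr -` B)" if "B \<in> ubp_mult d d'" for B
  proof -
    have "(Inl -` B, Inr -` B) \<in> sat_rel (ubp_mult d d')"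
      using sat_block[OF mult_partition that] by (simp add: sat_iff_sat_rel)
    then show ?thesis
      unfolding sat_rel_mult using sat_rel_card[OF d] sat_rel_card[OF d'] by fastforce
  qed
  then show ?thesis using mult_partition by (simp add: ubp_set_def)
qed

end

lemma sat_rel_mult: "d \<in> ubp_set k \<Longrightarrow> d' \<in> ubp_set k \<Longrightarrow> sat_rel (ubp_mult d d') = sat_rel d O sat_rel d'"
  by (rule diagram_product.sat_rel_mult, unfold_locales)

lemma ubp_mult_closed: "d \<in> ubp_set k \<Longrightarrow> d' \<in> ubp_set k \<Longrightarrow> ubp_mult d d' \<in> ubp_set k"
  by (rule diagram_product.mult_closed, unfold_locales)


section \<open>The monoid and its generators\<close>

lemma vimage_Inl_Inr [simp]:
  "Inl -` Inl ` A = A" "Inr -` Inr ` A = A" "Inl -` Inr ` A = {}" "Inr -` Inl ` A = {}"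
  by auto

text \<open>The common form of permutation diagrams, of the idempotents and of the diagrams
  \<open>ell\<close>, so that uniformity and related pairs are worked out once for all of
  them.\<close>

definition block_diag :: "(nat set \<Rightarrow> nat set) \<Rightarrow> nat set set \<Rightarrow> diagram" where
  "block_diag h P = (\<lambda>A. Inl ` A \<union> Inr ` h A) ` P"

locale block_bijection =
  fixes k :: nat and h :: "nat set \<Rightarrow> nat set" and P :: "nat set set"
  assumes P: "partition_on {1..k} P" and hP: "partition_on {1..k} (h ` P)"
    and inj: "inj_on h P" and card: "A \<in> P \<Longrightarrow> card (h A) = card A"
begin

lemma top_part_block_diag: "top_part (block_diag h P) = P"
  by (simp add: top_part_def block_diag_def image_image)

lemma bot_part_block_diag: "bot_part (block_diag h P) = h ` P"
  by (simp add: bot_part_def block_diag_def image_image)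

lemma block_diag_ubp: "block_diag h P \<in> ubp_set k"
  unfolding ubp_set_def
proof (intro CollectI conjI ballI)
  show "partition_on (verts k) (block_diag h P)"
    unfolding partition_on_def
  proof (intro conjI)
    have "\<Union>(block_diag h P) = Inl ` \<Union>P \<union> Inr ` \<Union>(h ` P)" by (auto simp: block_diag_def)
    then show "\<Union>(block_diag h P) = verts k" using P hP by (simp add: partition_on_def)
    show "disjoint (block_diag h P)"
      unfolding disjoint_def
    proof (intro ballI impI)
      fix D D' assume "D \<in> block_diag h P" "D' \<in> block_diag h P" and ne: "D \<noteq> D'"
      then obtain A A' where A: "A \<in> P" "A' \<in> P" "D = Inl ` A \<union> Inr ` h A" "D' = Inl ` A' \<union> Inr ` h A'"
        by (auto simp: block_diag_def)
      then have "A \<noteq> A'" using ne by auto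
      then have "h A \<noteq> h A'" using A inj by (auto dest: inj_onD)
      then have "A \<inter> A' = {}" "h A \<inter> h A' = {}"
        using A \<open>A \<noteq> A'\<close> disjointD[of P A A'] disjointD[of "h ` P" "h A" "h A'"] P hP
        unfolding partition_on_def by blast+
      then show "D \<inter> D' = {}" using A by auto
    qed
    show "{} \<notin> block_diag h P" using P by (auto simp: block_diag_def partition_on_def)
  qed
  fix D assume "D \<in> block_diag h P"
  then show "card (Inl -` D) = card (Inr -` D)" using card by (auto simp: block_diag_def)
qed

lemma sat_rel_block_diag: "sat_rel (block_diag h P) = {(\<Union>Q, \<Union>(h ` Q)) | Q. Q \<subseteq> P}"
proof (intro equalityI subsetI)
  fix z assume z: "z \<in> sat_rel (block_diag h P)"
  obtain A C where AC: "z = (A, C)" by (cases z)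
  have sat: "sat (block_diag h P) (Inl ` A \<union> Inr ` C)" using z AC by (simp add: sat_rel_def)
  have iff: "B \<subseteq> A \<and> h B \<subseteq> C \<or> B \<inter> A = {} \<and> h B \<inter> C = {}" if "B \<in> P" for B
  proof -
    have "Inl ` B \<union> Inr ` h B \<subseteq> Inl ` A \<union> Inr ` C \<or> (Inl ` B \<union> Inr ` h B) \<inter> (Inl ` A \<union> Inr ` C) = {}"
      using that by (intro sat_cases[OF sat]) (simp add: block_diag_def)
    then show ?thesis by auto
  qed
  have U: "A \<subseteq> \<Union>P" "C \<subseteq> \<Union>(h ` P)"
    using sat unfolding sat_def block_diag_def by auto
  have ne: "B \<noteq> {}" "h B \<noteq> {}" if "B \<in> P" for B
    using P hP that by (auto simp: partition_on_def)
  let ?Q = "{B \<in> P. B \<subseteq> A \<and> h B \<subseteq> C}"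
  have "A = \<Union>?Q"
  proof (intro equalityI subsetI)
    fix x assume x: "x \<in> A"
    then obtain B where B: "B \<in> P" "x \<in> B" using subsetD[OF U(1)] by blast
    then have "B \<in> ?Q" using iff[OF B(1)] x by auto
    then show "x \<in> \<Union>?Q" using B(2) by (rule UnionI)
  qed auto
  moreover have "C = \<Union>(h ` ?Q)"
  proof (intro equalityI subsetI)
    fix x assume x: "x \<in> C"
    then obtain B where B: "B \<in> P" "x \<in> h B" using subsetD[OF U(2)] by blast
    then have "B \<in> ?Q" using iff[OF B(1)] x by auto
    then show "x \<in> \<Union>(h ` ?Q)" using B(2) by (rule UN_I)
  qed auto
  ultimately have "z = (\<Union>?Q, \<Union>(h ` ?Q)) \<and> ?Q \<subseteq> P" using AC by simp
  then show "z \<in> {(\<Union>Q, \<Union>(h ` Q)) | Q. Q \<subseteq> P}" by blast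
next
  fix z assume "z \<in> {(\<Union>Q, \<Union>(h ` Q)) | Q. Q \<subseteq> P}"
  then obtain Q where Q: "Q \<subseteq> P" "z = (\<Union>Q, \<Union>(h ` Q))" by blast
  have "sat (block_diag h P) (\<Union>((\<lambda>A. Inl ` A \<union> Inr ` h A) ` Q))"
    by (rule sat_Union) (use Q sat_block[OF ubp_partition[OF block_diag_ubp]] in \<open>auto simp: block_diag_def\<close>)
  also have "\<Union>((\<lambda>A. Inl ` A \<union> Inr ` h A) ` Q) = Inl ` \<Union>Q \<union> Inr ` \<Union>(h ` Q)" by auto
  finally show "z \<in> sat_rel (block_diag h P)" using Q by (simp add: sat_rel_def)
qed

lemma sat_rel_block: "A \<in> P \<Longrightarrow> (A, h A) \<in> sat_rel (block_diag h P)"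
  unfolding sat_rel_block_diag by (intro CollectI exI[of _ "{A}"]) simp

end

lemma singletons_partition: "partition_on A ((\<lambda>j. {j}) ` A)"
  by (auto simp: partition_on_def disjoint_def)

context
  fixes k :: nat and \<sigma> :: "nat \<Rightarrow> nat"
  assumes \<sigma>: "\<sigma> permutes {1..k}"
begin

lemma perm_block_bijection: "block_bijection k ((`) \<sigma>) ((\<lambda>j. {j}) ` {1..k})"
proof
  have "(`) \<sigma> ` (\<lambda>j. {j}) ` {1..k} = (\<lambda>j. {j}) ` (\<sigma> ` {1..k})" by (simp add: image_image)
  then show "partition_on {1..k} ((`) \<sigma> ` (\<lambda>j. {j}) ` {1..k})"
    using singletons_partition[of "{1..k}"] by (simp only: permutes_image[OF \<sigma>])
  show "inj_on ((`) \<sigma>) ((\<lambda>j. {j}) ` {1..k})"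
    using permutes_inj[OF \<sigma>] by (auto simp: inj_on_def)
qed (auto simp: singletons_partition)

lemma perm_diag_block_diag: "perm_diag k \<sigma> = block_diag ((`) \<sigma>) ((\<lambda>j. {j}) ` {1..k})"
  by (simp add: perm_diag_def block_diag_def image_image insert_commute)

lemma perm_diag_ubp: "perm_diag k \<sigma> \<in> ubp_set k"
  unfolding perm_diag_block_diag by (rule block_bijection.block_diag_ubp[OF perm_block_bijection])

lemma sat_rel_perm_diag: "sat_rel (perm_diag k \<sigma>) = {(A, \<sigma> ` A) | A. A \<subseteq> {1..k}}"
proof -
  have "sat_rel (perm_diag k \<sigma>) =
      {(\<Union>Q, \<Union>((`) \<sigma> ` Q)) | Q. Q \<subseteq> (\<lambda>j. {j}) ` {1..k}}"
    unfolding perm_diag_block_diag by (rule block_bijection.sat_rel_block_diag[OF perm_block_bijection])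
  also have "\<dots> = {(A, \<sigma> ` A) | A. A \<subseteq> {1..k}}"
  proof (intro equalityI subsetI)
    fix z assume "z \<in> {(A, \<sigma> ` A) | A. A \<subseteq> {1..k}}"
    then obtain A where A: "A \<subseteq> {1..k}" "z = (A, \<sigma> ` A)" by blast
    then show "z \<in> {(\<Union>Q, \<Union>((`) \<sigma> ` Q)) | Q. Q \<subseteq> (\<lambda>j. {j}) ` {1..k}}"
      by (intro CollectI exI[of _ "(\<lambda>j. {j}) ` A"]) auto
  next
    fix z assume "z \<in> {(\<Union>Q, \<Union>((`) \<sigma> ` Q)) | Q. Q \<subseteq> (\<lambda>j. {j}) ` {1..k}}"
    then obtain Q where Q: "Q \<subseteq> (\<lambda>j. {j}) ` {1..k}" "z = (\<Union>Q, \<Union>((`) \<sigma> ` Q))" by blast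
    then have "\<Union>Q \<subseteq> {1..k}" "\<sigma> ` \<Union>Q = \<Union>((`) \<sigma> ` Q)" by auto
    then show "z \<in> {(A, \<sigma> ` A) | A. A \<subseteq> {1..k}}"
      unfolding Q(2) by (intro CollectI exI[of _ "\<Union>Q"]) simp
  qed
  finally show ?thesis .
qed

end

lemma e_block_bijection: "partition_on {1..k} \<pi> \<Longrightarrow> block_bijection k id \<pi>"
  by unfold_locales auto

lemma e_diag_block_diag: "e_diag \<pi> = block_diag id \<pi>"
  by (simp add: e_diag_def block_diag_def)

lemma e_diag_ubp: "partition_on {1..k} \<pi> \<Longrightarrow> e_diag \<pi> \<in> ubp_set k"
  unfolding e_diag_block_diag by (rule block_bijection.block_diag_ubp[OF e_block_bijection])

lemma sat_iff_Union:
  assumes "partition_on S P"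
  shows "sat P A \<longleftrightarrow> (\<exists>Q\<subseteq>P. A = \<Union>Q)"
proof
  assume "sat P A"
  then have "A = \<Union>{B \<in> P. B \<subseteq> A}" by (rule sat_eq_Union)
  then show "\<exists>Q\<subseteq>P. A = \<Union>Q" by (intro exI[of _ "{B \<in> P. B \<subseteq> A}"] conjI) auto
next
  assume "\<exists>Q\<subseteq>P. A = \<Union>Q"
  then obtain Q where "Q \<subseteq> P" "A = \<Union>Q" by (elim exE conjE)
  then show "sat P A" using sat_block[OF assms] by (auto intro!: sat_Union)
qed

lemma sat_rel_e_diag:
  assumes "partition_on {1..k} \<pi>"
  shows "sat_rel (e_diag \<pi>) = {(A, A) | A. sat \<pi> A}"
  unfolding e_diag_block_diag block_bijection.sat_rel_block_diag[OF e_block_bijection[OF assms]]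
    sat_iff_Union[OF assms] by auto

lemma one_ubp: "perm_diag k id \<in> ubp_set k"
  by (rule perm_diag_ubp[OF permutes_id])

lemma sat_rel_one: "sat_rel (perm_diag k id) = {(A, A) | A. A \<subseteq> {1..k}}"
  by (simp add: sat_rel_perm_diag[OF permutes_id])

lemma monoid_ubp: "monoid (ubp k)"
proof (rule monoidI; unfold ubp_def monoid.simps partial_object.simps)
  show "perm_diag k id \<in> ubp_set k" by (rule one_ubp)
  fix x assume x: "x \<in> ubp_set k"
  have "(A, C) \<in> sat_rel (ubp_mult (perm_diag k id) x) \<longleftrightarrow> (A, C) \<in> sat_rel x"
    "(A, C) \<in> sat_rel (ubp_mult x (perm_diag k id)) \<longleftrightarrow> (A, C) \<in> sat_rel x" for A C
    unfolding sat_rel_mult[OF one_ubp x] sat_rel_mult[OF x one_ubp] sat_rel_one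
    using sat_rel_subset[OF x, of A C] by auto
  then have "sat_rel (ubp_mult (perm_diag k id) x) = sat_rel x" "sat_rel (ubp_mult x (perm_diag k id)) = sat_rel x"
    by auto
  then show "ubp_mult (perm_diag k id) x = x" "ubp_mult x (perm_diag k id) = x"
    using x one_ubp by (simp_all add: ubp_eqI[of _ k] ubp_mult_closed)
  fix y assume y: "y \<in> ubp_set k"
  show "ubp_mult x y \<in> ubp_set k" using x y by (rule ubp_mult_closed)
  fix z assume z: "z \<in> ubp_set k"
  show "ubp_mult (ubp_mult x y) z = ubp_mult x (ubp_mult y z)"
    by (rule ubp_eqI[of _ k]) (use x y z in \<open>simp_all add: ubp_mult_closed sat_rel_mult[of _ k] O_assoc\<close>)
qed

section \<open>Generation of the monoid by adjacent transpositions and merges\<close>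

inductive_set ubp_gen :: "nat \<Rightarrow> diagram set" for k where
  one: "perm_diag k id \<in> ubp_gen k"
| s: "i \<in> {1..<k} \<Longrightarrow> s_gen k i \<in> ubp_gen k"
| b: "i \<in> {1..<k} \<Longrightarrow> b_gen k i \<in> ubp_gen k"
| mult: "d \<in> ubp_gen k \<Longrightarrow> d' \<in> ubp_gen k \<Longrightarrow> ubp_mult d d' \<in> ubp_gen k"

lemma transpose_permutes:
  fixes i :: nat
  shows "i \<in> {1..<k} \<Longrightarrow> Transposition.transpose i (i + 1) permutes {1..k}"
  by (rule permutes_swap_id) auto

lemma s_gen_ubp: "i \<in> {1..<k} \<Longrightarrow> s_gen k i \<in> ubp_set k"
  unfolding s_gen_def by (rule perm_diag_ubp[OF transpose_permutes])

lemma sat_rel_s_gen: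
  "i \<in> {1..<k} \<Longrightarrow> sat_rel (s_gen k i) = {(A, Transposition.transpose i (i + 1) ` A) | A. A \<subseteq> {1..k}}"
  unfolding s_gen_def by (rule sat_rel_perm_diag[OF transpose_permutes])

lemma b_partition:
  fixes i :: nat
  shows "i \<in> {1..<k} \<Longrightarrow> partition_on {1..k} (insert {i, i + 1} ((\<lambda>j. {j}) ` ({1..k} - {i, i + 1})))"
  by (auto simp: partition_on_def disjoint_def)

lemma b_gen_ubp: "i \<in> {1..<k} \<Longrightarrow> b_gen k i \<in> ubp_set k"
  unfolding b_gen_def by (rule e_diag_ubp[OF b_partition])

lemma sat_rel_b_gen:
  assumes i: "i \<in> {1..<k}"
  shows "sat_rel (b_gen k i) = {(A, A) | A. A \<subseteq> {1..k} \<and> (i \<in> A \<longleftrightarrow> i + 1 \<in> A)}"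
proof -
  let ?P = "insert {i, i + 1} ((\<lambda>j. {j}) ` ({1..k} - {i, i + 1}))"
  have "sat ?P A \<longleftrightarrow> A \<subseteq> {1..k} \<and> (i \<in> A \<longleftrightarrow> i + 1 \<in> A)" for A
  proof -
    have "\<Union>?P = {1..k}" using b_partition[OF i] by (simp add: partition_on_def)
    then show ?thesis unfolding sat_def by auto
  qed
  then show ?thesis unfolding b_gen_def sat_rel_e_diag[OF b_partition[OF i]] by simp
qed

lemma ubp_gen_subset: "d \<in> ubp_gen k \<Longrightarrow> d \<in> ubp_set k"
  by (induction rule: ubp_gen.induct) (auto simp: one_ubp s_gen_ubp b_gen_ubp ubp_mult_closed)

text \<open>A path through the stacked diagram meets the upper factor first, so the product of
  diagrams reverses the usual composition of permutations.\<close>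

lemma perm_diag_mult:
  assumes "\<sigma> permutes {1..k}" "\<tau> permutes {1..k}"
  shows "ubp_mult (perm_diag k \<sigma>) (perm_diag k \<tau>) = perm_diag k (\<tau> \<circ> \<sigma>)"
proof (rule ubp_eqI[of _ k])
  have sub: "\<sigma> ` A \<subseteq> {1..k}" if "A \<subseteq> {1..k}" for A
    using image_mono[OF that, of \<sigma>] permutes_image[OF assms(1)] by simp
  have "sat_rel (ubp_mult (perm_diag k \<sigma>) (perm_diag k \<tau>)) =
      {(A, \<sigma> ` A) | A. A \<subseteq> {1..k}} O {(A, \<tau> ` A) | A. A \<subseteq> {1..k}}"
    using assms by (simp add: sat_rel_mult[of _ k] perm_diag_ubp sat_rel_perm_diag)
  also have "\<dots> = {(A, (\<tau> \<circ> \<sigma>) ` A) | A. A \<subseteq> {1..k}}"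
    using sub by (auto simp: image_comp relcomp_unfold)
  also have "\<dots> = sat_rel (perm_diag k (\<tau> \<circ> \<sigma>))"
    by (simp only: sat_rel_perm_diag[OF permutes_compose[OF assms]])
  finally show "sat_rel (ubp_mult (perm_diag k \<sigma>) (perm_diag k \<tau>)) = sat_rel (perm_diag k (\<tau> \<circ> \<sigma>))" .
qed (use assms in \<open>auto simp: ubp_mult_closed perm_diag_ubp permutes_compose\<close>)

lemma adjacent_gen: "i \<in> {1..<k} \<Longrightarrow> perm_diag k (Transposition.transpose i (i + 1)) \<in> ubp_gen k"
  using ubp_gen.s by (simp add: s_gen_def)

text \<open>Conjugating the transposition of \<open>a\<close> and \<open>b\<close> by that of
  \<open>b\<close> and \<open>b + 1\<close> gives the transposition of \<open>a\<close> and
  \<open>b + 1\<close>. The distance is written \<open>Suc n\<close> so that the induction starts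
  with adjacent points.\<close>

lemma transposition_gen_aux:
  assumes "1 \<le> a" "a + Suc n \<le> k"
  shows "perm_diag k (Transposition.transpose a (a + Suc n)) \<in> ubp_gen k"
  using assms(2)
proof (induction n)
  case 0
  then show ?case using adjacent_gen[of a k] assms(1) by simp
next
  case (Suc n)
  let ?b = "a + Suc n"
  let ?t = "Transposition.transpose ?b (?b + 1)" and ?u = "Transposition.transpose a ?b"
  have t: "?t permutes {1..k}" "?u permutes {1..k}"
    using Suc.prems assms(1) by (auto intro!: permutes_swap_id)
  have "Transposition.transpose a (a + Suc (Suc n)) = ?t \<circ> (?u \<circ> ?t)"
    by (auto simp: fun_eq_iff Transposition.transpose_def)
  then have "perm_diag k (Transposition.transpose a (a + Suc (Suc n))) =
      ubp_mult (ubp_mult (perm_diag k ?t) (perm_diag k ?u)) (perm_diag k ?t)"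
    using t by (simp add: perm_diag_mult permutes_compose)
  moreover have "perm_diag k ?t \<in> ubp_gen k"
    using adjacent_gen[of ?b k] Suc.prems assms(1) by simp
  moreover have "perm_diag k ?u \<in> ubp_gen k" using Suc by simp
  ultimately show ?case by (simp add: ubp_gen.mult)
qed

lemma transposition_gen:
  assumes "a \<in> {1..k}" "b \<in> {1..k}" "a \<noteq> b"
  shows "perm_diag k (Transposition.transpose a b) \<in> ubp_gen k"
proof -
  have *: "perm_diag k (Transposition.transpose a b) \<in> ubp_gen k"
    if "a < b" "1 \<le> a" "b \<le> k" for a b
    using transposition_gen_aux[of a "b - a - 1" k] that by simp
  show ?thesis
    using *[of a b] *[of b a] assms by (cases "a < b") (auto simp: transpose_commute)
qed

lemma perm_diag_gen:
  assumes "\<sigma> permutes {1..k}"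
  shows "perm_diag k \<sigma> \<in> ubp_gen k"
  using assms finite_atLeastAtMost[of 1 k]
proof (induction rule: permutes_induct)
  case (swap a b p)
  then have eq: "perm_diag k (Transposition.transpose a b \<circ> p) =
      ubp_mult (perm_diag k p) (perm_diag k (Transposition.transpose a b))"
    by (simp add: perm_diag_mult permutes_swap_id)
  show ?case unfolding eq using swap by (blast intro: ubp_gen.mult transposition_gen)
qed (auto intro: ubp_gen.one simp: id_def[symmetric])

lemma relcomp3E:
  assumes "z \<in> R O S O T"
  obtains A B C D where "z = (A, D)" "(A, B) \<in> R" "(B, C) \<in> S" "(C, D) \<in> T"
  using assms by blast

text \<open>Merging \<open>a\<close> and \<open>b\<close> is the conjugate of the first merge by a
  permutation that takes \<open>a\<close> to \<open>1\<close> and \<open>b\<close> to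
  \<open>2\<close>. For \<open>a = b\<close> the identity diagram serves.\<close>

lemma pair_gen:
  assumes "a \<in> {1..k}" "b \<in> {1..k}"
  shows "\<exists>m\<in>ubp_gen k. sat_rel m = {(A, A) | A. A \<subseteq> {1..k} \<and> (a \<in> A \<longleftrightarrow> b \<in> A)}"
proof (cases "a = b")
  case True
  then show ?thesis by (intro bexI[OF _ ubp_gen.one]) (simp add: sat_rel_one)
next
  case False
  then have k2: "2 \<le> k" using assms by auto
  \<comment> \<open>\<open>\<tau>\<close> takes \<open>a\<close> to \<open>1\<close>, and then the
    image of \<open>b\<close> is swapped with \<open>2\<close>. As that image differs from
    \<open>1\<close>, the second swap leaves \<open>1\<close> in place.\<close>
  define \<tau> where "\<tau> = Transposition.transpose a 1"
  define \<sigma> where "\<sigma> = Transposition.transpose (\<tau> b) 2 \<circ> \<tau>"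
  have \<tau>b: "\<tau> b \<noteq> 1" "\<tau> b \<in> {1..k}"
    using False assms k2 by (auto simp: \<tau>_def Transposition.transpose_def)
  have perm: "\<sigma> permutes {1..k}"
    unfolding \<sigma>_def using assms k2 \<tau>b
    by (intro permutes_compose permutes_swap_id) (auto simp: \<tau>_def intro!: permutes_swap_id)
  have vals: "\<sigma> a = 1" "\<sigma> b = 2"
    using \<tau>b(1) by (auto simp: \<sigma>_def \<tau>_def Transposition.transpose_def)
  have one: "1 \<in> {1..<k}" using k2 by simp
  note pi = permutes_inv[OF perm]
  have sub: "\<sigma> ` A \<subseteq> {1..k}" if "A \<subseteq> {1..k}" for A
    using image_mono[OF that, of \<sigma>] permutes_image[OF perm] by simp
  let ?m = "ubp_mult (ubp_mult (perm_diag k \<sigma>) (b_gen k 1)) (perm_diag k (inv \<sigma>))"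
  have mem: "1 \<in> \<sigma> ` A \<longleftrightarrow> a \<in> A" "2 \<in> \<sigma> ` A \<longleftrightarrow> b \<in> A" for A
    using inj_image_mem_iff[OF permutes_inj[OF perm]] vals by metis+
  have back_img: "inv \<sigma> ` \<sigma> ` A = A" for A
    by (simp add: image_comp permutes_inv_o[OF perm])
  note ub = perm_diag_ubp[OF perm] b_gen_ubp[OF one]
  have b: "sat_rel (b_gen k 1) = {(A, A) | A. A \<subseteq> {1..k} \<and> (1 \<in> A \<longleftrightarrow> 2 \<in> A)}"
    using sat_rel_b_gen[OF one] by (simp add: numeral_2_eq_2)
  have "sat_rel ?m = {(A, \<sigma> ` A) | A. A \<subseteq> {1..k}} O
      {(A, A) | A. A \<subseteq> {1..k} \<and> (1 \<in> A \<longleftrightarrow> 2 \<in> A)} O {(A, inv \<sigma> ` A) | A. A \<subseteq> {1..k}}"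
    unfolding sat_rel_mult[OF ubp_mult_closed[OF ub] perm_diag_ubp[OF pi]] sat_rel_mult[OF ub]
      sat_rel_perm_diag[OF perm] sat_rel_perm_diag[OF pi] b O_assoc ..
  also have "\<dots> = {(A, A) | A. A \<subseteq> {1..k} \<and> (a \<in> A \<longleftrightarrow> b \<in> A)}"
  proof (intro equalityI subsetI)
    fix z assume "z \<in> {(A, A) | A. A \<subseteq> {1..k} \<and> (a \<in> A \<longleftrightarrow> b \<in> A)}"
    then obtain A where A: "A \<subseteq> {1..k}" "a \<in> A \<longleftrightarrow> b \<in> A" "z = (A, A)" by blast
    have rel: "(A, \<sigma> ` A) \<in> {(A, \<sigma> ` A) | A. A \<subseteq> {1..k}}"
      "(\<sigma> ` A, \<sigma> ` A) \<in> {(A, A) | A. A \<subseteq> {1..k} \<and> (1 \<in> A \<longleftrightarrow> 2 \<in> A)}"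
      "(\<sigma> ` A, A) \<in> {(A, inv \<sigma> ` A) | A. A \<subseteq> {1..k}}"
      using A sub[OF A(1)] mem[of A] back_img[of A] by (auto simp del: One_nat_def)
    show "z \<in> {(A, \<sigma> ` A) | A. A \<subseteq> {1..k}} O
      {(A, A) | A. A \<subseteq> {1..k} \<and> (1 \<in> A \<longleftrightarrow> 2 \<in> A)} O {(A, inv \<sigma> ` A) | A. A \<subseteq> {1..k}}"
      unfolding A(3) by (rule relcompI[OF rel(1) relcompI[OF rel(2,3)]])
  next
    fix z assume "z \<in> {(A, \<sigma> ` A) | A. A \<subseteq> {1..k}} O
      {(A, A) | A. A \<subseteq> {1..k} \<and> (1 \<in> A \<longleftrightarrow> 2 \<in> A)} O {(A, inv \<sigma> ` A) | A. A \<subseteq> {1..k}}"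
    then obtain A B C D where "z = (A, D)" "(A, B) \<in> {(A, \<sigma> ` A) | A. A \<subseteq> {1..k}}"
      "(B, C) \<in> {(A, A) | A. A \<subseteq> {1..k} \<and> (1 \<in> A \<longleftrightarrow> 2 \<in> A)}"
      "(C, D) \<in> {(A, inv \<sigma> ` A) | A. A \<subseteq> {1..k}}"
      by (rule relcomp3E)
    then have "A \<subseteq> {1..k}" "z = (A, inv \<sigma> ` \<sigma> ` A)" "1 \<in> \<sigma> ` A \<longleftrightarrow> 2 \<in> \<sigma> ` A"
      by (simp_all del: One_nat_def)
    then show "z \<in> {(A, A) | A. A \<subseteq> {1..k} \<and> (a \<in> A \<longleftrightarrow> b \<in> A)}"
      unfolding mem back_img by (intro CollectI exI[of _ A] conjI)
  qed
  finally have "sat_rel ?m = {(A, A) | A. A \<subseteq> {1..k} \<and> (a \<in> A \<longleftrightarrow> b \<in> A)}" .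
  moreover have "?m \<in> ubp_gen k"
    by (intro ubp_gen.mult perm_diag_gen perm pi ubp_gen.b one)
  ultimately show ?thesis by blast
qed

text \<open>Relations contained in the identity compose by intersection, so a product of merges
  accumulates their conditions.\<close>

lemma pairs_gen:
  assumes "finite R" "R \<subseteq> {1..k} \<times> {1..k}"
  shows "\<exists>m\<in>ubp_gen k. sat_rel m = {(A, A) | A. A \<subseteq> {1..k} \<and> (\<forall>(a, b)\<in>R. a \<in> A \<longleftrightarrow> b \<in> A)}"
  using assms
proof (induction R)
  case empty
  show ?case by (intro bexI[OF _ ubp_gen.one]) (simp add: sat_rel_one)
next
  case (insert p R)
  obtain a b where p: "p = (a, b)" by (cases p)
  obtain m where m: "m \<in> ubp_gen k"
    "sat_rel m = {(A, A) | A. A \<subseteq> {1..k} \<and> (\<forall>(a, b)\<in>R. a \<in> A \<longleftrightarrow> b \<in> A)}"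
    using insert by auto
  obtain m' where m': "m' \<in> ubp_gen k"
    "sat_rel m' = {(A, A) | A. A \<subseteq> {1..k} \<and> (a \<in> A \<longleftrightarrow> b \<in> A)}"
    using pair_gen[of a k b] insert.prems p by auto
  have "sat_rel (ubp_mult m m') = sat_rel m O sat_rel m'"
    using m(1) m'(1) by (intro sat_rel_mult ubp_gen_subset)
  also have "\<dots> = {(A, A) | A. A \<subseteq> {1..k} \<and> (\<forall>(a, b)\<in>insert p R. a \<in> A \<longleftrightarrow> b \<in> A)}"
    unfolding m(2) m'(2) p by (auto simp: relcomp_unfold)
  finally show ?case using m(1) m'(1) ubp_gen.mult by blast
qed

text \<open>A subset of \<open>{1..k}\<close> is a union of blocks exactly when it never separates
  two points of a block. So merging all such pairs produces the idempotent.\<close>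

lemma e_diag_gen:
  assumes \<pi>: "partition_on {1..k} \<pi>"
  shows "e_diag \<pi> \<in> ubp_gen k"
proof -
  let ?R = "\<Union>B\<in>\<pi>. B \<times> B"
  have sub: "?R \<subseteq> {1..k} \<times> {1..k}" using \<pi> by (auto simp: partition_on_def)
  then have "finite ?R" by (rule finite_subset) simp
  from pairs_gen[OF this sub] obtain m where m: "m \<in> ubp_gen k"
    "sat_rel m = {(A, A) | A. A \<subseteq> {1..k} \<and> (\<forall>(a, b)\<in>?R. a \<in> A \<longleftrightarrow> b \<in> A)}"
    by (rule bexE)
  have U: "\<Union>\<pi> = {1..k}" using \<pi> by (simp add: partition_on_def)
  have "sat \<pi> A \<longleftrightarrow> A \<subseteq> {1..k} \<and> (\<forall>(a, b)\<in>?R. a \<in> A \<longleftrightarrow> b \<in> A)" for A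
  proof
    assume A: "sat \<pi> A"
    have iff: "a \<in> A \<longleftrightarrow> b \<in> A" if "B \<in> \<pi>" "a \<in> B" "b \<in> B" for a b B
      using sat_block_subset[OF A that(1,2)] sat_block_subset[OF A that(1,3)] that by blast
    have "\<forall>(a, b)\<in>?R. a \<in> A \<longleftrightarrow> b \<in> A" using iff by fast
    then show "A \<subseteq> {1..k} \<and> (\<forall>(a, b)\<in>?R. a \<in> A \<longleftrightarrow> b \<in> A)"
      using sat_subset[OF A] unfolding U by (intro conjI)
  next
    assume A: "A \<subseteq> {1..k} \<and> (\<forall>(a, b)\<in>?R. a \<in> A \<longleftrightarrow> b \<in> A)"
    have "B \<subseteq> A \<or> B \<inter> A = {}" if B: "B \<in> \<pi>" for B
    proof (cases "B \<inter> A = {}")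
      case False
      then obtain a where a: "a \<in> B" "a \<in> A" by blast
      have "b \<in> A" if "b \<in> B" for b
      proof -
        have "(a, b) \<in> ?R" using B a(1) that by blast
        then show ?thesis using A a(2) by blast
      qed
      then show ?thesis by blast
    qed simp
    then show "sat \<pi> A" unfolding sat_def U using A by simp
  qed
  then have "e_diag \<pi> = m"
    using m \<pi> by (intro ubp_eqI[of _ k]) (simp_all add: sat_rel_e_diag e_diag_ubp ubp_gen_subset)
  then show ?thesis using m(1) by simp
qed

lemma ubp_factorization:
  assumes d: "d \<in> ubp_set k"
  shows "\<exists>\<sigma>. \<sigma> permutes {1..k} \<and> d = ubp_mult (perm_diag k \<sigma>) (e_diag (bot_part d))"
proof -
  note part = ubp_partition[OF d]
  have fin: "finite (Inl -` D)" "finite (Inr -` D)" if "D \<in> d" for D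
    by (rule finite_vimageI[OF ubp_finite(2)[OF d that]], simp)+
  have "\<forall>D\<in>d. \<exists>f. bij_betw f (Inl -` D) (Inr -` D)"
    using fin ubp_block_card[OF d] finite_same_card_bij by blast
  then obtain f where f: "\<And>D. D \<in> d \<Longrightarrow> bij_betw (f D) (Inl -` D) (Inr -` D)" by metis
  have "\<forall>x\<in>{1..k}. \<exists>D\<in>d. Inl x \<in> D" using part by (auto simp: partition_on_def)
  then obtain blk where blk: "\<And>x. x \<in> {1..k} \<Longrightarrow> blk x \<in> d \<and> Inl x \<in> blk x" by metis
  define \<sigma> where "\<sigma> x = (if x \<in> {1..k} then f (blk x) x else x)" for x
  have \<sigma>_blk: "Inr (\<sigma> x) \<in> blk x" if "x \<in> {1..k}" for x
    using f[of "blk x"] blk[OF that] that unfolding \<sigma>_def bij_betw_def by auto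
  have maps: "\<sigma> ` {1..k} \<subseteq> {1..k}"
  proof
    fix y assume "y \<in> \<sigma> ` {1..k}"
    then obtain x where x: "x \<in> {1..k}" "y = \<sigma> x" by auto
    then have "Inr y \<in> \<Union>d" using \<sigma>_blk blk by auto
    then show "y \<in> {1..k}" using part by (auto simp: partition_on_def)
  qed
  have "inj_on \<sigma> {1..k}"
  proof (rule inj_onI)
    fix x y assume xy: "x \<in> {1..k}" "y \<in> {1..k}" "\<sigma> x = \<sigma> y"
    have "Inr (\<sigma> x) \<in> blk x \<inter> blk y" using \<sigma>_blk xy by (metis IntI)
    then have eq: "blk x = blk y"
      using blk[OF xy(1)] blk[OF xy(2)] part unfolding partition_on_def disjoint_def by blast
    then show "x = y"
      using f[of "blk x"] blk[OF xy(1)] blk[OF xy(2)] xy unfolding \<sigma>_def bij_betw_def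
      by (metis inj_onD vimageI2)
  qed
  then have "bij_betw \<sigma> {1..k} {1..k}"
    using maps by (simp add: bij_betw_def endo_inj_surj)
  then have perm: "\<sigma> permutes {1..k}" by (rule bij_imp_permutes) (auto simp: \<sigma>_def)
  note bot = bot_part_partition[OF d]
  have img: "\<sigma> ` A = C" if AC: "(A, C) \<in> sat_rel d" for A C
  proof -
    have sub: "A \<subseteq> {1..k}" "C \<subseteq> {1..k}" by (rule sat_rel_subset[OF d AC])+
    have sat: "sat d (Inl ` A \<union> Inr ` C)" using AC by (simp add: sat_rel_def)
    have "\<sigma> x \<in> C" if "x \<in> A" for x
    proof -
      have x: "x \<in> {1..k}" using that sub by auto
      then have "blk x \<subseteq> Inl ` A \<union> Inr ` C"
        using blk[OF x] that by (intro sat_block_subset[OF sat, of _ "Inl x"]) auto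
      then show ?thesis using \<sigma>_blk[OF x] by auto
    qed
    then have "\<sigma> ` A \<subseteq> C" by auto
    moreover have "card (\<sigma> ` A) = card C"
      using sat_rel_card[OF d AC] card_image[OF permutes_inj_on[OF perm]] by metis
    moreover have "finite C" using sub(2) finite_subset by blast
    ultimately show ?thesis by (rule card_subset_eq[rotated])
  qed
  have "sat_rel d = {(A, \<sigma> ` A) | A. A \<subseteq> {1..k}} O {(C, C) | C. sat (bot_part d) C}"
  proof (intro equalityI subsetI)
    fix z assume z: "z \<in> sat_rel d"
    obtain A C where AC: "z = (A, C)" by (cases z)
    have "sat (bot_part d) C" using z AC sat_bot_part[OF d] by blast
    then show "z \<in> {(A, \<sigma> ` A) | A. A \<subseteq> {1..k}} O {(C, C) | C. sat (bot_part d) C}"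
      using z AC img[of A C] sat_rel_subset[OF d, of A C] by blast
  next
    fix z assume "z \<in> {(A, \<sigma> ` A) | A. A \<subseteq> {1..k}} O {(C, C) | C. sat (bot_part d) C}"
    then obtain A where A: "z = (A, \<sigma> ` A)" "A \<subseteq> {1..k}" "sat (bot_part d) (\<sigma> ` A)" by auto
    then obtain A' where A': "(A', \<sigma> ` A) \<in> sat_rel d" using sat_bot_part[OF d] by auto
    then have "A' = A" using img[OF A'] permutes_inj[OF perm] by (simp add: inj_image_eq_iff)
    then show "z \<in> sat_rel d" using A A' by simp
  qed
  then have "d = ubp_mult (perm_diag k \<sigma>) (e_diag (bot_part d))"
    using d perm bot by (intro ubp_eqI[of _ k])
      (simp_all add: ubp_mult_closed sat_rel_mult[of _ k] perm_diag_ubp e_diag_ubp sat_rel_perm_diag sat_rel_e_diag)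
  then show ?thesis using perm by blast
qed

lemma ubp_gen_eq: "ubp_gen k = ubp_set k"
proof (intro equalityI subsetI)
  fix d assume "d \<in> ubp_set k"
  then show "d \<in> ubp_gen k"
    using ubp_factorization[of d k] perm_diag_gen e_diag_gen[OF bot_part_partition] ubp_gen.mult
    by metis
qed (rule ubp_gen_subset)


section \<open>Preimages of blocks\<close>

text \<open>Junk unless \<open>C\<close> is a union of bottom blocks of \<open>d\<close>.\<close>

definition pre :: "diagram \<Rightarrow> nat set \<Rightarrow> nat set" where
  "pre d C = (THE A. (A, C) \<in> sat_rel d)"

lemma pre_eq: "d \<in> ubp_set k \<Longrightarrow> (A, C) \<in> sat_rel d \<Longrightarrow> pre d C = A"
  unfolding pre_def by (rule the_equality) (auto dest: sat_rel_functional(2))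

lemma pre_rel:
  assumes "d \<in> ubp_set k" "C \<in> Range (sat_rel d)"
  shows "(pre d C, C) \<in> sat_rel d"
proof -
  obtain A where "(A, C) \<in> sat_rel d" using assms(2) by (rule RangeE)
  then show ?thesis using pre_eq[OF assms(1)] by simp
qed

lemma pre_mult:
  assumes "d \<in> ubp_set k" "d' \<in> ubp_set k" "C \<in> Range (sat_rel d')" "pre d' C \<in> Range (sat_rel d)"
  shows "pre (ubp_mult d d') C = pre d (pre d' C)"
proof (rule pre_eq[OF ubp_mult_closed[OF assms(1,2)]])
  show "(pre d (pre d' C), C) \<in> sat_rel (ubp_mult d d')"
    unfolding sat_rel_mult[OF assms(1,2)]
    by (rule relcompI[OF pre_rel[OF assms(1,4)] pre_rel[OF assms(2,3)]])
qed

lemma Range_mult: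
  assumes "d \<in> ubp_set k" "d' \<in> ubp_set k"
  shows "C \<in> Range (sat_rel (ubp_mult d d')) \<longleftrightarrow>
    C \<in> Range (sat_rel d') \<and> pre d' C \<in> Range (sat_rel d)"
proof
  assume "C \<in> Range (sat_rel (ubp_mult d d'))"
  then obtain A B where "(A, B) \<in> sat_rel d" "(B, C) \<in> sat_rel d'"
    unfolding sat_rel_mult[OF assms] by blast
  then show "C \<in> Range (sat_rel d') \<and> pre d' C \<in> Range (sat_rel d)"
    using pre_eq[OF assms(2)] by blast
next
  assume "C \<in> Range (sat_rel d') \<and> pre d' C \<in> Range (sat_rel d)"
  then show "C \<in> Range (sat_rel (ubp_mult d d'))"
    unfolding sat_rel_mult[OF assms] using pre_rel[OF assms(2)] by blast
qed

lemma inj_on_pre: "d \<in> ubp_set k \<Longrightarrow> inj_on (pre d) (Range (sat_rel d))"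
  by (rule inj_onI) (metis pre_rel sat_rel_functional(1))

lemma card_pre: "d \<in> ubp_set k \<Longrightarrow> C \<in> Range (sat_rel d) \<Longrightarrow> card (pre d C) = card C"
  by (rule sat_rel_card[OF _ pre_rel])

lemma sat_rel_full: "d \<in> ubp_set k \<Longrightarrow> ({1..k}, {1..k}) \<in> sat_rel d"
  unfolding sat_rel_def by (simp only: mem_Collect_eq case_prod_conv sat_UNIV[OF ubp_partition])

text \<open>The relation is closed under unions and intersections and is injective, so
  \<open>pre d\<close> carries these operations over from its arguments. The values are nonempty
  because sizes are preserved.\<close>

lemma pre_image_partition:
  assumes d: "d \<in> ubp_set k" and Q: "partition_on {1..k} Q" "Q \<subseteq> Range (sat_rel d)"
  shows "partition_on {1..k} (pre d ` Q)"
proof -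
  have fin: "finite Q" by (rule finite_elements[OF _ Q(1)]) simp
  have U: "(\<Union>(pre d ` Q'), \<Union>Q') \<in> sat_rel d" if "finite Q'" "Q' \<subseteq> Q" for Q'
    using that
  proof (induction Q')
    case empty
    show ?case by (simp add: sat_rel_def sat_def)
  next
    case (insert B Q')
    have "(pre d B, B) \<in> sat_rel d" using insert.prems Q(2) by (intro pre_rel[OF d]) auto
    from sat_rel_Un[OF this insert.IH] insert.prems show ?case by simp
  qed
  have "\<Union>Q = {1..k}" using Q(1) by (simp add: partition_on_def)
  then have "(\<Union>(pre d ` Q), {1..k}) \<in> sat_rel d" using U[OF fin subset_refl] by simp
  then have "\<Union>(pre d ` Q) = {1..k}" by (rule sat_rel_functional(2)[OF d _ sat_rel_full[OF d]])
  moreover have "pre d B \<inter> pre d B' = {}" if B: "B \<in> Q" "B' \<in> Q" "B \<noteq> B'" for B B'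
  proof -
    have rel: "(pre d B, B) \<in> sat_rel d" "(pre d B', B') \<in> sat_rel d"
      using B Q(2) by (auto intro!: pre_rel[OF d])
    have "B \<inter> B' = {}" using disjointD[of Q B B'] Q(1) B by (simp add: partition_on_def)
    then have "(pre d B \<inter> pre d B', {}) \<in> sat_rel d" using sat_rel_Int[OF rel] by simp
    moreover have "({}, {}) \<in> sat_rel d" by (simp add: sat_rel_def sat_def)
    ultimately show ?thesis by (rule sat_rel_functional(2)[OF d])
  qed
  then have "disjoint (pre d ` Q)"
    unfolding disjoint_def by (metis imageE)
  moreover have "pre d B \<noteq> {}" if "B \<in> Q" for B
  proof -
    have "B \<noteq> {}" "finite B" using Q(1) that finite_subset[of B "{1..k}"] by (auto simp: partition_on_def)
    then have "card B \<noteq> 0" by simp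
    moreover have "card (pre d B) = card B" using that Q(2) by (intro card_pre[OF d]) auto
    ultimately show ?thesis by auto
  qed
  ultimately show ?thesis unfolding partition_on_def by (metis imageE)
qed


lemma partition_block:
  fixes k :: nat
  assumes "partition_on {1..k} P" "A \<in> P"
  shows "finite A" "A \<subseteq> {1..k}" "A \<noteq> {}" "Max A \<in> A" "Max A \<le> k" "card A \<in> {1..k}"
proof -
  show sub: "A \<subseteq> {1..k}" and ne: "A \<noteq> {}" using assms by (auto simp: partition_on_def)
  show fin: "finite A" using sub by (rule finite_subset) simp
  show "Max A \<in> A" by (rule Max_in[OF fin ne])
  then show "Max A \<le> k" using sub by auto
  have "card A \<le> k" using card_mono[OF _ sub] by simp
  moreover have "card A \<noteq> 0" using fin ne by simp
  ultimately show "card A \<in> {1..k}" by simp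
qed

lemma Max_inj_on_partition:
  fixes k :: nat
  assumes "partition_on {1..k} P"
  shows "inj_on Max P"
proof (rule inj_onI)
  fix A B assume AB: "A \<in> P" "B \<in> P" "Max A = Max B"
  then have "Max A \<in> A \<inter> B"
    using partition_block(4)[OF assms AB(1)] partition_block(4)[OF assms AB(2)] by simp
  then show "A = B" using assms AB by (metis disjointD empty_iff partition_on_def)
qed


section \<open>Fillings by the blocks of a set partition\<close>

definition entries :: "nat \<Rightarrow> shapes \<Rightarrow> tableaux \<Rightarrow> nat set set" where
  "entries k lam F = (\<Union>i\<in>{1..k}. F i ` cells (lam i))"

text \<open>Uniform tableaux without their order conditions. Pulling back along a diagram, when all
  entries are saturated, stays in this class, and straightening leads from it back to uniform
  tableaux.\<close>

definition block_filling :: "nat \<Rightarrow> shapes \<Rightarrow> tableaux \<Rightarrow> bool" where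
  "block_filling k lam F \<longleftrightarrow> (\<forall>i\<in>{1..k}. \<forall>x\<in>cells (lam i). card (F i x) = i) \<and>
     partition_on {1..k} (entries k lam F)"

lemma card_cells: "int_partition \<mu> \<Longrightarrow> card (cells \<mu>) = sum_list \<mu>"
proof -
  have "cells \<mu> = (SIGMA r:{..<length \<mu>}. {..<\<mu> ! r})" by (auto simp: cells_def)
  then show ?thesis by (simp add: sum_list_sum_nth atLeast0LessThan)
qed

locale shape =
  fixes k :: nat and lam :: shapes
  assumes lam: "lam \<in> index_set k"
begin

lemma int_part: "i \<in> {1..k} \<Longrightarrow> int_partition (lam i)"
  using lam by (auto simp: index_set_def)

lemma sum_cells: "(\<Sum>i = 1..k. i * card (cells (lam i))) = k"
  using lam by (simp add: index_set_def card_cells int_part)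

text \<open>Injectivity is a matter of counting: the entries of size \<open>i\<close> have to cover \<open>i\<close> times the number of
  cells of \<open>lam i\<close> points.\<close>

lemma block_filling_inj:
  assumes F: "block_filling k lam F" and i: "i \<in> {1..k}"
  shows "inj_on (F i) (cells (lam i))"
proof -
  have part: "partition_on {1..k} (entries k lam F)" using F by (simp add: block_filling_def)
  have card: "card (F i x) = i" if "i \<in> {1..k}" "x \<in> cells (lam i)" for i x
    using F that by (simp add: block_filling_def)
  have fin: "finite (entries k lam F)" by (rule finite_elements[OF _ part]) simp
  have "k = card (\<Union>(entries k lam F))" using part by (simp add: partition_on_def)
  also have "\<dots> = (\<Sum>B\<in>entries k lam F. card B)"
  proof (rule card_Union_disjoint)
    show "pairwise disjnt (entries k lam F)"
      using part by (auto simp: partition_on_def pairwise_def disjnt_def disjoint_def)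
    show "finite B" if "B \<in> entries k lam F" for B
      using part that finite_subset[of B "{1..k}"] by (auto simp: partition_on_def)
  qed
  also have "\<dots> = (\<Sum>i\<in>{1..k}. \<Sum>B\<in>F i ` cells (lam i). card B)"
    unfolding entries_def
  proof (rule sum.UNION_disjoint)
    show "\<forall>i\<in>{1..k}. finite (F i ` cells (lam i))" by simp
    show "\<forall>i\<in>{1..k}. \<forall>j\<in>{1..k}. i \<noteq> j \<longrightarrow> F i ` cells (lam i) \<inter> F j ` cells (lam j) = {}"
    proof (intro ballI impI equals0I)
      fix i j B assume ij: "i \<in> {1..k}" "j \<in> {1..k}" "i \<noteq> j"
        and B: "B \<in> F i ` cells (lam i) \<inter> F j ` cells (lam j)"
      have "card B = i" using card[OF ij(1)] B by auto
      moreover have "card B = j" using card[OF ij(2)] B by auto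
      ultimately show False using ij by simp
    qed
  qed simp
  also have "\<dots> = (\<Sum>i\<in>{1..k}. i * card (F i ` cells (lam i)))"
  proof (rule sum.cong[OF refl])
    fix i assume i: "i \<in> {1..k}"
    have "(\<Sum>B\<in>F i ` cells (lam i). card B) = (\<Sum>B\<in>F i ` cells (lam i). i)"
      by (rule sum.cong[OF refl]) (use card[OF i] in blast)
    then show "(\<Sum>B\<in>F i ` cells (lam i). card B) = i * card (F i ` cells (lam i))" by simp
  qed
  finally have sum: "(\<Sum>i\<in>{1..k}. i * card (F i ` cells (lam i))) = (\<Sum>i\<in>{1..k}. i * card (cells (lam i)))"
    using sum_cells by simp
  \<comment> \<open>Termwise inequalities with equal sums are equalities; the factor
    \<open>i\<close> is positive and cancels.\<close>
  have "i * card (F i ` cells (lam i)) = i * card (cells (lam i))"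
    by (rule sum_mono_inv[OF sum _ i]) (simp_all add: card_image_le)
  then have "card (F i ` cells (lam i)) = card (cells (lam i))" using i by simp
  then show ?thesis by (rule eq_card_imp_inj_on[OF finite_cells])
qed

lemma block_filling_tuple:
  assumes F: "block_filling k lam F"
  shows "tuple_filling last_less Max k lam (\<lambda>i. F i ` cells (lam i)) F"
  unfolding tuple_filling_def ranked_def last_less_def
proof (intro ballI conjI refl)
  fix i assume i: "i \<in> {1..k}"
  show "int_partition (lam i)" by (rule int_part[OF i])
  show "inj_on (F i) (cells (lam i))" by (rule block_filling_inj[OF F i])
  have "inj_on Max (entries k lam F)"
    using F by (intro Max_inj_on_partition[of k]) (simp add: block_filling_def)
  then show "inj_on Max (F i ` cells (lam i))"
    by (rule inj_on_subset) (use i in \<open>auto simp: entries_def\<close>)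
qed

lemma uniform_iff:
  "S \<in> uniform_tableaux k lam \<longleftrightarrow>
    block_filling k lam S \<and> S \<in> std_tuples last_less k lam (\<lambda>i. S i ` cells (lam i))"
proof
  assume S: "S \<in> uniform_tableaux k lam"
  then have Si: "S i \<in> cells (lam i) \<rightarrow>\<^sub>E {A. A \<subseteq> {1..k} \<and> card A = i}"
    "increasing last_less (lam i) (S i)" if "i \<in> {1..k}" for i
    using that PiE_mem[of S "{1..k}"] unfolding uniform_tableaux_def by blast+
  have F: "block_filling k lam S"
    unfolding block_filling_def
  proof (intro conjI ballI)
    show "card (S i x) = i" if "i \<in> {1..k}" "x \<in> cells (lam i)" for i x
      using PiE_mem[OF Si(1)[OF that(1)] that(2)] by simp
    show "partition_on {1..k} (entries k lam S)"
      using S by (simp add: uniform_tableaux_def entries_def)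
  qed
  have "S i \<in> std_tableaux last_less (lam i) (S i ` cells (lam i))" if i: "i \<in> {1..k}" for i
    using Si[OF i] block_filling_inj[OF F i] by (auto simp: std_tableaux_def bij_betw_def PiE_def)
  moreover have "S \<in> extensional {1..k}" using S by (auto simp: uniform_tableaux_def PiE_def)
  ultimately show "block_filling k lam S \<and> S \<in> std_tuples last_less k lam (\<lambda>i. S i ` cells (lam i))"
    using F by (auto simp: PiE_def)
next
  assume S: "block_filling k lam S \<and> S \<in> std_tuples last_less k lam (\<lambda>i. S i ` cells (lam i))"
  then have part: "partition_on {1..k} (entries k lam S)"
    and card: "\<And>i x. i \<in> {1..k} \<Longrightarrow> x \<in> cells (lam i) \<Longrightarrow> card (S i x) = i"
    by (auto simp: block_filling_def)
  have std: "S i \<in> std_tableaux last_less (lam i) (S i ` cells (lam i))" if "i \<in> {1..k}" for i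
    using S that by auto
  have "S i x \<subseteq> {1..k}" if "i \<in> {1..k}" "x \<in> cells (lam i)" for i x
    using part that unfolding partition_on_def entries_def by blast
  then have "S i \<in> cells (lam i) \<rightarrow>\<^sub>E {A. A \<subseteq> {1..k} \<and> card A = i}" if "i \<in> {1..k}" for i
    using std_tableauxD(4)[OF std[OF that]] card[OF that] that by (intro PiE_I) (auto simp: extensional_def)
  moreover have "increasing last_less (lam i) (S i)" if "i \<in> {1..k}" for i
    by (rule std_tableauxD(3)[OF std[OF that]])
  ultimately show "S \<in> uniform_tableaux k lam"
    using S part unfolding uniform_tableaux_def entries_def by (auto simp: PiE_def)
qed

lemma finite_entries: "finite (entries k lam F)"
  by (simp add: entries_def)

lemma entries_cong: "(\<And>i. i \<in> {1..k} \<Longrightarrow> S i ` cells (lam i) = F i ` cells (lam i)) \<Longrightarrow>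
    entries k lam S = entries k lam F"
  by (simp add: entries_def)

lemma entries_map: "entries k lam (\<lambda>i x. f (F i x)) = f ` entries k lam F"
  by (auto simp: entries_def)

text \<open>Straightening keeps the set of entries of every component. All terms of an expansion
  therefore have the same underlying set partition as the original filling.\<close>

lemma supp_straighten_block_filling:
  assumes F: "block_filling k lam F"
    and S: "S \<in> supp (straighten_tuple last_less k lam F)"
  shows "S \<in> uniform_tableaux k lam" "entries k lam S = entries k lam F"
    "\<And>i. i \<in> {1..k} \<Longrightarrow> S i ` cells (lam i) = F i ` cells (lam i)"
proof -
  have S': "S \<in> std_tuples last_less k lam (\<lambda>i. F i ` cells (lam i))"
    using supp_straighten_tuple[OF block_filling_tuple[OF F]] S by blast
  show im: "S i ` cells (lam i) = F i ` cells (lam i)" if "i \<in> {1..k}" for i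
    by (rule std_tableauxD(2)[OF PiE_mem[OF S' that]])
  then show ent: "entries k lam S = entries k lam F" by (rule entries_cong)
  have "card (S i x) = i" if i: "i \<in> {1..k}" and x: "x \<in> cells (lam i)" for i x
  proof -
    have "S i x \<in> F i ` cells (lam i)" using im[OF i] x by blast
    then show ?thesis using F i by (auto simp: block_filling_def)
  qed
  then have "block_filling k lam S"
    using F ent by (simp add: block_filling_def)
  moreover have "S \<in> std_tuples last_less k lam (\<lambda>i. S i ` cells (lam i))"
  proof -
    have "std_tuples last_less k lam (\<lambda>i. F i ` cells (lam i)) =
        std_tuples last_less k lam (\<lambda>i. S i ` cells (lam i))"
      by (rule PiE_cong) (simp only: im)
    then show ?thesis using S' by simp
  qed
  ultimately show "S \<in> uniform_tableaux k lam" by (simp add: uniform_iff)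
qed

lemma straighten_uniform:
  assumes "S \<in> uniform_tableaux k lam"
  shows "straighten_tuple last_less k lam S = bvec S"
  using assms straighten_tuple_std[OF block_filling_tuple] by (simp add: uniform_iff)

lemma block_filling_pre:
  assumes d: "d \<in> ubp_set k" and F: "block_filling k lam F" "entries k lam F \<subseteq> Range (sat_rel d)"
  shows "block_filling k lam (\<lambda>i x. pre d (F i x))"
  unfolding block_filling_def entries_map
proof (intro conjI ballI)
  show "partition_on {1..k} (pre d ` entries k lam F)"
    using F by (intro pre_image_partition[OF d]) (auto simp: block_filling_def)
  fix i x assume ix: "i \<in> {1..k}" "x \<in> cells (lam i)"
  then have "F i x \<in> Range (sat_rel d)" using F(2) unfolding entries_def by blast
  then have "card (pre d (F i x)) = card (F i x)" by (rule card_pre[OF d])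
  then show "card (pre d (F i x)) = i" using F(1) ix by (simp add: block_filling_def)
qed

lemma straighten_block_filling_comp:
  assumes F: "block_filling k lam F" and f: "inj_on f (entries k lam F)"
    and fF: "block_filling k lam (\<lambda>i x. f (F i x))"
  shows "straighten_tuple last_less k lam (\<lambda>i x. f (F i x)) =
    lin_ext (\<lambda>S. straighten_tuple last_less k lam (\<lambda>i x. f (S i x))) (straighten_tuple last_less k lam F)"
proof (rule straighten_tuple_comp[OF block_filling_tuple[OF F]])
  fix i assume i: "i \<in> {1..k}"
  show "inj_on f (F i ` cells (lam i))"
    using f by (rule inj_on_subset) (use i in \<open>auto simp: entries_def\<close>)
  have "ranked last_less ((\<lambda>x. f (F i x)) ` cells (lam i)) Max"
    using block_filling_tuple[OF fF] i by (simp add: tuple_filling_def)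
  then show "ranked last_less (f ` F i ` cells (lam i)) Max" by (simp add: image_image)
qed


section \<open>The action on uniform tableaux\<close>

text \<open>Defined on arbitrary fillings and not only on uniform tableaux, so that it can be
  compared before and after straightening its argument.\<close>

definition ct_basis :: "diagram \<Rightarrow> tableaux \<Rightarrow> (tableaux \<Rightarrow>\<^sub>0 complex)" where
  "ct_basis d F = (if entries k lam F \<subseteq> Range (sat_rel d)
     then straighten_tuple last_less k lam (\<lambda>i x. pre d (F i x)) else 0)"

lemma supp_ct_basis:
  assumes "d \<in> ubp_set k" "block_filling k lam F"
  shows "supp (ct_basis d F) \<subseteq> uniform_tableaux k lam"
  using supp_straighten_block_filling(1)[OF block_filling_pre[OF assms]] by (auto simp: ct_basis_def)

text \<open>The vanishing test looks only at the set of entries, which all terms of the expansion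
  share. If the test is passed, \<open>pre d\<close> is an injective relabelling and commutes with
  straightening.\<close>

lemma ct_basis_straighten:
  assumes d: "d \<in> ubp_set k" and F: "block_filling k lam F"
  shows "lin_ext (ct_basis d) (straighten_tuple last_less k lam F) = ct_basis d F"
proof (cases "entries k lam F \<subseteq> Range (sat_rel d)")
  case True
  have "lin_ext (ct_basis d) (straighten_tuple last_less k lam F) =
      lin_ext (\<lambda>S. straighten_tuple last_less k lam (\<lambda>i x. pre d (S i x))) (straighten_tuple last_less k lam F)"
    using supp_straighten_block_filling(2)[OF F] True by (intro lin_ext_cong) (simp add: ct_basis_def)
  also have "\<dots> = straighten_tuple last_less k lam (\<lambda>i x. pre d (F i x))"
    by (rule straighten_block_filling_comp[symmetric, OF F _ block_filling_pre[OF d F True]])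
      (rule inj_on_subset[OF inj_on_pre[OF d] True])
  finally show ?thesis using True by (simp add: ct_basis_def)
next
  case False
  have "lin_ext (ct_basis d) (straighten_tuple last_less k lam F) =
      lin_ext (\<lambda>_. 0) (straighten_tuple last_less k lam F)"
    using supp_straighten_block_filling(2)[OF F] False by (intro lin_ext_cong) (simp add: ct_basis_def)
  also have "\<dots> = 0" by (simp add: lin_ext_def)
  finally show ?thesis using False by (simp add: ct_basis_def)
qed

text \<open>By the previous lemma the inner straightening may be dropped. What remains is that the
  preimages and the vanishing conditions of \<open>d\<close> and \<open>d'\<close> compose to those
  of the product.\<close>

lemma ct_basis_mult:
  assumes d: "d \<in> ubp_set k" and d': "d' \<in> ubp_set k" and F: "block_filling k lam F"
  shows "ct_basis (ubp_mult d d') F = lin_ext (ct_basis d) (ct_basis d' F)"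
proof (cases "entries k lam F \<subseteq> Range (sat_rel d')")
  case True
  have "lin_ext (ct_basis d) (ct_basis d' F) = ct_basis d (\<lambda>i x. pre d' (F i x))"
    using ct_basis_straighten[OF d block_filling_pre[OF d' F True]] True by (simp add: ct_basis_def[of d'])
  also have "\<dots> = ct_basis (ubp_mult d d') F"
  proof -
    have "entries k lam (\<lambda>i x. pre d' (F i x)) \<subseteq> Range (sat_rel d) \<longleftrightarrow>
        entries k lam F \<subseteq> Range (sat_rel (ubp_mult d d'))"
      unfolding entries_map image_subset_iff subset_iff[of "entries k lam F"] Range_mult[OF d d']
      using subsetD[OF True] by blast
    moreover have "straighten_tuple last_less k lam (\<lambda>i x. pre d (pre d' (F i x))) =
        straighten_tuple last_less k lam (\<lambda>i x. pre (ubp_mult d d') (F i x))"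
      if sub: "entries k lam F \<subseteq> Range (sat_rel (ubp_mult d d'))"
    proof (rule straighten_tuple_cong)
      fix i x assume "i \<in> {1..k}" "x \<in> cells (lam i)"
      then have "F i x \<in> entries k lam F" unfolding entries_def by blast
      then have "F i x \<in> Range (sat_rel (ubp_mult d d'))" using sub by blast
      then show "pre d (pre d' (F i x)) = pre (ubp_mult d d') (F i x)"
        using pre_mult[OF d d'] Range_mult[OF d d'] by metis
    qed
    ultimately show ?thesis by (simp add: ct_basis_def)
  qed
  finally show ?thesis by simp
next
  case False
  then have "\<not> entries k lam F \<subseteq> Range (sat_rel (ubp_mult d d'))"
    using Range_mult[OF d d'] by blast
  then show ?thesis using False by (simp add: ct_basis_def)
qed

lemma ct_basis_one:
  assumes S: "S \<in> uniform_tableaux k lam"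
  shows "ct_basis (perm_diag k id) S = bvec S"
proof -
  have F: "block_filling k lam S" using S by (simp add: uniform_iff)
  have sub: "B \<subseteq> {1..k}" if "B \<in> entries k lam S" for B
    using F that by (auto simp: block_filling_def partition_on_def)
  have pre: "pre (perm_diag k id) B = B" if "B \<in> entries k lam S" for B
    using sub[OF that] by (intro pre_eq[OF one_ubp]) (simp add: sat_rel_one)
  have "entries k lam S \<subseteq> Range (sat_rel (perm_diag k id))"
    using sub by (auto simp: sat_rel_one)
  moreover have "straighten_tuple last_less k lam (\<lambda>i x. pre (perm_diag k id) (S i x)) =
      straighten_tuple last_less k lam S"
  proof (rule straighten_tuple_cong)
    fix i x assume "i \<in> {1..k}" "x \<in> cells (lam i)"
    then have "S i x \<in> entries k lam S" unfolding entries_def by blast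
    then show "pre (perm_diag k id) (S i x) = S i x" by (rule pre)
  qed
  ultimately show ?thesis using straighten_uniform[OF S] by (simp add: ct_basis_def)
qed

text \<open>The entries cover \<open>i\<close>, so they are all saturated exactly when the entry
  containing \<open>i\<close> also contains \<open>i + 1\<close>. Saturated sets are their own
  preimages, which leaves a tableau that is already standard.\<close>

lemma ct_basis_b_gen:
  assumes S: "S \<in> uniform_tableaux k lam" and i: "i \<in> {1..<k}"
  shows "ct_basis (b_gen k i) S = (if same_cell k lam S i (i + 1) then bvec S else 0)"
proof -
  have F: "block_filling k lam S" using S by (simp add: uniform_iff)
  have part: "partition_on {1..k} (entries k lam S)" using F by (simp add: block_filling_def)
  have sub: "B \<subseteq> {1..k}" if "B \<in> entries k lam S" for B
    using part that by (auto simp: partition_on_def)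
  have Range: "B \<in> Range (sat_rel (b_gen k i)) \<longleftrightarrow> B \<subseteq> {1..k} \<and> (i \<in> B \<longleftrightarrow> i + 1 \<in> B)" for B
    unfolding sat_rel_b_gen[OF i] by blast
  have same: "same_cell k lam S i (i + 1) \<longleftrightarrow> (\<exists>B\<in>entries k lam S. i \<in> B \<and> i + 1 \<in> B)"
    unfolding same_cell_def entries_def by blast
  have iff: "entries k lam S \<subseteq> Range (sat_rel (b_gen k i)) \<longleftrightarrow> same_cell k lam S i (i + 1)"
  proof
    assume sub': "entries k lam S \<subseteq> Range (sat_rel (b_gen k i))"
    have "i \<in> \<Union>(entries k lam S)" using part i by (auto simp: partition_on_def)
    then obtain B where "B \<in> entries k lam S" "i \<in> B" by blast
    then show "same_cell k lam S i (i + 1)" unfolding same using sub' Range by blast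
  next
    assume "same_cell k lam S i (i + 1)"
    then obtain B where B: "B \<in> entries k lam S" "i \<in> B" "i + 1 \<in> B" unfolding same by blast
    show "entries k lam S \<subseteq> Range (sat_rel (b_gen k i))"
    proof
      fix C assume C: "C \<in> entries k lam S"
      have "C = B \<or> C \<inter> B = {}" using part C B(1) by (metis disjointD partition_on_def)
      then show "C \<in> Range (sat_rel (b_gen k i))"
        unfolding Range using sub[OF C] B by blast
    qed
  qed
  have "straighten_tuple last_less k lam (\<lambda>j x. pre (b_gen k i) (S j x)) =
      straighten_tuple last_less k lam S" if "entries k lam S \<subseteq> Range (sat_rel (b_gen k i))"
  proof (rule straighten_tuple_cong)
    fix j x assume "j \<in> {1..k}" "x \<in> cells (lam j)"
    then have "S j x \<in> entries k lam S" unfolding entries_def by blast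
    then have "(S j x, S j x) \<in> sat_rel (b_gen k i)"
      using that Range unfolding sat_rel_b_gen[OF i] by blast
    then show "pre (b_gen k i) (S j x) = S j x" by (rule pre_eq[OF b_gen_ubp[OF i]])
  qed
  then show ?thesis using iff straighten_uniform[OF S] by (simp add: ct_basis_def)
qed

text \<open>A transposition is an involution, so preimages under its diagram are images under the
  transposition.\<close>

lemma ct_basis_s_gen:
  assumes S: "S \<in> uniform_tableaux k lam" and i: "i \<in> {1..<k}"
  shows "ct_basis (s_gen k i) S = straighten_tuple last_less k lam
    (\<lambda>j x. Transposition.transpose i (i + 1) ` S j x)"
proof -
  let ?t = "Transposition.transpose i (i + 1)"
  have F: "block_filling k lam S" using S by (simp add: uniform_iff)
  have rel: "(?t ` B, B) \<in> sat_rel (s_gen k i)" if "B \<in> entries k lam S" for B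
  proof -
    have "B \<subseteq> {1..k}" using F that by (auto simp: block_filling_def partition_on_def)
    then have "?t ` B \<subseteq> {1..k}" using permutes_image[OF transpose_permutes[OF i]] by blast
    moreover have "?t ` ?t ` B = B" by (simp add: image_comp)
    ultimately show ?thesis unfolding sat_rel_s_gen[OF i] by blast
  qed
  have "entries k lam S \<subseteq> Range (sat_rel (s_gen k i))" using rel by blast
  moreover have "straighten_tuple last_less k lam (\<lambda>j x. pre (s_gen k i) (S j x)) =
      straighten_tuple last_less k lam (\<lambda>j x. ?t ` S j x)"
  proof (rule straighten_tuple_cong)
    fix j x assume "j \<in> {1..k}" "x \<in> cells (lam j)"
    then have "S j x \<in> entries k lam S" unfolding entries_def by blast
    then show "pre (s_gen k i) (S j x) = ?t ` S j x" by (intro pre_eq[OF s_gen_ubp[OF i]] rel)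
  qed
  ultimately show ?thesis by (simp add: ct_basis_def)
qed

end


section \<open>Free modules\<close>

lemma free_mod_simps [simp]:
  "carrier (free_mod B) = {p. supp p \<subseteq> B}" "\<zero>\<^bsub>free_mod B\<^esub> = 0"
  "p \<oplus>\<^bsub>free_mod B\<^esub> q = p + q" "c \<odot>\<^bsub>free_mod B\<^esub> p = scale c p"
  by (simp_all add: free_mod_def)

lemma CC_simps [simp]:
  "carrier CC = UNIV" "\<zero>\<^bsub>CC\<^esub> = 0" "\<one>\<^bsub>CC\<^esub> = 1" "c \<oplus>\<^bsub>CC\<^esub> d = c + d" "c \<otimes>\<^bsub>CC\<^esub> d = c * d"
  by (simp_all add: ring_of_type_algebra_def)

lemma supp_add: "supp p \<subseteq> B \<Longrightarrow> supp q \<subseteq> B \<Longrightarrow> supp (p + q) \<subseteq> B"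
  using keys_add[of p q] by blast

lemma supp_scale_subset: "supp p \<subseteq> B \<Longrightarrow> supp (scale c p) \<subseteq> B"
  using supp_scale[of c p] by blast

lemma cring_CC: "cring CC"
  by (rule cring_from_type_algebra)

lemma module_free_mod: "module CC (free_mod B)"
proof (rule moduleI[OF cring_CC])
  show "abelian_group (free_mod B)"
  proof (rule abelian_groupI)
    fix p assume "p \<in> carrier (free_mod B)"
    then show "\<exists>q\<in>carrier (free_mod B). q \<oplus>\<^bsub>free_mod B\<^esub> p = \<zero>\<^bsub>free_mod B\<^esub>"
      by (intro bexI[of _ "- p"]) simp_all
  qed (simp_all add: supp_add add_ac)
qed (simp_all add: supp_scale_subset scale_add scale_add_left scale_scale)

lemma linear_map_lin_ext:
  "(\<And>b. b \<in> B \<Longrightarrow> supp (f b) \<subseteq> B') \<Longrightarrow> linear_map (free_mod B) (free_mod B') (lin_ext f)"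
  unfolding linear_map_def
proof (intro conjI ballI allI Pi_I)
  fix x assume f: "\<And>b. b \<in> B \<Longrightarrow> supp (f b) \<subseteq> B'" and x: "x \<in> carrier (free_mod B)"
  have "supp (lin_ext f x) \<subseteq> B'" by (rule supp_lin_ext) (use f x in auto)
  then show "lin_ext f x \<in> carrier (free_mod B')" by simp
qed (simp_all add: lin_ext_add lin_ext_scale)

lemma linear_map_restrict:
  assumes V: "module CC V" and f: "linear_map V W f"
  shows "linear_map V W (restrict f (carrier V))"
proof -
  interpret module CC V by (rule V)
  have "c \<odot>\<^bsub>V\<^esub> x \<in> carrier V" if "x \<in> carrier V" for c x using smult_closed[of c x] that by simp
  then show ?thesis using f unfolding linear_map_def by (auto simp: Pi_def)
qed

lemma linear_map_eq_lin_ext: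
  assumes f: "linear_map (free_mod B) (free_mod B') f" and p: "supp p \<subseteq> B"
  shows "f p = lin_ext (\<lambda>b. f (bvec b)) p"
proof -
  have add: "f (x + y) = f x + f y" if "supp x \<subseteq> B" "supp y \<subseteq> B" for x y
    using f that by (simp add: linear_map_def)
  have sc: "f (scale c x) = scale c (f x)" if "supp x \<subseteq> B" for c x
    using f that by (simp add: linear_map_def)
  have f0: "f 0 = 0" using sc[of 0 0] by simp
  have "f (\<Sum>b\<in>A. scale (coef p b) (bvec b)) = (\<Sum>b\<in>A. scale (coef p b) (f (bvec b)))"
    if "finite A" "A \<subseteq> B" for A
    using that
  proof (induction A)
    case (insert a A)
    have "supp (\<Sum>b\<in>A. scale (coef p b) (bvec b)) \<subseteq> B"
      using insert.prems by (intro supp_sum_subset supp_scale_subset) auto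
    moreover have "supp (bvec a) \<subseteq> B" "supp (scale (coef p a) (bvec a)) \<subseteq> B"
      using insert.prems by (simp, intro supp_scale_subset) simp
    ultimately show ?case
      using insert add[of "scale (coef p a) (bvec a)"] sc[of "bvec a" "coef p a"] by (simp del: map_single)
  qed (simp add: f0)
  from this[OF finite_keys p] show ?thesis unfolding sum_single_supp lin_ext_def .
qed

lemma linear_map_eqI:
  assumes "linear_map (free_mod B) (free_mod B') f" "linear_map (free_mod B) (free_mod B') g"
    and "\<And>b. b \<in> B \<Longrightarrow> f (bvec b) = g (bvec b)" and p: "p \<in> carrier (free_mod B)"
  shows "f p = g p"
proof -
  have "supp p \<subseteq> B" using p by simp
  then show ?thesis
    unfolding linear_map_eq_lin_ext[OF assms(1) \<open>supp p \<subseteq> B\<close>] linear_map_eq_lin_ext[OF assms(2) \<open>supp p \<subseteq> B\<close>]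
    using assms(3) by (intro lin_ext_cong) blast
qed

lemma representationD:
  assumes "representation M V act"
  shows "d \<in> carrier M \<Longrightarrow> linear_map V V (act d)"
    "d \<in> carrier M \<Longrightarrow> d' \<in> carrier M \<Longrightarrow> v \<in> carrier V \<Longrightarrow> act (d \<otimes>\<^bsub>M\<^esub> d') v = act d (act d' v)"
    "v \<in> carrier V \<Longrightarrow> act \<one>\<^bsub>M\<^esub> v = v"
  using assms by (simp_all add: representation_def)

section \<open>The representation on uniform tableaux and its uniqueness\<close>

context shape
begin

abbreviation "CT \<equiv> CT_mod k lam"

lemma CT_carrier: "carrier CT = {p. supp p \<subseteq> uniform_tableaux k lam}"
  by (simp add: CT_mod_def)

text \<open>Restricted in both arguments because the description of \<open>CT_act\<close> prescribes
  \<open>undefined\<close> outside the carriers.\<close>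

definition ct :: "diagram \<Rightarrow> (tableaux \<Rightarrow>\<^sub>0 complex) \<Rightarrow> (tableaux \<Rightarrow>\<^sub>0 complex)" where
  "ct = (\<lambda>d\<in>carrier (ubp k). restrict (lin_ext (ct_basis d)) (carrier CT))"

lemma linear_ct: "d \<in> carrier (ubp k) \<Longrightarrow> linear_map CT CT (ct d)"
proof -
  assume d: "d \<in> carrier (ubp k)"
  then have "linear_map CT CT (lin_ext (ct_basis d))"
    unfolding CT_mod_def by (intro linear_map_lin_ext supp_ct_basis) (auto simp: ubp_def uniform_iff)
  then have "linear_map CT CT (restrict (lin_ext (ct_basis d)) (carrier CT))"
    by (rule linear_map_restrict[rotated]) (simp add: CT_mod_def module_free_mod)
  then show ?thesis unfolding ct_def restrict_apply'[OF d] .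
qed

lemma ct_closed: "d \<in> carrier (ubp k) \<Longrightarrow> v \<in> carrier CT \<Longrightarrow> ct d v \<in> carrier CT"
  using linear_ct unfolding linear_map_def by blast

lemma representation_ct: "representation (ubp k) CT ct"
  unfolding representation_def
proof (intro conjI ballI)
  show "monoid (ubp k)" by (rule monoid_ubp)
  show "module CC CT" unfolding CT_mod_def by (rule module_free_mod)
  show "linear_map CT CT (ct d)" if "d \<in> carrier (ubp k)" for d using that by (rule linear_ct)
  have F: "block_filling k lam S" if "v \<in> carrier CT" "S \<in> supp v" for v S
    using that by (auto simp: CT_carrier uniform_iff)
  show "ct (d \<otimes>\<^bsub>ubp k\<^esub> d') v = ct d (ct d' v)"
    if d: "d \<in> carrier (ubp k)" "d' \<in> carrier (ubp k)" and v: "v \<in> carrier CT" for d d' v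
  proof -
    have u: "d \<in> ubp_set k" "d' \<in> ubp_set k" using d by (auto simp: ubp_def)
    have "d \<otimes>\<^bsub>ubp k\<^esub> d' \<in> carrier (ubp k)" using u by (simp add: ubp_def ubp_mult_closed)
    then have "ct (d \<otimes>\<^bsub>ubp k\<^esub> d') v = lin_ext (ct_basis (ubp_mult d d')) v"
      using v by (simp add: ct_def ubp_def)
    also have "\<dots> = lin_ext (\<lambda>S. lin_ext (ct_basis d) (ct_basis d' S)) v"
      using F[OF v] by (intro lin_ext_cong ct_basis_mult[OF u])
    also have "\<dots> = lin_ext (ct_basis d) (ct d' v)"
      using d v by (simp add: ct_def lin_ext_lin_ext)
    also have "\<dots> = ct d (ct d' v)" using ct_closed[OF d(2) v] d by (simp add: ct_def)
    finally show ?thesis .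
  qed
  show "ct \<one>\<^bsub>ubp k\<^esub> v = v" if v: "v \<in> carrier CT" for v
  proof -
    have "ct \<one>\<^bsub>ubp k\<^esub> v = lin_ext (ct_basis (perm_diag k id)) v"
      using v one_ubp by (simp add: ct_def ubp_def)
    also have "\<dots> = lin_ext bvec v"
      using v by (intro lin_ext_cong ct_basis_one) (auto simp: CT_carrier)
    finally show ?thesis by simp
  qed
qed

definition ct_spec :: "(diagram \<Rightarrow> (tableaux \<Rightarrow>\<^sub>0 complex) \<Rightarrow> (tableaux \<Rightarrow>\<^sub>0 complex)) \<Rightarrow> bool" where
  "ct_spec act \<longleftrightarrow> act \<in> carrier (ubp k) \<rightarrow>\<^sub>E (carrier CT \<rightarrow>\<^sub>E carrier CT) \<and>
     representation (ubp k) CT act \<and>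
     (\<forall>S\<in>uniform_tableaux k lam. \<forall>i\<in>{1..<k}.
        act (b_gen k i) (bvec S) = (if same_cell k lam S i (i + 1) then bvec S else 0) \<and>
        act (s_gen k i) (bvec S) = straighten_tuple last_less k lam
          (\<lambda>j x. Transposition.transpose i (i + 1) ` S j x))"

lemma ct_spec_ct: "ct_spec ct"
  unfolding ct_spec_def
proof (intro conjI ballI)
  show "ct \<in> carrier (ubp k) \<rightarrow>\<^sub>E (carrier CT \<rightarrow>\<^sub>E carrier CT)"
    using ct_closed by (auto simp: ct_def)
  show "representation (ubp k) CT ct" by (rule representation_ct)
  fix S i assume S: "S \<in> uniform_tableaux k lam" and i: "i \<in> {1..<k}"
  have ct: "ct d (bvec S) = ct_basis d S" if "d \<in> ubp_set k" for d
    using that S by (simp add: ct_def ubp_def CT_carrier)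
  show "ct (b_gen k i) (bvec S) = (if same_cell k lam S i (i + 1) then bvec S else 0)"
    unfolding ct[OF b_gen_ubp[OF i]] by (rule ct_basis_b_gen[OF S i])
  show "ct (s_gen k i) (bvec S) = straighten_tuple last_less k lam
      (\<lambda>j x. Transposition.transpose i (i + 1) ` S j x)"
    unfolding ct[OF s_gen_ubp[OF i]] by (rule ct_basis_s_gen[OF S i])
qed

lemma ct_specD:
  assumes "ct_spec act"
  shows "act \<in> carrier (ubp k) \<rightarrow>\<^sub>E (carrier CT \<rightarrow>\<^sub>E carrier CT)" "representation (ubp k) CT act"
    "S \<in> uniform_tableaux k lam \<Longrightarrow> i \<in> {1..<k} \<Longrightarrow>
       act (b_gen k i) (bvec S) = (if same_cell k lam S i (i + 1) then bvec S else 0)"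
    "S \<in> uniform_tableaux k lam \<Longrightarrow> i \<in> {1..<k} \<Longrightarrow>
       act (s_gen k i) (bvec S) = straighten_tuple last_less k lam
         (\<lambda>j x. Transposition.transpose i (i + 1) ` S j x)"
  using assms unfolding ct_spec_def by simp_all

text \<open>Linearity reduces agreement at a generator to basis vectors. Agreement then passes to
  products, hence to all diagrams by \<open>ubp_gen_eq\<close>, and extensionality settles the
  arguments outside the carriers.\<close>

lemma ct_spec_unique:
  assumes act: "ct_spec act"
  shows "act = ct"
proof -
  note a = ct_specD[OF act] and c = ct_specD[OF ct_spec_ct]
  note ar = representationD[OF a(2)] and cr = representationD[OF c(2)]
  have basis: "\<forall>v\<in>carrier CT. act d v = ct d v"
    if "d \<in> carrier (ubp k)" "\<And>S. S \<in> uniform_tableaux k lam \<Longrightarrow> act d (bvec S) = ct d (bvec S)" for d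
  proof
    fix v assume "v \<in> carrier CT"
    then show "act d v = ct d v"
      using linear_map_eqI[OF ar(1)[OF that(1), unfolded CT_mod_def] cr(1)[OF that(1), unfolded CT_mod_def] that(2)]
      by (simp add: CT_mod_def)
  qed
  have agree: "\<forall>v\<in>carrier CT. act d v = ct d v" if "d \<in> ubp_gen k" for d
    using that
  proof induction
    case one
    have "perm_diag k id = \<one>\<^bsub>ubp k\<^esub>" by (simp add: ubp_def)
    then show ?case using ar(3) cr(3) by simp
  next
    case (s i)
    show ?case
    proof (rule basis)
      show "s_gen k i \<in> carrier (ubp k)" using s_gen_ubp[OF s] by (simp add: ubp_def)
      show "act (s_gen k i) (bvec S) = ct (s_gen k i) (bvec S)" if "S \<in> uniform_tableaux k lam" for S
        by (simp only: a(4)[OF that s] c(4)[OF that s])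
    qed
  next
    case (b i)
    show ?case
    proof (rule basis)
      show "b_gen k i \<in> carrier (ubp k)" using b_gen_ubp[OF b] by (simp add: ubp_def)
      show "act (b_gen k i) (bvec S) = ct (b_gen k i) (bvec S)" if "S \<in> uniform_tableaux k lam" for S
        by (simp only: a(3)[OF that b] c(3)[OF that b])
    qed
  next
    case (mult d d')
    then have d: "d \<in> carrier (ubp k)" "d' \<in> carrier (ubp k)"
      using ubp_gen_subset by (auto simp: ubp_def)
    have "act (d \<otimes>\<^bsub>ubp k\<^esub> d') v = ct (d \<otimes>\<^bsub>ubp k\<^esub> d') v" if v: "v \<in> carrier CT" for v
      using mult.IH v ct_closed[OF d(2) v] by (simp only: ar(2)[OF d v] cr(2)[OF d v])
    then show ?case by (simp add: ubp_def)
  qed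
  have "act \<in> extensional (carrier (ubp k))" "ct \<in> extensional (carrier (ubp k))"
    using a(1) c(1) by (simp_all add: PiE_def)
  then show ?thesis
  proof (rule extensionalityI)
    fix d assume d: "d \<in> carrier (ubp k)"
    have "act d \<in> extensional (carrier CT)" "ct d \<in> extensional (carrier CT)"
      using PiE_mem[OF a(1) d] PiE_mem[OF c(1) d] by (simp_all add: PiE_def)
    then show "act d = ct d"
      by (rule extensionalityI) (use agree d in \<open>simp add: ubp_gen_eq ubp_def\<close>)
  qed
qed

lemma CT_act_eq_ct: "CT_act k lam = ct"
  unfolding CT_act_def ct_spec_def[symmetric]
  by (rule the_equality) (rule ct_spec_ct, rule ct_spec_unique)

lemma representation_CT: "representation (ubp k) CT (CT_act k lam)"
  unfolding CT_act_eq_ct by (rule representation_ct)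

lemma CT_act_eq:
  "d \<in> ubp_set k \<Longrightarrow> v \<in> carrier CT \<Longrightarrow> CT_act k lam d v = lin_ext (ct_basis d) v"
  unfolding CT_act_eq_ct by (simp add: ct_def ubp_def)

end


section \<open>Blocks in graded last letter order\<close>

text \<open>A numerical key for the graded last letter order on subsets of \<open>{1..k}\<close>.\<close>

definition gll_key :: "nat \<Rightarrow> nat set \<Rightarrow> nat" where
  "gll_key k A = card A * (k + 1) + Max A"

lemma gll_less_iff_Max:
  fixes k :: nat
  assumes "partition_on {1..k} P" "A \<in> P" "B \<in> P" "card A = card B"
  shows "gll_less A B \<longleftrightarrow> Max A < Max B"
  using Max_inj_on_partition[OF assms(1)] assms(2-4)
  by (auto simp: gll_less_def gll_le_def le_less dest: inj_onD)

text \<open>Maxima of blocks are at most \<open>k\<close>, so the weight \<open>k + 1\<close> on the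
  size lets a difference in size outweigh any difference of maxima.\<close>

lemma gll_less_iff_key:
  fixes k :: nat
  assumes P: "partition_on {1..k} P" and AB: "A \<in> P" "B \<in> P"
  shows "gll_less A B \<longleftrightarrow> gll_key k A < gll_key k B"
proof -
  have less: "gll_key k C < gll_key k D" if "C \<in> P" "D \<in> P" "card C < card D" for C D
  proof -
    have "gll_key k C < (card C + 1) * (k + 1)"
      using partition_block(5)[OF P that(1)] by (simp add: gll_key_def)
    also have "\<dots> \<le> card D * (k + 1)" using that(3) by (intro mult_right_mono) simp_all
    finally show ?thesis by (simp add: gll_key_def)
  qed
  consider "card A < card B" | "card B < card A" | "card A = card B" by linarith
  then show ?thesis
  proof cases
    case 1
    then show ?thesis using less[OF AB] by (auto simp: gll_less_def gll_le_def)
  next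
    case 2
    then show ?thesis using less[OF AB(2,1)] by (auto simp: gll_less_def gll_le_def)
  next
    case 3
    then show ?thesis using gll_less_iff_Max[OF P AB 3] by (simp add: gll_key_def)
  qed
qed

lemma gll_key_inj:
  fixes k :: nat
  assumes P: "partition_on {1..k} P"
  shows "inj_on (gll_key k) P"
proof (rule inj_onI, rule ccontr)
  fix A B assume AB: "A \<in> P" "B \<in> P" "gll_key k A = gll_key k B" "A \<noteq> B"
  have "Max A \<noteq> Max B" using Max_inj_on_partition[OF P] AB by (auto dest: inj_onD)
  then have "gll_less A B \<or> gll_less B A" using AB(4) by (auto simp: gll_less_def gll_le_def)
  then show False using gll_less_iff_key[OF P] AB by auto
qed

text \<open>On a partition the order is that of an injective numerical key. A sorted enumeration is
  thus forced by the sorted list of keys, which makes the description in \<open>blocks\<close> well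
  defined.\<close>

lemma blocks_spec:
  fixes k :: nat
  assumes P: "partition_on {1..k} P"
  shows "set (blocks P) = P" "sorted_wrt gll_less (blocks P)"
proof -
  let ?K = "gll_key k"
  have fin: "finite P" by (rule finite_elements[OF _ P]) simp
  define xs where "xs = map (inv_into P ?K) (sorted_list_of_set (?K ` P))"
  have set: "set xs = P"
    using fin gll_key_inj[OF P] by (simp add: xs_def image_image)
  have key: "map ?K xs = sorted_list_of_set (?K ` P)"
    using fin by (auto simp: xs_def f_inv_into_f intro: map_idI)
  have sorted_iff: "sorted_wrt gll_less ys \<longleftrightarrow> sorted_wrt (<) (map ?K ys)" if "set ys = P" for ys
    using that gll_less_iff_key[OF P] unfolding sorted_wrt_map
    by (auto intro: sorted_wrt_mono_rel[rotated])
  have "blocks P = xs"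
    unfolding blocks_def
  proof (rule the_equality)
    have "sorted_wrt (<) (map ?K xs)" unfolding key by simp
    then show "set xs = P \<and> sorted_wrt gll_less xs" using set sorted_iff by blast
    fix ys assume ys: "set ys = P \<and> sorted_wrt gll_less ys"
    then have "sorted_wrt (<) (map ?K ys)" using sorted_iff by blast
    then have "map ?K ys = sorted_list_of_set (?K ` P)"
      using ys by (metis list.set_map sorted_list_of_set.idem_if_sorted_distinct strict_sorted_iff)
    then have "map ?K ys = map ?K xs" by (simp add: key)
    then show "ys = xs"
      by (rule map_inj_on) (use ys set gll_key_inj[OF P] in simp)
  qed
  then show "set (blocks P) = P" "sorted_wrt gll_less (blocks P)"
    using set sorted_iff[OF set] key by simp_all
qed

lemma blocks_distinct:
  fixes k :: nat
  assumes P: "partition_on {1..k} P"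
  shows "distinct (blocks P)"
proof -
  have "sorted_wrt (\<lambda>A B. gll_key k A < gll_key k B) (blocks P)"
    by (rule sorted_wrt_mono_rel[OF _ blocks_spec(2)[OF P]])
      (use gll_less_iff_key[OF P] blocks_spec(1)[OF P] in auto)
  then have "sorted_wrt (<) (map (gll_key k) (blocks P))" by (simp add: sorted_wrt_map)
  then have "distinct (map (gll_key k) (blocks P))" by (simp only: strict_sorted_iff)
  then show ?thesis by (simp add: distinct_map)
qed

text \<open>Sizes increase weakly along \<open>blocks\<close>, so they form the sorted list of the
  type. Partitions of equal type therefore have blocks of equal size in equal positions.\<close>

lemma set_type_blocks:
  fixes k :: nat
  assumes P: "partition_on {1..k} P"
  shows "map card (blocks P) = sorted_list_of_multiset (set_type P)"
proof -
  have "sorted_wrt (\<lambda>A B. card A \<le> card B) (blocks P)"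
    by (rule sorted_wrt_mono_rel[OF _ blocks_spec(2)[OF P]]) (auto simp: gll_less_def gll_le_def)
  then have sorted: "sorted (map card (blocks P))" by (simp add: sorted_wrt_map)
  have "mset_set P = mset (blocks P)"
    using mset_set_set[OF blocks_distinct[OF P]] blocks_spec(1)[OF P] by simp
  then have "set_type P = mset (map card (blocks P))" by (simp add: set_type_def)
  then have "sorted_list_of_multiset (set_type P) = sort (map card (blocks P))"
    by (simp only: sorted_list_of_multiset_mset)
  then show ?thesis using sorted_sort_id[OF sorted] by simp
qed

section \<open>Matching the blocks of two partitions of the same type by position\<close>

definition corr :: "nat set set \<Rightarrow> nat set set \<Rightarrow> nat set \<Rightarrow> nat set" where
  "corr P Q A = the (map_of (zip (blocks P) (blocks Q)) A)"

locale same_type =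
  fixes k :: nat and P Q :: "nat set set"
  assumes P: "partition_on {1..k} P" and Q: "partition_on {1..k} Q"
    and type_eq: "set_type P = set_type Q"
begin

lemma sizes: "map card (blocks P) = map card (blocks Q)"
  using set_type_blocks[OF P] set_type_blocks[OF Q] type_eq by simp

lemma length_eq: "length (blocks P) = length (blocks Q)"
  using sizes by (rule map_eq_imp_length_eq)

lemma corr_nth: "j < length (blocks P) \<Longrightarrow> corr P Q (blocks P ! j) = blocks Q ! j"
  unfolding corr_def using map_of_zip_nth[OF length_eq blocks_distinct[OF P]] length_eq by simp

lemma block_nth: "A \<in> P \<Longrightarrow> \<exists>j<length (blocks P). A = blocks P ! j"
  using blocks_spec(1)[OF P] by (metis in_set_conv_nth)

lemma corr_in: "A \<in> P \<Longrightarrow> corr P Q A \<in> Q"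
  using block_nth[of A] corr_nth length_eq blocks_spec(1)[OF Q] nth_mem by metis

lemma card_corr: "A \<in> P \<Longrightarrow> card (corr P Q A) = card A"
  using block_nth[of A] corr_nth length_eq sizes by (metis nth_map)

lemma corr_image: "corr P Q ` P = Q"
proof (intro equalityI subsetI)
  fix B assume "B \<in> Q"
  then obtain j where j: "j < length (blocks Q)" "B = blocks Q ! j"
    using blocks_spec(1)[OF Q] by (metis in_set_conv_nth)
  then have "blocks P ! j \<in> P" using length_eq blocks_spec(1)[OF P] nth_mem by metis
  then show "B \<in> corr P Q ` P" using j length_eq corr_nth by (metis imageI)
qed (use corr_in in auto)

lemma corr_less: "A \<in> P \<Longrightarrow> B \<in> P \<Longrightarrow> gll_less A B \<Longrightarrow> gll_less (corr P Q A) (corr P Q B)"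
proof -
  assume AB: "A \<in> P" "B \<in> P" "gll_less A B"
  obtain i j where ij: "i < length (blocks P)" "A = blocks P ! i" "j < length (blocks P)" "B = blocks P ! j"
    using block_nth AB(1,2) by metis
  have "i < j"
  proof (rule ccontr)
    assume "\<not> i < j"
    then have "j = i \<or> j < i" by linarith
    then have "j = i \<or> gll_less B A"
      using blocks_spec(2)[OF P] ij by (auto simp: sorted_wrt_iff_nth_less)
    then show False using AB gll_less_iff_key[OF P] ij by auto
  qed
  then show ?thesis
    using ij corr_nth length_eq blocks_spec(2)[OF Q] by (auto simp: sorted_wrt_iff_nth_less)
qed

end

lemma same_type_sym: "same_type k P Q \<Longrightarrow> same_type k Q P"
  by (simp add: same_type_def)

context same_type
begin

lemma corr_inverse: "A \<in> P \<Longrightarrow> corr Q P (corr P Q A) = A"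
proof -
  assume "A \<in> P"
  then obtain j where j: "j < length (blocks P)" "A = blocks P ! j" using block_nth by blast
  interpret sym: same_type k Q P by (rule same_type_sym) (rule same_type_axioms)
  show ?thesis using j corr_nth sym.corr_nth length_eq by simp
qed

lemma inj_on_corr: "inj_on (corr P Q) P"
  using corr_inverse by (rule inj_on_inverseI)

lemma ell_block_diag: "ell P Q = block_diag (corr P Q) P"
proof -
  have "ell P Q = (\<lambda>j. Inl ` (blocks P ! j) \<union> Inr ` (blocks Q ! j)) ` {..<length (blocks P)}"
    unfolding ell_def length_eq by auto
  also have "\<dots> = (\<lambda>j. Inl ` (blocks P ! j) \<union> Inr ` corr P Q (blocks P ! j)) ` {..<length (blocks P)}"
    by (intro image_cong refl) (simp add: corr_nth)
  also have "\<dots> = (\<lambda>A. Inl ` A \<union> Inr ` corr P Q A) ` ((\<lambda>j. blocks P ! j) ` {..<length (blocks P)})"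
    by (simp add: image_image)
  also have "(\<lambda>j. blocks P ! j) ` {..<length (blocks P)} = P"
    using blocks_spec(1)[OF P] by (auto simp: set_conv_nth)
  finally show ?thesis by (simp add: block_diag_def)
qed

lemma ell_block_bijection: "block_bijection k (corr P Q) P"
  by unfold_locales (use P Q in \<open>simp_all add: corr_image inj_on_corr card_corr\<close>)

lemma ell_ubp: "ell P Q \<in> ubp_set k"
  unfolding ell_block_diag by (rule block_bijection.block_diag_ubp[OF ell_block_bijection])

lemma top_part_ell: "top_part (ell P Q) = P"
  unfolding ell_block_diag by (rule block_bijection.top_part_block_diag[OF ell_block_bijection])

lemma bot_part_ell: "bot_part (ell P Q) = Q"
  unfolding ell_block_diag block_bijection.bot_part_block_diag[OF ell_block_bijection] by (rule corr_image)

text \<open>The diagram \<open>ell P Q\<close> leads from \<open>P\<close> on top to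
  \<open>Q\<close> at the bottom, so pulling back goes from \<open>Q\<close> to \<open>P\<close>.
  For \<open>ell \<gamma> \<pi>\<close> this is the replacement of blocks of \<open>\<pi>\<close> by
  blocks of \<open>\<gamma>\<close>.\<close>

lemma pre_ell: "B \<in> Q \<Longrightarrow> pre (ell P Q) B = corr Q P B"
proof (rule pre_eq[OF ell_ubp])
  assume B: "B \<in> Q"
  interpret sym: same_type k Q P by (rule same_type_sym) (rule same_type_axioms)
  have "(corr Q P B, corr P Q (corr Q P B)) \<in> sat_rel (ell P Q)"
    unfolding ell_block_diag
    by (rule block_bijection.sat_rel_block[OF ell_block_bijection sym.corr_in[OF B]])
  then show "(corr Q P B, B) \<in> sat_rel (ell P Q)" by (simp add: sym.corr_inverse[OF B])
qed

lemma sat_rel_ell: "sat_rel (ell P Q) = {(\<Union>R, \<Union>(corr P Q ` R)) | R. R \<subseteq> P}"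
  unfolding ell_block_diag by (rule block_bijection.sat_rel_block_diag[OF ell_block_bijection])

end

text \<open>The two matchings are inverse to each other, so only the identity on unions of blocks of
  \<open>P\<close> is left. This is the inverse that factors arbitrary elements of
  \<open>L_set\<close> through some \<open>ell\<close>.\<close>

lemma ell_mult_inverse:
  assumes "same_type k P Q"
  shows "ubp_mult (ell P Q) (ell Q P) = e_diag P"
proof -
  interpret same_type k P Q by (rule assms)
  interpret sym: same_type k Q P by (rule same_type_sym[OF assms])
  have "sat_rel (ubp_mult (ell P Q) (ell Q P)) = sat_rel (ell P Q) O sat_rel (ell Q P)"
    by (rule sat_rel_mult[OF ell_ubp sym.ell_ubp])
  also have "\<dots> = {(A, A) | A. sat P A}"
  proof (intro equalityI subsetI)
    fix z assume "z \<in> sat_rel (ell P Q) O sat_rel (ell Q P)"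
    then obtain A C D where z: "z = (A, D)" "(A, C) \<in> sat_rel (ell P Q)" "(C, D) \<in> sat_rel (ell Q P)"
      by (elim relcompE)
    obtain R where R: "R \<subseteq> P" "A = \<Union>R" "C = \<Union>(corr P Q ` R)"
      using z(2) unfolding sat_rel_ell by blast
    have "corr P Q ` R \<subseteq> Q" using R(1) corr_image by blast
    then have "(\<Union>(corr P Q ` R), \<Union>(corr Q P ` corr P Q ` R)) \<in> sat_rel (ell Q P)"
      unfolding sym.sat_rel_ell by blast
    moreover have "corr Q P ` corr P Q ` R = R"
      using R(1) corr_inverse by (force simp: image_image)
    ultimately have "(C, A) \<in> sat_rel (ell Q P)" using R by simp
    then have "D = A" using z(3) sat_rel_functional(1)[OF sym.ell_ubp] by blast
    moreover have "sat P A" unfolding sat_iff_Union[OF P] using R by blast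
    ultimately show "z \<in> {(A, A) | A. sat P A}" using z(1) by blast
  next
    fix z assume "z \<in> {(A, A) | A. sat P A}"
    then obtain R where R: "R \<subseteq> P" "z = (\<Union>R, \<Union>R)" unfolding sat_iff_Union[OF P] by blast
    have "corr P Q ` R \<subseteq> Q" using R(1) corr_image by blast
    then have "(\<Union>(corr P Q ` R), \<Union>(corr Q P ` corr P Q ` R)) \<in> sat_rel (ell Q P)"
      unfolding sym.sat_rel_ell by blast
    moreover have "corr Q P ` corr P Q ` R = R"
      using R(1) corr_inverse by (force simp: image_image)
    moreover have "(\<Union>R, \<Union>(corr P Q ` R)) \<in> sat_rel (ell P Q)" unfolding sat_rel_ell using R(1) by blast
    ultimately show "z \<in> sat_rel (ell P Q) O sat_rel (ell Q P)" unfolding R(2) by (metis relcompI)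
  qed
  also have "\<dots> = sat_rel (e_diag P)" by (rule sat_rel_e_diag[OF P, symmetric])
  finally show ?thesis
    by (rule ubp_eqI[OF ubp_mult_closed[OF ell_ubp sym.ell_ubp] e_diag_ubp[OF P]])
qed


section \<open>The partition of consecutive blocks\<close>

text \<open>The formula inside \<open>pi_of\<close>, for an arbitrary list of sizes, so that
  induction can append one block at the end.\<close>

definition consecutive :: "nat list \<Rightarrow> nat set set" where
  "consecutive ps = {{sum_list (take j ps) + 1 .. sum_list (take (j + 1) ps)} | j. j < length ps}"

lemma consecutive_snoc:
  "consecutive (ps @ [p]) = insert {sum_list ps + 1 .. sum_list ps + p} (consecutive ps)"
proof -
  let ?f = "\<lambda>qs j. {sum_list (take j qs) + 1 .. sum_list (take (j + 1) qs)}"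
  have image: "consecutive qs = ?f qs ` {..<length qs}" for qs
    unfolding consecutive_def by blast
  have "consecutive (ps @ [p]) = insert (?f (ps @ [p]) (length ps)) (?f (ps @ [p]) ` {..<length ps})"
    unfolding image by (simp add: lessThan_Suc)
  also have "?f (ps @ [p]) ` {..<length ps} = ?f ps ` {..<length ps}"
    by (rule image_cong) simp_all
  finally show ?thesis unfolding image[of ps] by simp
qed

lemma consecutive_spec:
  assumes "0 \<notin> set ps"
  shows "partition_on {1..sum_list ps} (consecutive ps) \<and> set_type (consecutive ps) = mset ps"
  using assms
proof (induction ps rule: rev_induct)
  case Nil
  then show ?case by (simp add: consecutive_def set_type_def partition_on_def)
next
  case (snoc p ps)
  let ?B = "{sum_list ps + 1 .. sum_list ps + p}"
  have IH: "partition_on {1..sum_list ps} (consecutive ps)" "set_type (consecutive ps) = mset ps"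
    using snoc by auto
  have p: "p > 0" using snoc.prems by auto
  have disj: "A \<inter> ?B = {}" if "A \<in> consecutive ps" for A
  proof -
    have "A \<subseteq> {1..sum_list ps}" using IH(1) that by (auto simp: partition_on_def)
    then show ?thesis by fastforce
  qed
  have new: "?B \<notin> consecutive ps" using disj[of ?B] p by auto
  have fin: "finite (consecutive ps)" by (rule finite_elements[OF _ IH(1)]) simp
  have "partition_on {1..sum_list (ps @ [p])} (consecutive (ps @ [p]))"
    unfolding consecutive_snoc partition_on_def
  proof (intro conjI)
    have "\<Union>(insert ?B (consecutive ps)) = ?B \<union> {1..sum_list ps}"
      using IH(1) by (simp add: partition_on_def)
    then show "\<Union>(insert ?B (consecutive ps)) = {1..sum_list (ps @ [p])}" by auto
    have "disjoint (consecutive ps)" using IH(1) by (simp add: partition_on_def)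
    then show "disjoint (insert ?B (consecutive ps))"
      using disj by (auto simp: disjoint_def Int_commute)
    show "{} \<notin> insert ?B (consecutive ps)" using IH(1) p by (auto simp: partition_on_def)
  qed
  moreover have "set_type (consecutive (ps @ [p])) = mset (ps @ [p])"
    using IH(2) fin new unfolding consecutive_snoc by (simp add: set_type_def)
  ultimately show ?case by blast
qed

lemma count_set_type:
  assumes "finite P"
  shows "count (set_type P) n = card {B \<in> P. card B = n}"
proof -
  have "count (set_type P) n = (\<Sum>B\<in>card -` {n} \<inter> P. count (mset_set P) B)"
    using assms by (simp add: set_type_def count_image_mset)
  also have "\<dots> = (\<Sum>B\<in>card -` {n} \<inter> P. 1)"
    using assms by (intro sum.cong) auto
  also have "card -` {n} \<inter> P = {B \<in> P. card B = n}" by auto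
  finally show ?thesis by simp
qed

lemma count_vec_type: "count (vec_type k lam) n = (if n \<in> {1..k} then sum_list (lam n) else 0)"
proof -
  have "count (vec_type k lam) n = (\<Sum>i = 1..k. if i = n then sum_list (lam i) else 0)"
    unfolding vec_type_def by (simp add: count_sum count_replicate_mset del: One_nat_def)
  also have "\<dots> = (if n \<in> {1..k} then sum_list (lam n) else 0)"
    by (simp add: sum.delta del: One_nat_def)
  finally show ?thesis .
qed

lemma sum_mset_sum: "finite A \<Longrightarrow> sum_mset (\<Sum>i\<in>A. f i) = (\<Sum>i\<in>A. sum_mset (f i))"
  by (induction A rule: finite_induct) simp_all

lemma increasing_mono:
  assumes \<mu>: "int_partition \<mu>" and T: "increasing lt \<mu> T"
    and imp: "\<And>x y. x \<in> cells \<mu> \<Longrightarrow> y \<in> cells \<mu> \<Longrightarrow> lt (T x) (T y) \<Longrightarrow> lt' (T' x) (T' y)"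
  shows "increasing lt' \<mu> T'"
  unfolding increasing_def
proof (intro conjI allI impI; elim conjE)
  fix r c c' assume c: "c < c'" "(r, c') \<in> cells \<mu>"
  then have "(r, c) \<in> cells \<mu>" by (auto simp: cells_def)
  then show "lt' (T' (r, c)) (T' (r, c'))" using imp c T by (auto simp: increasing_def)
next
  fix r r' c assume r: "r < r'" "(r', c) \<in> cells \<mu>"
  then have "(r, c) \<in> cells \<mu>" using cells_down[OF \<mu> r(2), of r c] by simp
  then show "lt' (T' (r, c)) (T' (r', c))" using imp r T by (auto simp: increasing_def)
qed

section \<open>Tableaux on set partitions of the given type\<close>

context shape
begin

abbreviation "\<pi> \<equiv> pi_of (vec_type k lam)"

abbreviation "parts \<equiv> set_partitions_of_type k (vec_type k lam)"

lemma pi_spec: "partition_on {1..k} \<pi>" "set_type \<pi> = vec_type k lam"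
proof -
  let ?ps = "sorted_list_of_multiset (vec_type k lam)"
  have mset: "mset ?ps = vec_type k lam" by simp
  have "0 \<notin> set ?ps"
  proof
    assume "0 \<in> set ?ps"
    then have "count (vec_type k lam) 0 > 0" by simp
    then show False unfolding count_vec_type by simp
  qed
  moreover have "sum_list ?ps = k"
  proof -
    have "sum_list ?ps = sum_mset (vec_type k lam)" by (metis mset sum_mset_sum_list)
    also have "\<dots> = (\<Sum>i = 1..k. sum_list (lam i) * i)"
      unfolding vec_type_def by (simp add: sum_mset_sum sum_mset_replicate_mset)
    also have "\<dots> = k" using lam by (simp add: index_set_def mult.commute)
    finally show ?thesis .
  qed
  moreover have "\<pi> = consecutive ?ps" by (simp add: pi_of_def consecutive_def Let_def)
  ultimately show "partition_on {1..k} \<pi>" "set_type \<pi> = vec_type k lam"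
    using consecutive_spec[of ?ps] mset by auto
qed

lemma parts_iff: "\<gamma> \<in> parts \<longleftrightarrow> partition_on {1..k} \<gamma> \<and> set_type \<gamma> = vec_type k lam"
  by (simp add: set_partitions_of_type_def)

lemma pi_in_parts: "\<pi> \<in> parts"
  using pi_spec by (simp add: parts_iff)

lemma same_type: "\<gamma> \<in> parts \<Longrightarrow> \<delta> \<in> parts \<Longrightarrow> same_type k \<gamma> \<delta>"
  by unfold_locales (simp_all add: parts_iff)

lemma finite_parts: "finite parts"
proof (rule finite_subset)
  show "parts \<subseteq> Pow (Pow {1..k})"
  proof
    fix \<gamma> assume "\<gamma> \<in> parts"
    then have "\<Union>\<gamma> = {1..k}" by (simp add: parts_iff partition_on_def)
    then show "\<gamma> \<in> Pow (Pow {1..k})" by blast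
  qed
qed simp

text \<open>The family \<open>pi_tableaux\<close> for an arbitrary set partition. Uniform tableaux
  are sorted into these families by their sets of entries.\<close>

definition tabs :: "nat set set \<Rightarrow> tableaux set" where
  "tabs \<gamma> = std_tuples gll_less k lam (\<lambda>i. {B \<in> \<gamma>. card B = i})"

lemma pi_tableaux_eq: "pi_tableaux k lam \<gamma> = tabs \<gamma>"
  by (simp add: pi_tableaux_def tabs_def)

lemma tabs_D:
  assumes "T \<in> tabs \<gamma>" "i \<in> {1..k}"
  shows "T i \<in> std_tableaux gll_less (lam i) {B \<in> \<gamma>. card B = i}"
    "inj_on (T i) (cells (lam i))" "T i ` cells (lam i) = {B \<in> \<gamma>. card B = i}"
proof -
  show T: "T i \<in> std_tableaux gll_less (lam i) {B \<in> \<gamma>. card B = i}"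
    by (rule PiE_mem[OF assms(1)[unfolded tabs_def] assms(2)])
  show "inj_on (T i) (cells (lam i))" "T i ` cells (lam i) = {B \<in> \<gamma>. card B = i}"
    by (rule std_tableauxD[OF T])+
qed

lemma tabs_block_filling:
  assumes "partition_on {1..k} \<gamma>" "T \<in> tabs \<gamma>"
  shows "block_filling k lam T" "entries k lam T = \<gamma>"
proof -
  have im: "T i ` cells (lam i) = {B \<in> \<gamma>. card B = i}" if "i \<in> {1..k}" for i
    by (rule tabs_D(3)[OF assms(2) that])
  have "entries k lam T = (\<Union>i\<in>{1..k}. {B \<in> \<gamma>. card B = i})"
    unfolding entries_def using im by simp
  also have "\<dots> = \<gamma>" using partition_block(6)[OF assms(1)] by blast
  finally show ent: "entries k lam T = \<gamma>" .
  have "card (T i x) = i" if "i \<in> {1..k}" "x \<in> cells (lam i)" for i x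
  proof -
    have "T i x \<in> {B \<in> \<gamma>. card B = i}" using im[OF that(1)] that(2) by blast
    then show ?thesis by simp
  qed
  then show "block_filling k lam T" using assms(1) ent by (simp add: block_filling_def)
qed

lemma block_filling_entries:
  assumes F: "block_filling k lam F" and i: "i \<in> {1..k}"
  shows "F i ` cells (lam i) = {B \<in> entries k lam F. card B = i}"
proof (intro equalityI subsetI)
  fix B assume "B \<in> F i ` cells (lam i)"
  then show "B \<in> {B \<in> entries k lam F. card B = i}"
    using F i by (auto simp: block_filling_def entries_def)
next
  fix B assume B: "B \<in> {B \<in> entries k lam F. card B = i}"
  then obtain j x where jx: "j \<in> {1..k}" "x \<in> cells (lam j)" "B = F j x"
    by (auto simp: entries_def)
  then have "card B = j" using F by (simp add: block_filling_def)
  then show "B \<in> F i ` cells (lam i)" using B jx by auto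
qed

text \<open>All blocks in one component have the same size, and among such blocks of a partition the
  graded order compares maxima.\<close>

lemma std_gll_eq_last:
  assumes P: "partition_on {1..k} \<gamma>" and \<mu>: "int_partition \<mu>"
  shows "std_tableaux gll_less \<mu> {B \<in> \<gamma>. card B = i} = std_tableaux last_less \<mu> {B \<in> \<gamma>. card B = i}"
proof -
  have lt: "gll_less A B \<longleftrightarrow> last_less A B"
    if "A \<in> {B \<in> \<gamma>. card B = i}" "B \<in> {B \<in> \<gamma>. card B = i}" for A B
    using gll_less_iff_Max[OF P, of A B] that by (simp add: last_less_def)
  have "increasing gll_less \<mu> T \<longleftrightarrow> increasing last_less \<mu> T"
    if T: "bij_betw T (cells \<mu>) {B \<in> \<gamma>. card B = i}" for T
  proof -
    have "T x \<in> {B \<in> \<gamma>. card B = i}" if "x \<in> cells \<mu>" for x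
      using bij_betw_imp_surj_on[OF T] that by blast
    then have "gll_less (T x) (T y) \<longleftrightarrow> last_less (T x) (T y)" if "x \<in> cells \<mu>" "y \<in> cells \<mu>" for x y
      using lt that by blast
    then show ?thesis
      using increasing_mono[OF \<mu>, of gll_less T last_less T] increasing_mono[OF \<mu>, of last_less T gll_less T]
      by blast
  qed
  then show ?thesis unfolding std_tableaux_def by blast
qed

lemma tabs_eq_last:
  assumes "partition_on {1..k} \<gamma>"
  shows "tabs \<gamma> = std_tuples last_less k lam (\<lambda>i. {B \<in> \<gamma>. card B = i})"
  unfolding tabs_def by (rule PiE_cong) (rule std_gll_eq_last[OF assms int_part])

text \<open>Component \<open>n\<close> is injective and collects exactly the blocks of size
  \<open>n\<close>, so the number of these blocks is the number of cells of
  \<open>lam n\<close>.\<close>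

lemma block_filling_type:
  assumes F: "block_filling k lam F"
  shows "entries k lam F \<in> parts"
proof -
  have P: "partition_on {1..k} (entries k lam F)" using F by (simp add: block_filling_def)
  have "set_type (entries k lam F) = vec_type k lam"
  proof (rule multiset_eqI)
    fix n
    show "count (set_type (entries k lam F)) n = count (vec_type k lam) n"
    proof (cases "n \<in> {1..k}")
      case True
      have "count (set_type (entries k lam F)) n = card (F n ` cells (lam n))"
        unfolding count_set_type[OF finite_entries] block_filling_entries[OF F True] ..
      also have "\<dots> = sum_list (lam n)"
        using card_image[OF block_filling_inj[OF F True]] card_cells[OF int_part[OF True]] by simp
      finally show ?thesis using True by (simp only: count_vec_type if_True)
    next
      case False
      then have "{B \<in> entries k lam F. card B = n} = {}" using partition_block(6)[OF P] by blast
      then have "count (set_type (entries k lam F)) n = 0"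
        unfolding count_set_type[OF finite_entries] by (simp only: card.empty)
      then show ?thesis using False by (simp only: count_vec_type if_False)
    qed
  qed
  then show ?thesis using P by (simp add: parts_iff)
qed

lemma uniform_tabs:
  assumes S: "S \<in> uniform_tableaux k lam"
  shows "entries k lam S \<in> parts" "S \<in> tabs (entries k lam S)"
proof -
  have F: "block_filling k lam S" and std: "S \<in> std_tuples last_less k lam (\<lambda>i. S i ` cells (lam i))"
    using S by (simp_all add: uniform_iff)
  show "entries k lam S \<in> parts" by (rule block_filling_type[OF F])
  have "std_tuples last_less k lam (\<lambda>i. S i ` cells (lam i)) =
      std_tuples last_less k lam (\<lambda>i. {B \<in> entries k lam S. card B = i})"
    by (rule PiE_cong) (simp only: block_filling_entries[OF F])
  then show "S \<in> tabs (entries k lam S)"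
    using std F tabs_eq_last by (simp add: block_filling_def)
qed

lemma tabs_uniform:
  assumes "\<gamma> \<in> parts" "T \<in> tabs \<gamma>"
  shows "T \<in> uniform_tableaux k lam" "entries k lam T = \<gamma>"
proof -
  have P: "partition_on {1..k} \<gamma>" using assms(1) by (simp add: parts_iff)
  show "entries k lam T = \<gamma>" by (rule tabs_block_filling(2)[OF P assms(2)])
  have F: "block_filling k lam T" by (rule tabs_block_filling(1)[OF P assms(2)])
  have "std_tuples last_less k lam (\<lambda>i. T i ` cells (lam i)) =
      std_tuples last_less k lam (\<lambda>i. {B \<in> \<gamma>. card B = i})"
    by (rule PiE_cong) (simp only: tabs_D(3)[OF assms(2)])
  then show "T \<in> uniform_tableaux k lam"
    using F assms(2) tabs_eq_last[OF P] by (simp add: uniform_iff)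
qed

lemma relabel_apply:
  "i \<in> {1..k} \<Longrightarrow> x \<in> cells (lam i) \<Longrightarrow> relabel k lam \<gamma> \<delta> T i x = corr \<gamma> \<delta> (T i x)"
  unfolding relabel_def corr_def by (simp only: restrict_apply' )

lemma relabel_tabs:
  assumes \<gamma>: "\<gamma> \<in> parts" and \<delta>: "\<delta> \<in> parts" and T: "T \<in> tabs \<gamma>"
  shows "relabel k lam \<gamma> \<delta> T \<in> tabs \<delta>"
proof -
  interpret same_type k \<gamma> \<delta> by (rule same_type[OF \<gamma> \<delta>])
  have "relabel k lam \<gamma> \<delta> T i \<in> std_tableaux gll_less (lam i) {B \<in> \<delta>. card B = i}"
    if i: "i \<in> {1..k}" for i
  proof -
    note Ti = tabs_D[OF T i]
    have in\<gamma>: "T i x \<in> \<gamma>" if "x \<in> cells (lam i)" for x using Ti(3) that by blast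
    have im: "corr \<gamma> \<delta> ` {B \<in> \<gamma>. card B = i} = {B \<in> \<delta>. card B = i}"
    proof (intro equalityI subsetI)
      fix B assume B: "B \<in> {B \<in> \<delta>. card B = i}"
      then obtain A where "A \<in> \<gamma>" "B = corr \<gamma> \<delta> A" using corr_image by blast
      then show "B \<in> corr \<gamma> \<delta> ` {B \<in> \<gamma>. card B = i}" using B card_corr by auto
    qed (use corr_in card_corr in auto)
    have "T i ` cells (lam i) \<subseteq> \<gamma>" using in\<gamma> by (rule image_subsetI)
    then have "inj_on (\<lambda>x. corr \<gamma> \<delta> (T i x)) (cells (lam i))"
      by (rule comp_inj_on[OF Ti(2) inj_on_subset[OF inj_on_corr], unfolded o_def])
    moreover have "(\<lambda>x. corr \<gamma> \<delta> (T i x)) ` cells (lam i) = {B \<in> \<delta>. card B = i}"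
      unfolding im[symmetric] Ti(3)[symmetric] image_image ..
    ultimately have "bij_betw (\<lambda>x. corr \<gamma> \<delta> (T i x)) (cells (lam i)) {B \<in> \<delta>. card B = i}"
      by (simp add: bij_betw_def)
    then have bij: "bij_betw (relabel k lam \<gamma> \<delta> T i) (cells (lam i)) {B \<in> \<delta>. card B = i}"
      by (rule bij_betw_cong[THEN iffD1, rotated]) (simp add: relabel_apply[OF i])
    have "increasing gll_less (lam i) (relabel k lam \<gamma> \<delta> T i)"
      by (rule increasing_mono[OF int_part[OF i] std_tableauxD(3)[OF Ti(1)]])
        (simp add: relabel_apply[OF i] corr_less in\<gamma>)
    moreover have "relabel k lam \<gamma> \<delta> T i \<in> extensional (cells (lam i))"
      using i by (simp add: relabel_def)
    ultimately show ?thesis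
      using bij by (auto simp: std_tableaux_def PiE_def bij_betw_def)
  qed
  moreover have "relabel k lam \<gamma> \<delta> T \<in> extensional {1..k}" by (simp add: relabel_def)
  ultimately show ?thesis unfolding tabs_def PiE_iff by blast
qed

lemma relabel_inverse:
  assumes \<gamma>: "\<gamma> \<in> parts" and \<delta>: "\<delta> \<in> parts" and T: "T \<in> tabs \<gamma>"
  shows "relabel k lam \<delta> \<gamma> (relabel k lam \<gamma> \<delta> T) = T"
proof -
  interpret same_type k \<gamma> \<delta> by (rule same_type[OF \<gamma> \<delta>])
  have T': "relabel k lam \<delta> \<gamma> (relabel k lam \<gamma> \<delta> T) \<in> tabs \<gamma>"
    by (rule relabel_tabs[OF \<delta> \<gamma> relabel_tabs[OF \<gamma> \<delta> T]])
  show ?thesis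
  proof (rule extensionalityI)
    show "relabel k lam \<delta> \<gamma> (relabel k lam \<gamma> \<delta> T) \<in> extensional {1..k}" "T \<in> extensional {1..k}"
      using T T' by (simp_all add: tabs_def PiE_def)
    fix i assume i: "i \<in> {1..k}"
    show "relabel k lam \<delta> \<gamma> (relabel k lam \<gamma> \<delta> T) i = T i"
    proof (rule extensionalityI)
      show "relabel k lam \<delta> \<gamma> (relabel k lam \<gamma> \<delta> T) i \<in> extensional (cells (lam i))"
        "T i \<in> extensional (cells (lam i))"
        by (rule std_tableauxD(4)[OF tabs_D(1)[OF T' i]] std_tableauxD(4)[OF tabs_D(1)[OF T i]])+
      fix x assume x: "x \<in> cells (lam i)"
      then have "T i x \<in> \<gamma>" using tabs_D(3)[OF T i] by blast
      then show "relabel k lam \<delta> \<gamma> (relabel k lam \<gamma> \<delta> T) i x = T i x"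
        by (simp only: relabel_apply[OF i x] corr_inverse)
    qed
  qed
qed

text \<open>A uniform tableau determines \<open>\<gamma>\<close> as its set of entries, and matching
  \<open>\<gamma>\<close> with \<open>\<pi>\<close> by position undoes the relabelling.\<close>

lemma relabel_bij:
  "bij_betw (\<lambda>(\<gamma>, T). relabel k lam \<pi> \<gamma> T) (parts \<times> tabs \<pi>) (uniform_tableaux k lam)"
proof (rule bij_betw_byWitness[where f' = "\<lambda>S. (entries k lam S, relabel k lam (entries k lam S) \<pi> S)"])
  let ?f = "\<lambda>(\<gamma>, T). relabel k lam \<pi> \<gamma> T"
  let ?g = "\<lambda>S. (entries k lam S, relabel k lam (entries k lam S) \<pi> S)"
  show "\<forall>a\<in>parts \<times> tabs \<pi>. ?g (?f a) = a"
  proof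
    fix a assume "a \<in> parts \<times> tabs \<pi>"
    then obtain \<gamma> T where a: "a = (\<gamma>, T)" and \<gamma>: "\<gamma> \<in> parts" and T: "T \<in> tabs \<pi>" by blast
    have "entries k lam (relabel k lam \<pi> \<gamma> T) = \<gamma>"
      by (rule tabs_uniform(2)[OF \<gamma> relabel_tabs[OF pi_in_parts \<gamma> T]])
    then show "?g (?f a) = a"
      using relabel_inverse[OF pi_in_parts \<gamma> T] by (simp add: a)
  qed
  show "\<forall>S\<in>uniform_tableaux k lam. ?f (?g S) = S"
    using relabel_inverse[OF uniform_tabs(1) pi_in_parts uniform_tabs(2)] by simp
  show "(\<lambda>(\<gamma>, T). relabel k lam \<pi> \<gamma> T) ` (parts \<times> tabs \<pi>) \<subseteq> uniform_tableaux k lam"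
    using tabs_uniform(1)[OF _ relabel_tabs[OF pi_in_parts]] by auto
  show "(\<lambda>S. (entries k lam S, relabel k lam (entries k lam S) \<pi> S)) ` uniform_tableaux k lam \<subseteq> parts \<times> tabs \<pi>"
    using uniform_tabs relabel_tabs[OF _ pi_in_parts] by auto
qed

lemma finite_tabs: "\<gamma> \<in> parts \<Longrightarrow> finite (tabs \<gamma>)"
  unfolding tabs_def
proof (rule finite_std_tuples)
  fix i assume "\<gamma> \<in> parts"
  then have "finite \<gamma>" using finite_elements[of "{1..k}" \<gamma>] by (simp add: parts_iff)
  then show "finite {B \<in> \<gamma>. card B = i}" by (rule finite_subset[rotated]) blast
qed

end


section \<open>Quotients as spaces of fibres\<close>

lemma free_mod_uminus:
  assumes "supp p \<subseteq> B"
  shows "\<ominus>\<^bsub>free_mod B\<^esub> p = - p"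
proof -
  interpret module CC "free_mod B" by (rule module_free_mod)
  show ?thesis by (rule minus_equality) (use assms in simp_all)
qed

text \<open>Negation is scaling by \<open>- 1\<close>, so closure under additive inverses follows
  from closure under scalars.\<close>

lemma submodule_free_mod_iff:
  "submodule N CC (free_mod B) \<longleftrightarrow> N \<subseteq> {p. supp p \<subseteq> B} \<and> 0 \<in> N \<and>
     (\<forall>p\<in>N. \<forall>q\<in>N. p + q \<in> N) \<and> (\<forall>c. \<forall>p\<in>N. scale c p \<in> N)"
proof
  interpret module CC "free_mod B" by (rule module_free_mod)
  assume N: "submodule N CC (free_mod B)"
  note E = submoduleE[OF N]
  have sc: "scale c p \<in> N" if "p \<in> N" for c p using E(4)[of c p] that by simp
  obtain p where "p \<in> N" using E(2) by blast
  then have "0 \<in> N" using sc[of p 0] by simp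
  moreover have "p + q \<in> N" if "p \<in> N" "q \<in> N" for p q using E(5)[OF that] by simp
  ultimately show "N \<subseteq> {p. supp p \<subseteq> B} \<and> 0 \<in> N \<and>
     (\<forall>p\<in>N. \<forall>q\<in>N. p + q \<in> N) \<and> (\<forall>c. \<forall>p\<in>N. scale c p \<in> N)"
    using E(1) sc by simp
next
  interpret module CC "free_mod B" by (rule module_free_mod)
  assume N: "N \<subseteq> {p. supp p \<subseteq> B} \<and> 0 \<in> N \<and>
     (\<forall>p\<in>N. \<forall>q\<in>N. p + q \<in> N) \<and> (\<forall>c. \<forall>p\<in>N. scale c p \<in> N)"
  show "submodule N CC (free_mod B)"
  proof (rule submoduleI)
    fix p assume p: "p \<in> N"
    then have "scale (- 1) p \<in> N" using N by blast
    moreover have "scale (- 1) p = - p" by (rule poly_mapping_eqI) (simp add: lookup_uminus)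
    moreover have "supp p \<subseteq> B" using N p by blast
    ultimately show "\<ominus>\<^bsub>free_mod B\<^esub> p \<in> N" using free_mod_uminus by metis
  qed (use N in auto)
qed

text \<open>\<open>\<phi>\<close> describes a linear map between free spaces, and \<open>s\<close> a
  section of it on basis vectors. The section gives surjectivity and also normal forms for the
  elements of the quotient by the kernel.\<close>

locale fiber_quotient =
  fixes B :: "'b set" and U :: "'u set" and \<phi> :: "'b \<Rightarrow> ('u \<Rightarrow>\<^sub>0 complex)"
    and s :: "'u \<Rightarrow> ('b \<Rightarrow>\<^sub>0 complex)"
  assumes \<phi>: "b \<in> B \<Longrightarrow> supp (\<phi> b) \<subseteq> U"
    and s: "u \<in> U \<Longrightarrow> supp (s u) \<subseteq> B" and \<phi>_s: "u \<in> U \<Longrightarrow> lin_ext \<phi> (s u) = bvec u"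
begin

definition ker :: "('b \<Rightarrow>\<^sub>0 complex) set" where
  "ker = {x. supp x \<subseteq> B \<and> lin_ext \<phi> x = 0}"

definition fib :: "('u \<Rightarrow>\<^sub>0 complex) \<Rightarrow> ('b \<Rightarrow>\<^sub>0 complex) set" where
  "fib y = {x. supp x \<subseteq> B \<and> lin_ext \<phi> x = y}"

abbreviation "W \<equiv> quot_mod (free_mod B) ker"

lemma \<phi>_supp: "supp x \<subseteq> B \<Longrightarrow> supp (lin_ext \<phi> x) \<subseteq> U"
  by (rule supp_lin_ext) (use \<phi> in blast)

lemma section_spec:
  assumes "supp y \<subseteq> U"
  shows "supp (lin_ext s y) \<subseteq> B" "lin_ext \<phi> (lin_ext s y) = y"
proof -
  show "supp (lin_ext s y) \<subseteq> B" by (rule supp_lin_ext) (use assms s in blast)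
  have "lin_ext \<phi> (lin_ext s y) = lin_ext bvec y"
    unfolding lin_ext_lin_ext by (rule lin_ext_cong) (use assms \<phi>_s in blast)
  then show "lin_ext \<phi> (lin_ext s y) = y" by simp
qed

lemma section_fib: "supp y \<subseteq> U \<Longrightarrow> lin_ext s y \<in> fib y"
  by (simp add: fib_def section_spec)

lemma supp_diff: "supp x \<subseteq> B \<Longrightarrow> supp z \<subseteq> B \<Longrightarrow> supp (x - z) \<subseteq> B"
  using keys_diff[of x z] by blast

lemma fib_inj: "supp y \<subseteq> U \<Longrightarrow> supp z \<subseteq> U \<Longrightarrow> fib y = fib z \<Longrightarrow> y = z"
  using section_fib[of y] by (auto simp: fib_def)

lemma coset_eq_fib:
  assumes x: "supp x \<subseteq> B"
  shows "ker +>\<^bsub>free_mod B\<^esub> x = fib (lin_ext \<phi> x)"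
  unfolding a_r_coset_def'
proof (intro equalityI subsetI)
  fix z assume "z \<in> (\<Union>h\<in>ker. {h \<oplus>\<^bsub>free_mod B\<^esub> x})"
  then obtain h where "h \<in> ker" "z = h + x" by auto
  then show "z \<in> fib (lin_ext \<phi> x)"
    using x by (simp add: ker_def fib_def lin_ext_add supp_add)
next
  fix z assume z: "z \<in> fib (lin_ext \<phi> x)"
  then have "z - x \<in> ker" using x by (simp add: ker_def fib_def lin_ext_diff supp_diff)
  moreover have "z = (z - x) \<oplus>\<^bsub>free_mod B\<^esub> x" by simp
  ultimately show "z \<in> (\<Union>h\<in>ker. {h \<oplus>\<^bsub>free_mod B\<^esub> x})" by blast
qed

lemma ker_eq_fib: "ker = fib 0"
  by (simp add: ker_def fib_def)

lemma W_carrier: "carrier W = fib ` {y. supp y \<subseteq> U}"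
proof -
  have "carrier W = (\<lambda>x. ker +>\<^bsub>free_mod B\<^esub> x) ` {x. supp x \<subseteq> B}"
    unfolding quot_mod_def A_RCOSETS_def' by auto
  also have "\<dots> = (\<lambda>x. fib (lin_ext \<phi> x)) ` {x. supp x \<subseteq> B}"
    by (rule image_cong) (simp_all add: coset_eq_fib)
  also have "\<dots> = fib ` (lin_ext \<phi> ` {x. supp x \<subseteq> B})" by (simp add: image_image)
  also have "lin_ext \<phi> ` {x. supp x \<subseteq> B} = {y. supp y \<subseteq> U}"
  proof (intro equalityI subsetI)
    fix y assume "y \<in> {y. supp y \<subseteq> U}"
    then show "y \<in> lin_ext \<phi> ` {x. supp x \<subseteq> B}"
      using section_spec[of y] by (intro image_eqI[of _ _ "lin_ext s y"]) simp_all
  qed (use \<phi>_supp in blast)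
  finally show ?thesis .
qed

lemma fib_closed: "supp y \<subseteq> U \<Longrightarrow> fib y \<in> carrier W"
  unfolding W_carrier by blast

text \<open>A single element of \<open>Z\<close> suffices, since \<open>fib y\<close> contains all
  the differences required. Allowing a proper part \<open>Z\<close> of a fibre covers scalar
  multiples and actions, where the image of a coset need not be a whole coset; for the scalar
  \<open>0\<close> it is a single point.\<close>

lemma set_add_fib:
  assumes "supp y \<subseteq> U" "supp z \<subseteq> U" "Z \<subseteq> fib z" "Z \<noteq> {}"
  shows "fib y <+>\<^bsub>free_mod B\<^esub> Z = fib (y + z)"
  unfolding set_add_def'
proof (intro equalityI subsetI)
  fix x assume "x \<in> (\<Union>h\<in>fib y. \<Union>l\<in>Z. {h \<oplus>\<^bsub>free_mod B\<^esub> l})"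
  then obtain h l where "h \<in> fib y" "l \<in> fib z" "x = h + l" using assms(3) by auto
  then show "x \<in> fib (y + z)" by (simp add: fib_def lin_ext_add supp_add)
next
  fix x assume x: "x \<in> fib (y + z)"
  obtain l where l: "l \<in> Z" using assms(4) by blast
  then have "l \<in> fib z" using assms(3) by blast
  then have "x - l \<in> fib y" using x by (simp add: fib_def lin_ext_diff supp_diff)
  moreover have "x = (x - l) \<oplus>\<^bsub>free_mod B\<^esub> l" by simp
  ultimately show "x \<in> (\<Union>h\<in>fib y. \<Union>l\<in>Z. {h \<oplus>\<^bsub>free_mod B\<^esub> l})" using l by blast
qed

lemma fib_nonempty: "supp y \<subseteq> U \<Longrightarrow> fib y \<noteq> {}"
  using section_fib by blast

lemma W_add: "supp y \<subseteq> U \<Longrightarrow> supp z \<subseteq> U \<Longrightarrow> fib y \<oplus>\<^bsub>W\<^esub> fib z = fib (y + z)"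
  by (simp add: quot_mod_def set_add_fib fib_nonempty)

lemma W_zero: "\<zero>\<^bsub>W\<^esub> = fib 0"
  by (simp add: quot_mod_def ker_eq_fib)

lemma ker_add_fib:
  assumes "supp z \<subseteq> U" "Z \<subseteq> fib z" "Z \<noteq> {}"
  shows "ker <+>\<^bsub>free_mod B\<^esub> Z = fib z"
  unfolding ker_eq_fib using set_add_fib[of 0 z Z] assms by simp

lemma W_smult:
  assumes y: "supp y \<subseteq> U"
  shows "c \<odot>\<^bsub>W\<^esub> fib y = fib (scale c y)"
proof -
  have "(\<lambda>x. scale c x) ` fib y \<subseteq> fib (scale c y)"
    by (auto simp: fib_def lin_ext_scale supp_scale_subset intro: supp_scale_subset[THEN subsetD])
  then show ?thesis
    using ker_add_fib[of "scale c y" "(\<lambda>x. scale c x) ` fib y"] fib_nonempty[OF y] supp_scale_subset[OF y]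
    by (simp add: quot_mod_def)
qed

lemma W_cases:
  assumes "v \<in> carrier W"
  obtains y where "supp y \<subseteq> U" "v = fib y"
  using assms unfolding W_carrier by blast

lemma abelian_group_W: "abelian_group W"
proof (rule abelian_groupI)
  fix x y assume "x \<in> carrier W" "y \<in> carrier W"
  then obtain a b where ab: "supp a \<subseteq> U" "x = fib a" "supp b \<subseteq> U" "y = fib b" by (elim W_cases)
  show "x \<oplus>\<^bsub>W\<^esub> y \<in> carrier W" using ab by (simp add: W_add fib_closed supp_add)
  show "x \<oplus>\<^bsub>W\<^esub> y = y \<oplus>\<^bsub>W\<^esub> x" using ab by (simp add: W_add add.commute)
  fix z assume "z \<in> carrier W"
  then obtain c where c: "supp c \<subseteq> U" "z = fib c" by (elim W_cases)
  show "x \<oplus>\<^bsub>W\<^esub> y \<oplus>\<^bsub>W\<^esub> z = x \<oplus>\<^bsub>W\<^esub> (y \<oplus>\<^bsub>W\<^esub> z)"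
    using ab c by (simp add: W_add supp_add add.assoc)
next
  show "\<zero>\<^bsub>W\<^esub> \<in> carrier W" unfolding W_zero by (rule fib_closed) simp
  fix x assume "x \<in> carrier W"
  then obtain a where a: "supp a \<subseteq> U" "x = fib a" by (elim W_cases)
  show "\<zero>\<^bsub>W\<^esub> \<oplus>\<^bsub>W\<^esub> x = x" unfolding W_zero using a by (simp add: W_add)
  have "fib (- a) \<oplus>\<^bsub>W\<^esub> x = \<zero>\<^bsub>W\<^esub>" unfolding W_zero using a by (simp add: W_add)
  then show "\<exists>y\<in>carrier W. y \<oplus>\<^bsub>W\<^esub> x = \<zero>\<^bsub>W\<^esub>" using a fib_closed[of "- a"] by auto
qed

lemma module_W: "module CC W"
proof (rule moduleI[OF cring_CC abelian_group_W])
  fix c d :: complex and x assume "x \<in> carrier W"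
  then obtain a where a: "supp a \<subseteq> U" "x = fib a" by (elim W_cases)
  show "c \<odot>\<^bsub>W\<^esub> x \<in> carrier W" using a by (simp add: W_smult fib_closed supp_scale_subset)
  show "(c \<oplus>\<^bsub>CC\<^esub> d) \<odot>\<^bsub>W\<^esub> x = c \<odot>\<^bsub>W\<^esub> x \<oplus>\<^bsub>W\<^esub> d \<odot>\<^bsub>W\<^esub> x"
    using a by (simp add: W_smult W_add supp_scale_subset scale_add_left)
  show "c \<otimes>\<^bsub>CC\<^esub> d \<odot>\<^bsub>W\<^esub> x = c \<odot>\<^bsub>W\<^esub> (d \<odot>\<^bsub>W\<^esub> x)"
    using a by (simp add: W_smult supp_scale_subset scale_scale)
  show "\<one>\<^bsub>CC\<^esub> \<odot>\<^bsub>W\<^esub> x = x" using a by (simp add: W_smult)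
  fix y assume "y \<in> carrier W"
  then obtain b where b: "supp b \<subseteq> U" "y = fib b" by (elim W_cases)
  show "c \<odot>\<^bsub>W\<^esub> (x \<oplus>\<^bsub>W\<^esub> y) = c \<odot>\<^bsub>W\<^esub> x \<oplus>\<^bsub>W\<^esub> c \<odot>\<^bsub>W\<^esub> y"
    using a b by (simp add: W_smult W_add supp_scale_subset supp_add scale_add)
qed

lemma finsum_fib:
  assumes "finite I" "\<And>i. i \<in> I \<Longrightarrow> supp (h i) \<subseteq> U"
  shows "(\<Oplus>\<^bsub>W\<^esub>i\<in>I. fib (h i)) = fib (\<Sum>i\<in>I. h i)"
  using assms
proof (induction I)
  case empty
  interpret abelian_group W by (rule abelian_group_W)
  show ?case by (simp add: W_zero)
next
  case (insert i I)
  interpret abelian_group W by (rule abelian_group_W)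
  have "(\<Oplus>\<^bsub>W\<^esub>j\<in>insert i I. fib (h j)) = fib (h i) \<oplus>\<^bsub>W\<^esub> (\<Oplus>\<^bsub>W\<^esub>j\<in>I. fib (h j))"
    using insert by (intro finsum_insert) (auto intro: fib_closed)
  also have "\<dots> = fib (h i + (\<Sum>j\<in>I. h j))"
    using insert by (simp add: W_add supp_sum_subset)
  finally show ?case using insert by simp
qed

text \<open>\<open>fib\<close> carries the free space on \<open>U\<close> linearly and injectively
  onto \<open>W\<close>, so a family corresponding to the standard basis of that space is a basis of
  \<open>W\<close>. The coefficients of a vector are read off at the points
  \<open>g i\<close>.\<close>

lemma is_basis_W:
  assumes I: "finite I" and g: "bij_betw g I U" and e: "\<And>i. i \<in> I \<Longrightarrow> e i = fib (bvec (g i))"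
  shows "is_basis W I e"
  unfolding is_basis_def
proof (intro conjI ballI)
  show "finite I" by (rule I)
  have gU: "g i \<in> U" if "i \<in> I" for i using g that by (auto simp: bij_betw_def)
  show "e \<in> I \<rightarrow> carrier W" using gU e by (auto intro!: fib_closed)
  fix v assume "v \<in> carrier W"
  then obtain y where y: "supp y \<subseteq> U" "v = fib y" by (elim W_cases)
  have supp: "supp (scale (c i) (bvec (g i))) \<subseteq> U" if "i \<in> I" for c and i
    using gU[OF that] by (intro supp_scale_subset) simp
  have comb: "(\<Oplus>\<^bsub>W\<^esub>i\<in>I. c i \<odot>\<^bsub>W\<^esub> e i) = fib (\<Sum>i\<in>I. scale (c i) (bvec (g i)))" for c
  proof -
    interpret abelian_group W by (rule abelian_group_W)
    have eq: "c i \<odot>\<^bsub>W\<^esub> e i = fib (scale (c i) (bvec (g i)))" if "i \<in> I" for i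
      unfolding e[OF that] by (rule W_smult) (use gU[OF that] in simp)
    have "(\<Oplus>\<^bsub>W\<^esub>i\<in>I. c i \<odot>\<^bsub>W\<^esub> e i) = (\<Oplus>\<^bsub>W\<^esub>i\<in>I. fib (scale (c i) (bvec (g i))))"
      by (rule finsum_cong') (use eq supp fib_closed in auto)
    then show ?thesis using finsum_fib[OF I supp] by simp
  qed
  have coef: "coef (\<Sum>i\<in>I. scale (c i) (bvec (g i))) (g j) = c j" if j: "j \<in> I" for c j
  proof -
    have "coef (\<Sum>i\<in>I. scale (c i) (bvec (g i))) (g j) = (\<Sum>i\<in>I. c i * (if g i = g j then 1 else 0))"
      by (simp only: lookup_sum coef_scale coef_bvec)
    also have "\<dots> = (\<Sum>i\<in>I. if i = j then c i else 0)"
      using g j by (intro sum.cong) (auto simp: bij_betw_def inj_on_def)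
    finally show ?thesis using I j by simp
  qed
  have sum_supp: "supp (\<Sum>i\<in>I. scale (c i) (bvec (g i))) \<subseteq> U" for c
    by (rule supp_sum_subset) (rule supp)
  have coef0: "coef (\<Sum>i\<in>I. scale (c i) (bvec (g i))) u = 0" if "u \<notin> U" for c u
    using sum_supp[of c] that by (auto simp: in_keys_iff)
  have iff: "v = (\<Oplus>\<^bsub>W\<^esub>i\<in>I. c i \<odot>\<^bsub>W\<^esub> e i) \<longleftrightarrow> (\<forall>i\<in>I. c i = coef y (g i))" for c
  proof -
    have "v = (\<Oplus>\<^bsub>W\<^esub>i\<in>I. c i \<odot>\<^bsub>W\<^esub> e i) \<longleftrightarrow> y = (\<Sum>i\<in>I. scale (c i) (bvec (g i)))"
    proof
      assume "v = (\<Oplus>\<^bsub>W\<^esub>i\<in>I. c i \<odot>\<^bsub>W\<^esub> e i)"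
      then have "fib y = fib (\<Sum>i\<in>I. scale (c i) (bvec (g i)))" unfolding comb y(2) .
      then show "y = (\<Sum>i\<in>I. scale (c i) (bvec (g i)))"
        by (rule fib_inj[OF y(1) sum_supp])
    qed (simp add: comb y(2))
    also have "\<dots> \<longleftrightarrow> (\<forall>i\<in>I. c i = coef y (g i))"
    proof
      assume y': "y = (\<Sum>i\<in>I. scale (c i) (bvec (g i)))"
      show "\<forall>i\<in>I. c i = coef y (g i)" using coef[of _ c] unfolding y' by simp
    next
      assume c: "\<forall>i\<in>I. c i = coef y (g i)"
      show "y = (\<Sum>i\<in>I. scale (c i) (bvec (g i)))"
      proof (rule poly_mapping_eqI)
        fix u show "coef y u = coef (\<Sum>i\<in>I. scale (c i) (bvec (g i))) u"
        proof (cases "u \<in> U")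
          case True
          then obtain j where j: "j \<in> I" "u = g j" using g by (auto simp: bij_betw_def)
          then show ?thesis using coef[OF j(1), of c] c by simp
        next
          case False
          then have "coef y u = 0" using y(1) by (auto simp: in_keys_iff)
          then show ?thesis using coef0[OF False] by simp
        qed
      qed
    qed
    finally show ?thesis .
  qed
  show "\<exists>!c. c \<in> I \<rightarrow>\<^sub>E UNIV \<and> v = (\<Oplus>\<^bsub>W\<^esub>i\<in>I. c i \<odot>\<^bsub>W\<^esub> e i)"
    unfolding iff
  proof (rule ex1I[of _ "\<lambda>i\<in>I. coef y (g i)"])
    fix c assume c: "c \<in> I \<rightarrow>\<^sub>E UNIV \<and> (\<forall>i\<in>I. c i = coef y (g i))"
    show "c = (\<lambda>i\<in>I. coef y (g i))"
      by (rule extensionalityI[of _ I]) (use c in \<open>auto simp: PiE_def\<close>)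
  qed auto
qed

text \<open>The extension of \<open>\<phi>\<close> is constant on a fibre, so on the carrier of
  \<open>W\<close> the value does not depend on the representative chosen.\<close>

definition rho :: "('b \<Rightarrow>\<^sub>0 complex) set \<Rightarrow> ('u \<Rightarrow>\<^sub>0 complex)" where
  "rho Y = lin_ext \<phi> (SOME x. x \<in> Y)"

lemma rho_fib: "supp y \<subseteq> U \<Longrightarrow> rho (fib y) = y"
  unfolding rho_def using someI_ex[of "\<lambda>x. x \<in> fib y"] section_fib[of y] by (auto simp: fib_def)

text \<open>The map \<open>\<theta>\<close> on representatives lifts \<open>act\<close> along
  \<open>\<phi>\<close>. Hence \<open>actW\<close> sends the fibre over \<open>y\<close> to the
  fibre over \<open>act d y\<close>, and the laws of a representation are inherited from
  \<open>act\<close>.\<close>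

lemma rep_iso_rho:
  assumes rep: "representation M (free_mod U) act"
    and theta: "\<And>d x. d \<in> carrier M \<Longrightarrow> supp x \<subseteq> B \<Longrightarrow>
      supp (\<theta> d x) \<subseteq> B \<and> lin_ext \<phi> (\<theta> d x) = act d (lin_ext \<phi> x)"
    and actW: "\<And>d Y. actW d Y = ker <+>\<^bsub>free_mod B\<^esub> (\<theta> d ` Y)"
  shows "rep_iso M W actW (free_mod U) act rho"
proof -
  have act: "supp (act d y) \<subseteq> U" if "d \<in> carrier M" "supp y \<subseteq> U" for d y
  proof -
    have "act d y \<in> carrier (free_mod U)"
      using representationD(1)[OF rep that(1)] that(2) unfolding linear_map_def by (auto dest: funcset_mem)
    then show ?thesis by simp
  qed
  have actW_fib: "actW d (fib y) = fib (act d y)" if "d \<in> carrier M" "supp y \<subseteq> U" for d y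
    unfolding actW
  proof (rule ker_add_fib[OF act[OF that]])
    show "\<theta> d ` fib y \<subseteq> fib (act d y)" using theta[OF that(1)] unfolding fib_def by blast
    show "\<theta> d ` fib y \<noteq> {}" using fib_nonempty[OF that(2)] by simp
  qed
  have lin: "act d (y + z) = act d y + act d z" "act d (scale c y) = scale c (act d y)"
    if "d \<in> carrier M" "supp y \<subseteq> U" "supp z \<subseteq> U" for d y z c
    using rep that unfolding representation_def linear_map_def by simp_all
  have "representation M W actW"
    unfolding representation_def
  proof (intro conjI ballI)
    show "monoid M" using rep by (simp add: representation_def)
    show "module CC W" by (rule module_W)
    show "linear_map W W (actW d)" if d: "d \<in> carrier M" for d
      unfolding linear_map_def
    proof (intro conjI ballI allI Pi_I)
      fix x assume "x \<in> carrier W"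
      then obtain a where a: "supp a \<subseteq> U" "x = fib a" by (elim W_cases)
      show "actW d x \<in> carrier W" using a d by (simp add: actW_fib fib_closed act)
      show "actW d (c \<odot>\<^bsub>W\<^esub> x) = c \<odot>\<^bsub>W\<^esub> actW d x" for c
        using a d by (simp add: W_smult actW_fib act supp_scale_subset lin(2)[OF d a(1) a(1)])
      fix y assume "y \<in> carrier W"
      then obtain b where b: "supp b \<subseteq> U" "y = fib b" by (elim W_cases)
      show "actW d (x \<oplus>\<^bsub>W\<^esub> y) = actW d x \<oplus>\<^bsub>W\<^esub> actW d y"
        using a b d by (simp add: W_add actW_fib act supp_add lin(1))
    qed
    fix v assume "v \<in> carrier W"
    then obtain y where y: "supp y \<subseteq> U" "v = fib y" by (elim W_cases)
    show "actW \<one>\<^bsub>M\<^esub> v = v"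
    proof -
      have "monoid M" "act \<one>\<^bsub>M\<^esub> y = y" using rep y by (simp_all add: representation_def)
      then show ?thesis using y monoid.one_closed[of M] by (simp add: actW_fib)
    qed
    show "actW (d \<otimes>\<^bsub>M\<^esub> d') v = actW d (actW d' v)" if "d \<in> carrier M" "d' \<in> carrier M" for d d'
    proof -
      have "monoid M" "act (d \<otimes>\<^bsub>M\<^esub> d') y = act d (act d' y)"
        using rep y that by (simp_all add: representation_def)
      then show ?thesis using y that monoid.m_closed[of M d d'] by (simp add: actW_fib act)
    qed
  qed
  moreover have "linear_map W (free_mod U) rho"
    unfolding linear_map_def
  proof (intro conjI ballI allI Pi_I)
    fix x assume "x \<in> carrier W"
    then obtain a where a: "supp a \<subseteq> U" "x = fib a" by (elim W_cases)
    show "rho x \<in> carrier (free_mod U)" using a by (simp add: rho_fib)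
    show "rho (c \<odot>\<^bsub>W\<^esub> x) = c \<odot>\<^bsub>free_mod U\<^esub> rho x" for c
      using a by (simp add: W_smult rho_fib supp_scale_subset)
    fix y assume "y \<in> carrier W"
    then obtain b where b: "supp b \<subseteq> U" "y = fib b" by (elim W_cases)
    show "rho (x \<oplus>\<^bsub>W\<^esub> y) = rho x \<oplus>\<^bsub>free_mod U\<^esub> rho y"
      using a b by (simp add: W_add rho_fib supp_add)
  qed
  moreover have "bij_betw rho (carrier W) (carrier (free_mod U))"
  proof (rule bij_betw_byWitness[where f' = fib])
    show "\<forall>v\<in>carrier W. fib (rho v) = v" using rho_fib by (auto simp: W_carrier)
    show "\<forall>y\<in>carrier (free_mod U). rho (fib y) = y" using rho_fib by simp
    show "rho ` carrier W \<subseteq> carrier (free_mod U)" using rho_fib by (auto simp: W_carrier)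
    show "fib ` carrier (free_mod U) \<subseteq> carrier W" by (simp add: W_carrier)
  qed
  moreover have "rho (actW d v) = act d (rho v)" if d: "d \<in> carrier M" and v: "v \<in> carrier W" for d v
  proof -
    obtain y where y: "supp y \<subseteq> U" "v = fib y" using v by (elim W_cases)
    then show ?thesis using d by (simp add: actW_fib rho_fib act)
  qed
  ultimately show ?thesis using rep unfolding rep_iso_def by blast
qed

text \<open>If basis vectors are congruent to their normal forms modulo \<open>N\<close>, then by
  linearity every \<open>x\<close> is congruent to \<open>lin_ext s (lin_ext \<phi> x)\<close>,
  which is zero for \<open>x\<close> in the kernel.\<close>

lemma submod_gen_eq_ker:
  assumes rels: "R \<subseteq> ker"
    and reduce: "\<And>N b. submodule N CC (free_mod B) \<Longrightarrow> R \<subseteq> N \<Longrightarrow> b \<in> B \<Longrightarrow>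
      bvec b - lin_ext s (\<phi> b) \<in> N"
  shows "submod_gen (free_mod B) R = ker"
proof
  have "submodule ker CC (free_mod B)"
    unfolding submodule_free_mod_iff
    by (auto simp: ker_def lin_ext_add lin_ext_scale dest: supp_add[THEN subsetD, rotated 2] supp_scale_subset[THEN subsetD, rotated])
  then show "submod_gen (free_mod B) R \<subseteq> ker" unfolding submod_gen_def using rels by blast
  show "ker \<subseteq> submod_gen (free_mod B) R"
    unfolding submod_gen_def
  proof (intro subsetI InterI)
    fix x N assume x: "x \<in> ker" and N: "N \<in> {N. submodule N CC (free_mod B) \<and> R \<subseteq> N}"
    then have N': "submodule N CC (free_mod B)" "R \<subseteq> N" by blast+
    then have cl: "0 \<in> N" "\<And>p q. p \<in> N \<Longrightarrow> q \<in> N \<Longrightarrow> p + q \<in> N" "\<And>c p. p \<in> N \<Longrightarrow> scale c p \<in> N"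
      unfolding submodule_free_mod_iff by blast+
    let ?t = "\<lambda>b. bvec b - lin_ext s (\<phi> b)"
    have "(\<Sum>b\<in>A. scale (coef x b) (?t b)) \<in> N" if "finite A" "A \<subseteq> B" for A
      using that
    proof (induction A)
      case (insert b A)
      then have "?t b \<in> N" using reduce[OF N'] by blast
      then show ?case using insert cl by simp
    qed (use cl in simp)
    then have "lin_ext ?t x \<in> N" unfolding lin_ext_def using x by (simp add: ker_def)
    moreover have "lin_ext ?t x = x - lin_ext s (lin_ext \<phi> x)"
    proof -
      have "lin_ext ?t x + lin_ext (\<lambda>b. lin_ext s (\<phi> b)) x = lin_ext bvec x"
        unfolding lin_ext_add_fun[symmetric] by simp
      then show ?thesis by (simp add: lin_ext_lin_ext eq_diff_eq)
    qed
    ultimately show "x \<in> N" using x by (simp add: ker_def)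
  qed
qed

end


section \<open>The induced module\<close>

lemma free_mod_induct:
  assumes "supp p \<subseteq> B" and zero: "Q 0" and base: "\<And>b. b \<in> B \<Longrightarrow> Q (bvec b)"
    and add: "\<And>p q. supp p \<subseteq> B \<Longrightarrow> supp q \<subseteq> B \<Longrightarrow> Q p \<Longrightarrow> Q q \<Longrightarrow> Q (p + q)"
    and sc: "\<And>c p. supp p \<subseteq> B \<Longrightarrow> Q p \<Longrightarrow> Q (scale c p)"
  shows "Q p"
proof -
  have "supp (\<Sum>b\<in>A. scale (coef p b) (bvec b)) \<subseteq> B \<and> Q (\<Sum>b\<in>A. scale (coef p b) (bvec b))"
    if "finite A" "A \<subseteq> B" for A
    using that
  proof (induction A)
    case (insert b A)
    have b: "supp (bvec b) \<subseteq> B" "b \<in> B" using insert.prems by simp_all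
    have sb: "supp (scale (coef p b) (bvec b)) \<subseteq> B" by (rule supp_scale_subset[OF b(1)])
    have Qb: "Q (scale (coef p b) (bvec b))" by (rule sc[OF b(1) base[OF b(2)]])
    have IH: "supp (\<Sum>b\<in>A. scale (coef p b) (bvec b)) \<subseteq> B" "Q (\<Sum>b\<in>A. scale (coef p b) (bvec b))"
      using insert by simp_all
    show ?case
      unfolding sum.insert[OF insert.hyps] using supp_add[OF sb IH(1)] add[OF sb IH(1) Qb IH(2)] by (rule conjI)
  qed (simp add: zero)
  from this[OF finite_keys assms(1)] show ?thesis by (simp only: sum_single_supp)
qed

text \<open>Both halves determine the block they come from, so both types can be counted over the
  blocks of \<open>d\<close>, whose halves have equal size.\<close>

lemma top_bot_set_type:
  assumes d: "d \<in> ubp_set k"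
  shows "set_type (top_part d) = set_type (bot_part d)"
proof -
  have disj: "D = D'" if "D \<in> d" "D' \<in> d" "D \<inter> D' \<noteq> {}" for D D'
    using disjointD[of d D D'] ubp_partition[OF d] that by (auto simp: partition_on_def)
  have inj: "inj_on (\<lambda>D. Inl -` D) d" "inj_on (\<lambda>D. Inr -` D) d"
  proof (rule_tac [!] inj_onI)
    fix D D' assume D: "D \<in> d" "D' \<in> d"
    show "D = D'" if "Inl -` D = Inl -` D'"
    proof (rule disj[OF D])
      obtain x where "x \<in> Inl -` D" using ubp_block_nonempty(1)[OF d D(1)] by blast
      then have "Inl x \<in> D" "Inl x \<in> D'" using that by blast+
      then show "D \<inter> D' \<noteq> {}" by blast
    qed
    show "D = D'" if "Inr -` D = Inr -` D'"
    proof (rule disj[OF D])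
      obtain x where "x \<in> Inr -` D" using ubp_block_nonempty(2)[OF d D(1)] by blast
      then have "Inr x \<in> D" "Inr x \<in> D'" using that by blast+
      then show "D \<inter> D' \<noteq> {}" by blast
    qed
  qed
  have "set_type (top_part d) = image_mset (\<lambda>D. card (Inl -` D)) (mset_set d)"
    unfolding set_type_def top_part_def image_mset_mset_set[OF inj(1), symmetric]
    by (simp add: multiset.map_comp o_def)
  also have "\<dots> = image_mset (\<lambda>D. card (Inr -` D)) (mset_set d)"
    by (rule image_mset_cong) (use ubp_block_card[OF d] ubp_finite(1)[OF d] in simp)
  also have "\<dots> = set_type (bot_part d)"
    unfolding set_type_def bot_part_def image_mset_mset_set[OF inj(2), symmetric]
    by (simp add: multiset.map_comp o_def)
  finally show ?thesis .
qed

lemma bot_part_eqI: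
  assumes d: "d \<in> ubp_set k" and P: "partition_on {1..k} P" and eq: "\<And>C. C \<in> Range (sat_rel d) \<longleftrightarrow> sat P C"
  shows "bot_part d = P"
  by (rule partition_eq_if_sat[OF bot_part_partition[OF d] P]) (simp only: sat_bot_part[OF d] eq)

lemma top_part_eqI:
  assumes d: "d \<in> ubp_set k" and P: "partition_on {1..k} P" and eq: "\<And>A. A \<in> Domain (sat_rel d) \<longleftrightarrow> sat P A"
  shows "top_part d = P"
  by (rule partition_eq_if_sat[OF top_part_partition[OF d] P]) (simp only: sat_top_part[OF d] eq)

lemma bot_part_mult:
  assumes d: "d \<in> ubp_set k" and d': "d' \<in> ubp_set k" and eq: "bot_part d = top_part d'"
  shows "bot_part (ubp_mult d d') = bot_part d'" "top_part (ubp_mult d d') = top_part d"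
proof -
  have mid: "B \<in> Range (sat_rel d) \<longleftrightarrow> B \<in> Domain (sat_rel d')" for B
    unfolding sat_bot_part[OF d, symmetric] sat_top_part[OF d', symmetric] eq ..
  have "C \<in> Range (sat_rel (ubp_mult d d')) \<longleftrightarrow> sat (bot_part d') C" for C
    unfolding sat_rel_mult[OF d d'] sat_bot_part[OF d'] using mid by blast
  then show "bot_part (ubp_mult d d') = bot_part d'"
    by (rule bot_part_eqI[OF ubp_mult_closed[OF d d'] bot_part_partition[OF d']])
  have "A \<in> Domain (sat_rel (ubp_mult d d')) \<longleftrightarrow> sat (top_part d) A" for A
    unfolding sat_rel_mult[OF d d'] sat_top_part[OF d] using mid by blast
  then show "top_part (ubp_mult d d') = top_part d"
    by (rule top_part_eqI[OF ubp_mult_closed[OF d d'] top_part_partition[OF d]])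
qed

lemma e_diag_top_mult:
  assumes d: "d \<in> ubp_set k"
  shows "ubp_mult (e_diag (top_part d)) d = d"
proof -
  note P = top_part_partition[OF d]
  have "sat_rel (ubp_mult (e_diag (top_part d)) d) = {(A, A) | A. sat (top_part d) A} O sat_rel d"
    unfolding sat_rel_mult[OF e_diag_ubp[OF P] d] sat_rel_e_diag[OF P] ..
  also have "\<dots> = sat_rel d"
  proof -
    have "(A, C) \<in> {(A, A) | A. A \<in> Domain (sat_rel d)} O sat_rel d \<longleftrightarrow> (A, C) \<in> sat_rel d" for A C
      by auto
    then show ?thesis unfolding sat_top_part[OF d] by auto
  qed
  finally show ?thesis by (rule ubp_eqI[OF ubp_mult_closed[OF e_diag_ubp[OF P] d] d])
qed

text \<open>The inverse block map of the definition of \<open>V_act\<close> is thereby expressed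
  through \<open>pre\<close>, so that the group module and uniform tableaux are governed by one
  formula.\<close>

lemma inv_block_map:
  assumes d: "d \<in> ubp_set k" and C: "C \<in> bot_part d"
  shows "inv_into (top_part d) (block_map d) C = pre d C"
proof -
  have split: "Inl ` (Inl -` D) \<union> Inr ` (Inr -` D) = D" for D :: "(nat + nat) set" by (rule sum_set_split)
  have disj: "D = D'" if "D \<in> d" "D' \<in> d" "x \<in> D" "x \<in> D'" for D D' x
    using disjointD[of d D D'] ubp_partition[OF d] that by (auto simp: partition_on_def)
  have map: "block_map d (Inl -` D) = Inr -` D" if D: "D \<in> d" for D
    unfolding block_map_def
  proof (rule the_equality)
    show "Inl ` (Inl -` D) \<union> Inr ` (Inr -` D) \<in> d" unfolding split by (rule D)
    fix E assume E: "Inl ` (Inl -` D) \<union> Inr ` E \<in> d"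
    obtain x where "x \<in> Inl -` D" using ubp_block_nonempty(1)[OF d D] by blast
    then have "Inl ` (Inl -` D) \<union> Inr ` E = D" by (intro disj[OF E D, of "Inl x"]) auto
    then show "E = Inr -` D" by (metis vimage_sum_set(2))
  qed
  obtain D where D: "D \<in> d" "C = Inr -` D" using C unfolding bot_part_def by blast
  have "inj_on (block_map d) (top_part d)"
  proof (rule inj_onI)
    fix A A' assume A: "A \<in> top_part d" "A' \<in> top_part d" "block_map d A = block_map d A'"
    then obtain D D' where D: "D \<in> d" "A = Inl -` D" "D' \<in> d" "A' = Inl -` D'"
      unfolding top_part_def by blast
    then have eq: "Inr -` D = Inr -` D'" using A(3) map by simp
    obtain x where "x \<in> Inr -` D" using ubp_block_nonempty(2)[OF d D(1)] by blast
    then have "Inr x \<in> D" "Inr x \<in> D'" using eq by blast+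
    then show "A = A'" using disj[OF D(1,3)] D by blast
  qed
  moreover have "Inl -` D \<in> top_part d" unfolding top_part_def using D(1) by (rule imageI)
  ultimately have "inv_into (top_part d) (block_map d) C = Inl -` D"
    by (rule inv_into_f_eq) (simp only: map[OF D(1)] D(2))
  moreover have "pre d C = Inl -` D"
    unfolding D(2) by (rule pre_eq[OF d ubp_block_sat_rel[OF d D(1)]])
  ultimately show ?thesis by simp
qed

text \<open>The order enters \<open>straighten\<close> only through the set of standard
  tableaux.\<close>

lemma straighten_std_cong:
  assumes "std_tableaux lt \<mu> (F ` cells \<mu>) = std_tableaux lt' \<mu> (F ` cells \<mu>)"
  shows "straighten lt \<mu> F = straighten lt' \<mu> F"
  unfolding straighten_def assms ..

section \<open>The linear map from the tensor product to uniform tableaux\<close>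

context shape
begin

lemma straighten_gll_eq_last:
  assumes F: "block_filling k lam F"
  shows "straighten_tuple gll_less k lam F = straighten_tuple last_less k lam F"
proof -
  have P: "partition_on {1..k} (entries k lam F)" using F by (simp add: block_filling_def)
  have std: "std_tableaux gll_less (lam i) (F i ` cells (lam i)) =
      std_tableaux last_less (lam i) (F i ` cells (lam i))" if "i \<in> {1..k}" for i
    unfolding block_filling_entries[OF F that] by (rule std_gll_eq_last[OF P int_part[OF that]])
  have "straighten gll_less (lam i) (F i) = straighten last_less (lam i) (F i)" if "i \<in> {1..k}" for i
    by (rule straighten_std_cong[OF std[OF that]])
  moreover have "(\<Pi>\<^sub>E i\<in>{1..k}. std_tableaux gll_less (lam i) (F i ` cells (lam i))) =
      (\<Pi>\<^sub>E i\<in>{1..k}. std_tableaux last_less (lam i) (F i ` cells (lam i)))"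
    by (rule PiE_cong) (rule std)
  ultimately show ?thesis unfolding straighten_tuple_def by simp
qed

abbreviation "L \<equiv> L_set k \<pi>"
abbreviation "G \<equiv> G_group k \<pi>"
abbreviation "V \<equiv> tabs \<pi>"
abbreviation "U \<equiv> uniform_tableaux k lam"

lemma L_iff: "l \<in> L \<longleftrightarrow> l \<in> ubp_set k \<and> bot_part l = \<pi>"
  by (simp add: L_set_def)

lemma G_iff: "g \<in> carrier G \<longleftrightarrow> g \<in> ubp_set k \<and> top_part g = \<pi> \<and> bot_part g = \<pi>"
  by (simp add: G_group_def)

lemma V_block_filling: "T \<in> V \<Longrightarrow> block_filling k lam T"
  by (rule tabs_block_filling(1)[OF pi_spec(1)])

lemma V_entries: "T \<in> V \<Longrightarrow> entries k lam T = \<pi>"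
  by (rule tabs_block_filling(2)[OF pi_spec(1)])

lemma pi_Range: "l \<in> L \<Longrightarrow> \<pi> \<subseteq> Range (sat_rel l)"
  using sat_block[OF pi_spec(1)] sat_bot_part[of l k] by (auto simp: L_iff)

text \<open>If all blocks of \<open>\<pi>\<close> are unions of bottom blocks of \<open>ubp_mult d l\<close>, then its bottom is \<open>\<pi>\<close>, because
  multiplication by \<open>d\<close> can only coarsen the bottom of \<open>l\<close>.\<close>

lemma ct_basis_outside:
  assumes d: "d \<in> ubp_set k" and l: "l \<in> L" and dl: "ubp_mult d l \<notin> L" and T: "T \<in> V"
  shows "ct_basis (ubp_mult d l) T = 0"
proof -
  have l': "l \<in> ubp_set k" "bot_part l = \<pi>" using l by (simp_all add: L_iff)
  note dl' = ubp_mult_closed[OF d l'(1)]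
  have "\<not> \<pi> \<subseteq> Range (sat_rel (ubp_mult d l))"
  proof
    assume sub: "\<pi> \<subseteq> Range (sat_rel (ubp_mult d l))"
    have "C \<in> Range (sat_rel (ubp_mult d l)) \<longleftrightarrow> sat \<pi> C" for C
    proof
      assume "C \<in> Range (sat_rel (ubp_mult d l))"
      then have "C \<in> Range (sat_rel l)" unfolding sat_rel_mult[OF d l'(1)] by blast
      then show "sat \<pi> C" using sat_bot_part[OF l'(1)] l'(2) by simp
    next
      assume "sat \<pi> C"
      then have C: "C = \<Union>{B \<in> \<pi>. B \<subseteq> C}" by (rule sat_eq_Union)
      have "sat (bot_part (ubp_mult d l)) (\<Union>{B \<in> \<pi>. B \<subseteq> C})"
        by (rule sat_Union) (use sub sat_bot_part[OF dl'] in blast)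
      then show "C \<in> Range (sat_rel (ubp_mult d l))"
        unfolding sat_bot_part[OF dl'] using C by simp
    qed
    then have "bot_part (ubp_mult d l) = \<pi>" by (rule bot_part_eqI[OF dl' pi_spec(1)])
    then show False using dl dl' by (simp add: L_iff)
  qed
  then show ?thesis by (simp add: ct_basis_def V_entries[OF T])
qed

lemma L_mult_G:
  assumes "l \<in> L" "g \<in> carrier G"
  shows "ubp_mult l g \<in> L"
  using assms bot_part_mult(1)[of l k g] ubp_mult_closed[of l k g] by (simp add: L_iff G_iff)

text \<open>All blocks of \<open>\<pi>\<close> are saturated for \<open>g\<close>, so the vanishing
  case does not occur, and both orders straighten alike. Balancedness of the tensor map thus becomes
  a case of multiplicativity of \<open>ct_basis\<close>.\<close>

lemma V_act_basis:
  assumes g: "g \<in> carrier G" and T: "T \<in> V"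
  shows "V_act k lam g (bvec T) = ct_basis g T"
proof -
  have g': "g \<in> ubp_set k" "bot_part g = \<pi>" using g by (simp_all add: G_iff)
  then have gL: "g \<in> L" by (simp add: L_iff)
  note F = V_block_filling[OF T]
  have sub: "entries k lam T \<subseteq> Range (sat_rel g)" unfolding V_entries[OF T] by (rule pi_Range[OF gL])
  have "straighten_tuple gll_less k lam (\<lambda>i x. inv_into (top_part g) (block_map g) (T i x)) =
      straighten_tuple gll_less k lam (\<lambda>i x. pre g (T i x))"
  proof (rule straighten_tuple_cong)
    fix i x assume "i \<in> {1..k}" "x \<in> cells (lam i)"
    then have "T i x \<in> entries k lam T" unfolding entries_def by blast
    then show "inv_into (top_part g) (block_map g) (T i x) = pre g (T i x)"
      unfolding V_entries[OF T] g'(2)[symmetric] by (rule inv_block_map[OF g'(1)])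
  qed
  also have "\<dots> = straighten_tuple last_less k lam (\<lambda>i x. pre g (T i x))"
    by (rule straighten_gll_eq_last[OF block_filling_pre[OF g'(1) F sub]])
  finally show ?thesis using sub by (simp add: V_act_def ct_basis_def)
qed

text \<open>\<open>g\<close> permutes the blocks of \<open>\<pi>\<close>, and straightening keeps
  the set of entries, so all terms are again tableaux on \<open>\<pi>\<close>.\<close>

lemma supp_ct_basis_G:
  assumes g: "g \<in> carrier G" and T: "T \<in> V"
  shows "supp (ct_basis g T) \<subseteq> V"
proof
  fix S assume S: "S \<in> supp (ct_basis g T)"
  have g': "g \<in> ubp_set k" "top_part g = \<pi>" using g by (simp_all add: G_iff)
  have gL: "g \<in> L" using g by (simp add: L_iff G_iff)
  note F = V_block_filling[OF T]
  have sub: "entries k lam T \<subseteq> Range (sat_rel g)" unfolding V_entries[OF T] by (rule pi_Range[OF gL])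
  have S': "S \<in> supp (straighten_tuple last_less k lam (\<lambda>i x. pre g (T i x)))"
    using S sub by (simp add: ct_basis_def)
  note supp = supp_straighten_block_filling[OF block_filling_pre[OF g'(1) F sub] S']
  have "entries k lam S = pre g ` \<pi>"
    using supp(2) unfolding entries_map V_entries[OF T] .
  also have "\<dots> = \<pi>"
  proof -
    have "pre g (Inr -` D) = Inl -` D" if "D \<in> g" for D
      by (rule pre_eq[OF g'(1) ubp_block_sat_rel[OF g'(1) that]])
    then have "pre g ` bot_part g = top_part g"
      unfolding bot_part_def top_part_def image_image by (rule image_cong[OF refl])
    then show ?thesis using g by (simp add: G_iff)
  qed
  finally show "S \<in> V" using uniform_tabs(2)[OF supp(1)] by simp
qed

definition phi :: "(diagram \<Rightarrow>\<^sub>0 complex) \<times> (tableaux \<Rightarrow>\<^sub>0 complex) \<Rightarrow> (tableaux \<Rightarrow>\<^sub>0 complex)" where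
  "phi = (\<lambda>(m, v). lin_ext (\<lambda>l. lin_ext (ct_basis l) v) m)"

text \<open>The partition \<open>\<gamma>\<close> is recovered as the set of entries of
  \<open>S\<close>, and the second factor is \<open>S\<close> relabelled back to
  \<open>\<pi>\<close>.\<close>

definition sect :: "tableaux \<Rightarrow> ((diagram \<Rightarrow>\<^sub>0 complex) \<times> (tableaux \<Rightarrow>\<^sub>0 complex) \<Rightarrow>\<^sub>0 complex)" where
  "sect S = bvec (bvec (ell (entries k lam S) \<pi>), bvec (relabel k lam (entries k lam S) \<pi> S))"

abbreviation "MV \<equiv> {m. supp m \<subseteq> L} \<times> {v. supp v \<subseteq> V}"

lemma phi_simps:
  "phi (m + m', v) = phi (m, v) + phi (m', v)" "phi (m, v + v') = phi (m, v) + phi (m, v')"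
  "phi (scale c m, v) = scale c (phi (m, v))" "phi (m, scale c v) = scale c (phi (m, v))"
  "phi (bvec l, v) = lin_ext (ct_basis l) v"
  by (simp_all add: phi_def lin_ext_add lin_ext_scale lin_ext_add_fun lin_ext_scale_fun)

lemma ell_L: "\<gamma> \<in> parts \<Longrightarrow> ell \<gamma> \<pi> \<in> L"
  using same_type.ell_ubp[OF same_type[OF _ pi_in_parts]] same_type.bot_part_ell[OF same_type[OF _ pi_in_parts]]
  by (simp add: L_iff)

lemma phi_ell:
  assumes \<gamma>: "\<gamma> \<in> parts" and T: "T \<in> V"
  shows "phi (bvec (ell \<gamma> \<pi>), bvec T) = bvec (relabel k lam \<pi> \<gamma> T)"
proof -
  interpret same_type k \<gamma> \<pi> by (rule same_type[OF \<gamma> pi_in_parts])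
  have "straighten_tuple last_less k lam (\<lambda>i x. pre (ell \<gamma> \<pi>) (T i x)) =
      straighten_tuple last_less k lam (relabel k lam \<pi> \<gamma> T)"
  proof (rule straighten_tuple_cong)
    fix i x assume ix: "i \<in> {1..k}" "x \<in> cells (lam i)"
    then have "T i x \<in> entries k lam T" unfolding entries_def by blast
    then have "T i x \<in> \<pi>" by (simp only: V_entries[OF T])
    then show "pre (ell \<gamma> \<pi>) (T i x) = relabel k lam \<pi> \<gamma> T i x"
      by (simp only: pre_ell relabel_apply[OF ix])
  qed
  also have "\<dots> = bvec (relabel k lam \<pi> \<gamma> T)"
    by (rule straighten_uniform[OF tabs_uniform(1)[OF \<gamma> relabel_tabs[OF pi_in_parts \<gamma> T]]])
  finally show ?thesis
    using pi_Range[OF ell_L[OF \<gamma>]] by (simp add: phi_simps ct_basis_def V_entries[OF T])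
qed

lemma supp_phi:
  assumes "b \<in> MV"
  shows "supp (phi b) \<subseteq> U"
proof -
  obtain m v where b: "b = (m, v)" "supp m \<subseteq> L" "supp v \<subseteq> V" using assms by blast
  have "supp (lin_ext (\<lambda>l. lin_ext (ct_basis l) v) m) \<subseteq> U"
  proof (intro supp_lin_ext)
    fix l T assume "l \<in> supp m" "T \<in> supp v"
    then have "l \<in> L" "T \<in> V" using b by blast+
    then show "supp (ct_basis l T) \<subseteq> U" by (intro supp_ct_basis V_block_filling) (simp add: L_iff)
  qed
  then show ?thesis by (simp add: phi_def b(1))
qed

lemma phi_fiber_quotient: "fiber_quotient MV U phi sect"
proof
  show "supp (phi b) \<subseteq> U" if "b \<in> MV" for b by (rule supp_phi[OF that])
  fix S assume S: "S \<in> U"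
  note u = uniform_tabs[OF S]
  have T: "relabel k lam (entries k lam S) \<pi> S \<in> V" by (rule relabel_tabs[OF u(1) pi_in_parts u(2)])
  show "supp (sect S) \<subseteq> MV" using T ell_L[OF u(1)] by (simp add: sect_def)
  show "lin_ext phi (sect S) = bvec S"
    using phi_ell[OF u(1) T] relabel_inverse[OF u(1) pi_in_parts u(2)] by (simp add: sect_def)
qed

end


section \<open>The kernel of the tensor relations and the isomorphism\<close>

context shape
begin

interpretation fq: fiber_quotient MV U phi sect
  by (rule phi_fiber_quotient)

abbreviation "rels \<equiv> tensor_rels G (free_mod L) L_ract (V_mod k lam) (V_act k lam)"

lemma V_mod_eq: "V_mod k lam = free_mod V"
  by (simp add: V_mod_def pi_tableaux_eq)

lemma tensor_free_eq: "tensor_free (free_mod L) (V_mod k lam) = free_mod MV"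
  by (simp add: tensor_free_def V_mod_eq)

lemma V_act_eq:
  assumes "g \<in> carrier G" "supp v \<subseteq> V"
  shows "V_act k lam g v = lin_ext (ct_basis g) v"
proof -
  have "V_act k lam g v = lin_ext (\<lambda>T. V_act k lam g (bvec T)) v" by (simp add: V_act_def)
  also have "\<dots> = lin_ext (ct_basis g) v"
    by (rule lin_ext_cong) (use assms V_act_basis in blast)
  finally show ?thesis .
qed

lemma V_act_closed: "g \<in> carrier G \<Longrightarrow> supp v \<subseteq> V \<Longrightarrow> supp (V_act k lam g v) \<subseteq> V"
  unfolding V_act_eq by (rule supp_lin_ext) (use supp_ct_basis_G in blast)

lemma L_ract_closed: "g \<in> carrier G \<Longrightarrow> supp m \<subseteq> L \<Longrightarrow> supp (L_ract m g) \<subseteq> L"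
  unfolding L_ract_def
proof (rule supp_lin_ext)
  fix l assume "g \<in> carrier G" "supp m \<subseteq> L" "l \<in> supp m"
  then have "ubp_mult l g \<in> L" by (intro L_mult_G) auto
  then show "supp (bvec (ubp_mult l g)) \<subseteq> L" by simp
qed

text \<open>\<open>ct_basis\<close> turns the product \<open>l g\<close> into a composition, and its
  inner factor is the action of \<open>g\<close> on the group module.\<close>

lemma phi_balanced:
  assumes m: "supp m \<subseteq> L" and g: "g \<in> carrier G" and v: "supp v \<subseteq> V"
  shows "phi (L_ract m g, v) = phi (m, V_act k lam g v)"
proof -
  have "phi (L_ract m g, v) = lin_ext (\<lambda>l. lin_ext (ct_basis (ubp_mult l g)) v) m"
    by (simp add: phi_def L_ract_def lin_ext_lin_ext)
  also have "\<dots> = lin_ext (\<lambda>l. lin_ext (ct_basis l) (lin_ext (ct_basis g) v)) m"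
  proof (rule lin_ext_cong)
    fix l assume "l \<in> supp m"
    then have l: "l \<in> ubp_set k" using m by (auto simp: L_iff)
    have g': "g \<in> ubp_set k" using g by (simp add: G_iff)
    have "lin_ext (ct_basis (ubp_mult l g)) v = lin_ext (\<lambda>T. lin_ext (ct_basis l) (ct_basis g T)) v"
      by (rule lin_ext_cong) (use v V_block_filling in \<open>blast intro: ct_basis_mult[OF l g']\<close>)
    then show "lin_ext (ct_basis (ubp_mult l g)) v = lin_ext (ct_basis l) (lin_ext (ct_basis g) v)"
      by (simp add: lin_ext_lin_ext)
  qed
  also have "\<dots> = phi (m, V_act k lam g v)"
    unfolding V_act_eq[OF g v] by (simp add: phi_def)
  finally show ?thesis .
qed

lemma rels_kerI:
  assumes "supp x \<subseteq> MV" "lin_ext phi x = 0"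
  shows "x \<in> fq.ker"
  using assms by (simp add: fq.ker_def)

lemma rels_ker: "rels \<subseteq> fq.ker"
proof
  fix x assume "x \<in> rels"
  then consider
      (1) m m' v where "supp m \<subseteq> L" "supp m' \<subseteq> L" "supp v \<subseteq> V"
        "x = bvec (m + m', v) - bvec (m, v) - bvec (m', v)"
    | (2) m v v' where "supp m \<subseteq> L" "supp v \<subseteq> V" "supp v' \<subseteq> V"
        "x = bvec (m, v + v') - bvec (m, v) - bvec (m, v')"
    | (3) c m v where "supp m \<subseteq> L" "supp v \<subseteq> V" "x = bvec (scale c m, v) - scale c (bvec (m, v))"
    | (4) c m v where "supp m \<subseteq> L" "supp v \<subseteq> V" "x = bvec (m, scale c v) - scale c (bvec (m, v))"
    | (5) m g v where "supp m \<subseteq> L" "g \<in> carrier G" "supp v \<subseteq> V"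
        "x = bvec (L_ract m g, v) - bvec (m, V_act k lam g v)"
    unfolding tensor_rels_def V_mod_eq free_mod_simps mem_Collect_eq Un_iff by blast
  then show "x \<in> fq.ker"
  proof cases
    case 1
    show ?thesis
      unfolding 1(4)
    proof (rule rels_kerI)
      show "supp (bvec (m + m', v) - bvec (m, v) - bvec (m', v)) \<subseteq> MV"
        by (intro fq.supp_diff) (use 1 supp_add[of m L m'] in simp_all)
    qed (simp add: lin_ext_diff phi_simps)
  next
    case 2
    show ?thesis
      unfolding 2(4)
    proof (rule rels_kerI)
      show "supp (bvec (m, v + v') - bvec (m, v) - bvec (m, v')) \<subseteq> MV"
        by (intro fq.supp_diff) (use 2 supp_add[of v V v'] in simp_all)
    qed (simp add: lin_ext_diff phi_simps)
  next
    case 3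
    show ?thesis
      unfolding 3(3)
    proof (rule rels_kerI)
      show "supp (bvec (scale c m, v) - scale c (bvec (m, v))) \<subseteq> MV"
        by (intro fq.supp_diff supp_scale_subset) (use 3 supp_scale_subset[of m L c] in simp_all)
    qed (simp add: lin_ext_diff lin_ext_scale phi_simps)
  next
    case 4
    show ?thesis
      unfolding 4(3)
    proof (rule rels_kerI)
      show "supp (bvec (m, scale c v) - scale c (bvec (m, v))) \<subseteq> MV"
        by (intro fq.supp_diff supp_scale_subset) (use 4 supp_scale_subset[of v V c] in simp_all)
    qed (simp add: lin_ext_diff lin_ext_scale phi_simps)
  next
    case 5
    show ?thesis
      unfolding 5(4)
    proof (rule rels_kerI)
      show "supp (bvec (L_ract m g, v) - bvec (m, V_act k lam g v)) \<subseteq> MV"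
        by (intro fq.supp_diff) (use 5 L_ract_closed V_act_closed in simp_all)
    qed (simp add: lin_ext_diff phi_balanced[OF 5(1-3)])
  qed
qed

lemma relsI:
  "supp m \<subseteq> L \<Longrightarrow> supp m' \<subseteq> L \<Longrightarrow> supp v \<subseteq> V \<Longrightarrow> bvec (m + m', v) - bvec (m, v) - bvec (m', v) \<in> rels"
  "supp m \<subseteq> L \<Longrightarrow> supp v \<subseteq> V \<Longrightarrow> supp v' \<subseteq> V \<Longrightarrow> bvec (m, v + v') - bvec (m, v) - bvec (m, v') \<in> rels"
  "supp m \<subseteq> L \<Longrightarrow> supp v \<subseteq> V \<Longrightarrow> bvec (scale c m, v) - scale c (bvec (m, v)) \<in> rels"
  "supp m \<subseteq> L \<Longrightarrow> supp v \<subseteq> V \<Longrightarrow> bvec (m, scale c v) - scale c (bvec (m, v)) \<in> rels"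
  "supp m \<subseteq> L \<Longrightarrow> g \<in> carrier G \<Longrightarrow> supp v \<subseteq> V \<Longrightarrow> bvec (L_ract m g, v) - bvec (m, V_act k lam g v) \<in> rels"
  unfolding tensor_rels_def V_mod_eq free_mod_simps mem_Collect_eq Un_iff by blast+

lemma scale_diff: "scale c (p - q) = scale c p - scale c q"
  by (rule poly_mapping_eqI) (simp add: lookup_minus right_diff_distrib)

text \<open>With \<open>\<gamma>\<close> the top of \<open>l\<close>, the group element is
  \<open>g = ell \<pi> \<gamma>\<close> times \<open>l\<close>. The product of the two
  \<open>ell\<close> diagrams is the idempotent of \<open>\<gamma>\<close>, which is neutral on the
  left of \<open>l\<close>.\<close>

lemma L_factor:
  assumes l: "l \<in> L"
  obtains \<gamma> g where "\<gamma> \<in> parts" "g \<in> carrier G" "ubp_mult (ell \<gamma> \<pi>) g = l"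
proof
  have l': "l \<in> ubp_set k" "bot_part l = \<pi>" using l by (simp_all add: L_iff)
  let ?\<gamma> = "top_part l"
  show \<gamma>: "?\<gamma> \<in> parts"
    using top_part_partition[OF l'(1)] top_bot_set_type[OF l'(1)] l'(2) pi_spec(2) by (simp add: parts_iff)
  interpret same_type k ?\<gamma> \<pi> by (rule same_type[OF \<gamma> pi_in_parts])
  interpret sym: same_type k \<pi> ?\<gamma> by (rule same_type[OF pi_in_parts \<gamma>])
  let ?g = "ubp_mult (ell \<pi> ?\<gamma>) l"
  show "?g \<in> carrier G"
    using bot_part_mult[OF sym.ell_ubp l'(1) sym.bot_part_ell] sym.top_part_ell l'(2)
      ubp_mult_closed[OF sym.ell_ubp l'(1)] by (simp add: G_iff)
  have "ubp_mult (ell ?\<gamma> \<pi>) ?g = ubp_mult (ubp_mult (ell ?\<gamma> \<pi>) (ell \<pi> ?\<gamma>)) l"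
    using monoid.m_assoc[OF monoid_ubp, of "ell ?\<gamma> \<pi>" k "ell \<pi> ?\<gamma>" l] ell_ubp sym.ell_ubp l'(1)
    by (simp add: ubp_def)
  also have "\<dots> = l"
    unfolding ell_mult_inverse[OF same_type_axioms] by (rule e_diag_top_mult[OF l'(1)])
  finally show "ubp_mult (ell ?\<gamma> \<pi>) ?g = l" .
qed

text \<open>The defect \<open>t b\<close> compares a generator with its normal form. The bilinearity
  relations reduce it to pairs of basis vectors, and factoring \<open>l\<close> moves a group
  element across the tensor sign. What is left involves only diagrams \<open>ell\<close>, for which
  the defect is zero.\<close>

lemma reduce_mod_rels:
  assumes N: "submodule N CC (free_mod MV)" and rels: "rels \<subseteq> N" and b: "b \<in> MV"
  shows "bvec b - lin_ext sect (phi b) \<in> N"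
proof -
  have N0: "0 \<in> N" and Nadd: "\<And>p q. p \<in> N \<Longrightarrow> q \<in> N \<Longrightarrow> p + q \<in> N"
    and Nsc: "\<And>c p. p \<in> N \<Longrightarrow> scale c p \<in> N"
    using N unfolding submodule_free_mod_iff by blast+
  note r = relsI[THEN subsetD[OF rels]]
  define t where "t b = bvec b - lin_ext sect (phi b)" for b
  have t_v: "t (m, v) \<in> N"
    if m: "supp m \<subseteq> L" and v: "supp v \<subseteq> V" and base: "\<And>T. T \<in> V \<Longrightarrow> t (m, bvec T) \<in> N" for m v
    using v
  proof (rule free_mod_induct[where Q = "\<lambda>v. t (m, v) \<in> N"])
    \<comment> \<open>The generator at \<open>(m, 0)\<close> is not zero in the free space; the
      relation for the scalar \<open>0\<close> puts it into \<open>N\<close>.\<close>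
    show "t (m, 0) \<in> N"
      using r(4)[OF m, of 0 0] phi_simps(4)[of m 0 0] by (simp add: t_def)
    fix p q assume pq: "supp p \<subseteq> V" "supp q \<subseteq> V" "t (m, p) \<in> N" "t (m, q) \<in> N"
    have "t (m, p + q) = (bvec (m, p + q) - bvec (m, p) - bvec (m, q)) + (t (m, p) + t (m, q))"
      by (simp add: t_def phi_simps lin_ext_add)
    then show "t (m, p + q) \<in> N" using Nadd[OF r(2)[OF m pq(1,2)] Nadd[OF pq(3,4)]] by simp
  next
    fix c p assume p: "supp p \<subseteq> V" "t (m, p) \<in> N"
    have "t (m, scale c p) = (bvec (m, scale c p) - scale c (bvec (m, p))) + scale c (t (m, p))"
      by (simp only: t_def phi_simps lin_ext_scale scale_diff) simp
    then show "t (m, scale c p) \<in> N" using Nadd[OF r(4)[OF m p(1)] Nsc[OF p(2)]] by simp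
  qed (rule base)
  have t_m: "t (m, v) \<in> N"
    if m: "supp m \<subseteq> L" and v: "supp v \<subseteq> V" and base: "\<And>l. l \<in> L \<Longrightarrow> t (bvec l, v) \<in> N" for m v
    using m
  proof (rule free_mod_induct[where Q = "\<lambda>m. t (m, v) \<in> N"])
    show "t (0, v) \<in> N"
      using r(3)[of 0 v 0] v phi_simps(3)[of 0 0 v] by (simp add: t_def)
    fix p q assume pq: "supp p \<subseteq> L" "supp q \<subseteq> L" "t (p, v) \<in> N" "t (q, v) \<in> N"
    have "t (p + q, v) = (bvec (p + q, v) - bvec (p, v) - bvec (q, v)) + (t (p, v) + t (q, v))"
      by (simp add: t_def phi_simps lin_ext_add)
    then show "t (p + q, v) \<in> N" using Nadd[OF r(1)[OF pq(1,2) v] Nadd[OF pq(3,4)]] by simp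
  next
    fix c p assume p: "supp p \<subseteq> L" "t (p, v) \<in> N"
    have "t (scale c p, v) = (bvec (scale c p, v) - scale c (bvec (p, v))) + scale c (t (p, v))"
      by (simp only: t_def phi_simps lin_ext_scale scale_diff) simp
    then show "t (scale c p, v) \<in> N" using Nadd[OF r(3)[OF p(1) v] Nsc[OF p(2)]] by simp
  qed (rule base)
  have t_ell: "t (bvec (ell \<gamma> \<pi>), bvec T) = 0" if \<gamma>: "\<gamma> \<in> parts" and T: "T \<in> V" for \<gamma> T
  proof -
    have "entries k lam (relabel k lam \<pi> \<gamma> T) = \<gamma>"
      by (rule tabs_uniform(2)[OF \<gamma> relabel_tabs[OF pi_in_parts \<gamma> T]])
    then have "sect (relabel k lam \<pi> \<gamma> T) = bvec (bvec (ell \<gamma> \<pi>), bvec T)"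
      using relabel_inverse[OF pi_in_parts \<gamma> T] by (simp add: sect_def)
    then show ?thesis by (simp add: t_def phi_ell[OF \<gamma> T])
  qed
  have t_bas: "t (bvec l, bvec T) \<in> N" if l: "l \<in> L" and T: "T \<in> V" for l T
  proof -
    obtain \<gamma> g where \<gamma>: "\<gamma> \<in> parts" and g: "g \<in> carrier G" and eq: "ubp_mult (ell \<gamma> \<pi>) g = l"
      using l by (rule L_factor)
    let ?e = "bvec (ell \<gamma> \<pi>)" and ?w = "V_act k lam g (bvec T)"
    have e: "supp ?e \<subseteq> L" using ell_L[OF \<gamma>] by simp
    have vT: "supp (bvec T) \<subseteq> V" using T by simp
    have ract: "L_ract ?e g = bvec l" by (simp add: L_ract_def eq)
    \<comment> \<open>Straightening makes \<open>?w\<close> a combination of tableaux instead of a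
      single one, so linearity in the second argument is used once more.\<close>
    have "t (?e, ?w) \<in> N"
      by (rule t_v[OF e V_act_closed[OF g vT]]) (simp add: t_ell[OF \<gamma>] N0)
    moreover have "t (bvec l, bvec T) = (bvec (L_ract ?e g, bvec T) - bvec (?e, ?w)) + t (?e, ?w)"
      using phi_balanced[OF e g vT] by (simp add: t_def ract)
    ultimately show ?thesis using Nadd[OF r(5)[OF e g vT]] by simp
  qed
  obtain m v where mv: "b = (m, v)" "supp m \<subseteq> L" "supp v \<subseteq> V" using b by blast
  have "t (m, v) \<in> N"
  proof (rule t_m[OF mv(2,3)])
    fix l assume l: "l \<in> L"
    show "t (bvec l, v) \<in> N" by (rule t_v[OF _ mv(3) t_bas[OF l]]) (use l in simp)
  qed
  then show ?thesis by (simp add: t_def mv(1))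
qed

lemma tensor_ker_eq: "tensor_ker G (free_mod L) L_ract (V_mod k lam) (V_act k lam) = fq.ker"
  unfolding tensor_ker_def tensor_free_eq by (rule fq.submod_gen_eq_ker[OF rels_ker reduce_mod_rels])

lemma W_mod_eq: "W_mod k lam = quot_mod (free_mod MV) fq.ker"
  by (simp only: W_mod_def Let_def tensor_mod_def tensor_ker_eq tensor_free_eq)

lemma W_elt_eq:
  assumes "\<gamma> \<in> parts" "T \<in> V"
  shows "W_elt k lam \<gamma> T = fq.fib (bvec (relabel k lam \<pi> \<gamma> T))"
proof -
  have "supp (bvec (bvec (ell \<gamma> \<pi>), bvec T)) \<subseteq> MV" using ell_L[OF assms(1)] assms(2) by simp
  from fq.coset_eq_fib[OF this] show ?thesis
    by (simp only: W_elt_def Let_def pure_tensor_def tensor_ker_eq tensor_free_eq lin_ext_bvec phi_ell[OF assms])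
qed

lemma L_lact_closed: "d \<in> ubp_set k \<Longrightarrow> supp (L_lact k \<pi> d m) \<subseteq> L"
  unfolding L_lact_def by (rule supp_lin_ext) simp

text \<open>The two conventions for zero agree: when \<open>ubp_mult d l\<close> leaves
  \<open>L\<close>, some block of \<open>\<pi>\<close> is not saturated for it, so the closed
  formula vanishes as well.\<close>

lemma phi_L_lact:
  assumes d: "d \<in> ubp_set k" and m: "supp m \<subseteq> L" and v: "supp v \<subseteq> V"
  shows "phi (L_lact k \<pi> d m, v) = lin_ext (ct_basis d) (phi (m, v))"
proof -
  have "phi (L_lact k \<pi> d m, v) = lin_ext (\<lambda>l. phi (if ubp_mult d l \<in> L then bvec (ubp_mult d l) else 0, v)) m"
    by (simp add: phi_def L_lact_def lin_ext_lin_ext)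
  also have "\<dots> = lin_ext (\<lambda>l. lin_ext (ct_basis d) (lin_ext (ct_basis l) v)) m"
  proof (rule lin_ext_cong)
    fix l assume "l \<in> supp m"
    then have l: "l \<in> L" "l \<in> ubp_set k" using m by (auto simp: L_iff)
    have "lin_ext (ct_basis (ubp_mult d l)) v = lin_ext (\<lambda>T. lin_ext (ct_basis d) (ct_basis l T)) v"
      by (rule lin_ext_cong) (use v V_block_filling in \<open>blast intro: ct_basis_mult[OF d l(2)]\<close>)
    then have mult: "lin_ext (ct_basis (ubp_mult d l)) v = lin_ext (ct_basis d) (lin_ext (ct_basis l) v)"
      by (simp add: lin_ext_lin_ext)
    show "phi (if ubp_mult d l \<in> L then bvec (ubp_mult d l) else 0, v) =
        lin_ext (ct_basis d) (lin_ext (ct_basis l) v)"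
    proof (cases "ubp_mult d l \<in> L")
      case True
      then show ?thesis using mult by (simp add: phi_simps)
    next
      case False
      have "lin_ext (ct_basis (ubp_mult d l)) v = lin_ext (\<lambda>_. 0) v"
        by (rule lin_ext_cong) (use v ct_basis_outside[OF d l(1) False] in blast)
      also have "\<dots> = 0" by (simp add: lin_ext_def)
      finally show ?thesis using False mult by (simp add: phi_def)
    qed
  qed
  also have "\<dots> = lin_ext (ct_basis d) (phi (m, v))" by (simp add: phi_def lin_ext_lin_ext)
  finally show ?thesis .
qed

definition lact :: "diagram \<Rightarrow> ((diagram \<Rightarrow>\<^sub>0 complex) \<times> (tableaux \<Rightarrow>\<^sub>0 complex) \<Rightarrow>\<^sub>0 complex) \<Rightarrow>
    ((diagram \<Rightarrow>\<^sub>0 complex) \<times> (tableaux \<Rightarrow>\<^sub>0 complex) \<Rightarrow>\<^sub>0 complex)" where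
  "lact d = lin_ext (\<lambda>(m, v). bvec (L_lact k \<pi> d m, v))"

lemma lact_spec:
  assumes d: "d \<in> carrier (ubp k)" and x: "supp x \<subseteq> MV"
  shows "supp (lact d x) \<subseteq> MV \<and> lin_ext phi (lact d x) = CT_act k lam d (lin_ext phi x)"
proof
  have d': "d \<in> ubp_set k" using d by (simp add: ubp_def)
  show "supp (lact d x) \<subseteq> MV"
    unfolding lact_def
  proof (rule supp_lin_ext)
    fix b assume "b \<in> supp x"
    then obtain m v where "b = (m, v)" "supp v \<subseteq> V" using x by blast
    then show "supp (case b of (m, v) \<Rightarrow> bvec (L_lact k \<pi> d m, v)) \<subseteq> MV"
      using L_lact_closed[OF d', of m] by simp
  qed
  have "lin_ext phi (lact d x) = lin_ext (\<lambda>b. lin_ext (ct_basis d) (phi b)) x"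
    unfolding lact_def lin_ext_lin_ext
  proof (rule lin_ext_cong)
    fix b assume "b \<in> supp x"
    then obtain m v where "b = (m, v)" "supp m \<subseteq> L" "supp v \<subseteq> V" using x by blast
    then show "lin_ext phi (case b of (m, v) \<Rightarrow> bvec (L_lact k \<pi> d m, v)) = lin_ext (ct_basis d) (phi b)"
      using phi_L_lact[OF d'] by simp
  qed
  also have "\<dots> = lin_ext (ct_basis d) (lin_ext phi x)" by (simp add: lin_ext_lin_ext)
  also have "\<dots> = CT_act k lam d (lin_ext phi x)"
    by (rule CT_act_eq[OF d', symmetric]) (simp add: CT_carrier fq.\<phi>_supp[OF x])
  finally show "lin_ext phi (lact d x) = CT_act k lam d (lin_ext phi x)" .
qed

lemma W_act_eq: "W_act k lam d Y = fq.ker <+>\<^bsub>free_mod MV\<^esub> (lact d ` Y)"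
  by (simp only: W_act_def Let_def tensor_left_def tensor_ker_eq tensor_free_eq lact_def)

text \<open>By \<open>W_elt_eq\<close> the elements are the fibres over basis vectors, and
  \<open>relabel_bij\<close> matches their index set with the uniform tableaux.\<close>

lemma W_basis: "is_basis (W_mod k lam) (parts \<times> V) (\<lambda>(\<gamma>, T). W_elt k lam \<gamma> T)"
  unfolding W_mod_eq
proof (rule fq.is_basis_W[OF _ relabel_bij])
  show "finite (parts \<times> V)" by (rule finite_cartesian_product[OF finite_parts finite_tabs[OF pi_in_parts]])
  fix i assume "i \<in> parts \<times> V"
  then obtain \<gamma> T where "i = (\<gamma>, T)" "\<gamma> \<in> parts" "T \<in> V" by blast
  then show "(case i of (\<gamma>, T) \<Rightarrow> W_elt k lam \<gamma> T) =
      fq.fib (bvec (case i of (\<gamma>, T) \<Rightarrow> relabel k lam \<pi> \<gamma> T))"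
    using W_elt_eq by simp
qed

lemma W_iso: "rep_iso (ubp k) (W_mod k lam) (W_act k lam) (CT_mod k lam) (CT_act k lam) fq.rho"
  unfolding W_mod_eq CT_mod_def
  by (rule fq.rep_iso_rho[OF representation_CT[unfolded CT_mod_def] lact_spec W_act_eq])

lemma rho_W_elt:
  assumes "\<gamma> \<in> parts" "T \<in> V"
  shows "fq.rho (W_elt k lam \<gamma> T) = bvec (relabel k lam \<pi> \<gamma> T)"
  unfolding W_elt_eq[OF assms]
  by (rule fq.rho_fib) (simp add: tabs_uniform(1)[OF assms(1) relabel_tabs[OF pi_in_parts assms]])

lemma W_isomorphic: "\<exists>\<rho>. (\<forall>\<gamma>\<in>parts. \<forall>T\<in>V. \<rho> (W_elt k lam \<gamma> T) = bvec (relabel k lam \<pi> \<gamma> T)) \<and>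
    rep_iso (ubp k) (W_mod k lam) (W_act k lam) (CT_mod k lam) (CT_act k lam) \<rho>"
  using rho_W_elt W_iso by blast

end

theorem theorem3p24:
  fixes k :: nat and lam :: "nat \<Rightarrow> nat list"
  assumes "k \<ge> 1" and "lam \<in> index_set k"
  shows "is_basis (W_mod k lam)
      (set_partitions_of_type k (vec_type k lam) \<times> pi_tableaux k lam (pi_of (vec_type k lam)))
      (\<lambda>(\<gamma>, T). W_elt k lam \<gamma> T) \<and>
    (\<exists>\<rho>. (\<forall>\<gamma> \<in> set_partitions_of_type k (vec_type k lam).
            \<forall>T \<in> pi_tableaux k lam (pi_of (vec_type k lam)).
              \<rho> (W_elt k lam \<gamma> T) = bvec (relabel k lam (pi_of (vec_type k lam)) \<gamma> T)) \<and>
         rep_iso (ubp k) (W_mod k lam) (W_act k lam) (CT_mod k lam) (CT_act k lam) \<rho>)"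
proof -
  interpret shape k lam by unfold_locales (rule assms(2))
  show ?thesis unfolding pi_tableaux_eq by (rule conjI[OF W_basis W_isomorphic])
qed

end
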